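(* Let $f\colon M\to\mathbf{R}^3$ be a $C^2$-immersed surface with positive Gauss curvature everywhere. Then the tantrix of any $C^2$ figure-eight on $M$ is a ($C^1$) figure-eight on $\mathbf{S}^2$. In particular, $M$ admits no skew $C^2$ figure-eights.
   Context: A $C^k$ immersed loop is a $C^k$ map with nowhere-vanishing velocity, defined on $\mathbf{S}^1\simeq\mathbf{R}/2\pi$. A loop $\alpha\colon\mathbf{S}^1\to M$ is identified with the loop $\gamma=f\circ\alpha$ in $\mathbf{R}^3$; its tantrix is the map $\tau\colon\mathbf{S}^1\to\mathbf{S}^2$, $\tau(t)=\gamma'(t)/\|\gamma'(t)\|$, and the loop is skew if $\gamma'(t)\times\gamma'(s)\ne 0$ for all distinct $t,s\in\mathbf{R}/2\pi$. A regular homotopy is a deformation of loops through immersed loops (continuous in the $C^1$ sense). Identify $\mathbf{R}^2\simeq\mathbf{C}$; the standard figure-eight is the loop $\gamma_0(e^{it})=\cos t\,(1+i\sin t)$. A $C^k$ figure-eight $\alpha$ on a surface $M$ is any $C^k$ immersed loop on $M$ regularly homotopic in $M$ to a loop $\beta$ contained in an open coordinate disc $\phi\colon U\to\mathbf{R}^2$, $U\subset M$, with $\phi\circ\beta=\gamma_0$. *)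

theory Defs
  imports "HOL-Analysis.Analysis" "HOL-Library.Extended_Nat"
begin

section \<open>Maps of class $C^k$ on open sets\<close>

text \<open>
  In finite dimensions, continuity of all iterated directional derivatives is
  the usual condition; the set \<open>S\<close> is always meant to be open.
\<close>

primrec Ck_on :: "nat \<Rightarrow> ('a::real_normed_vector \<Rightarrow> 'b::real_normed_vector) \<Rightarrow> 'a set \<Rightarrow> bool" where
  "Ck_on 0 g S \<longleftrightarrow> continuous_on S g"
| "Ck_on (Suc k) g S \<longleftrightarrow>
     (\<forall>x\<in>S. g differentiable (at x)) \<and> (\<forall>v. Ck_on k (\<lambda>x. frechet_derivative g (at x) v) S)"

definition Cr_on :: "enat \<Rightarrow> ('a::real_normed_vector \<Rightarrow> 'b::real_normed_vector) \<Rightarrow> 'a set \<Rightarrow> bool" where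
  "Cr_on r g S \<longleftrightarrow> (\<forall>k. enat k \<le> r \<longrightarrow> Ck_on k g S)"


section \<open>Surfaces\<close>

text \<open>
  A surface is a topology together with an atlas; the plane is identified with
  \<^typ>\<open>complex\<close>. A chart is a pair \<open>(U, \<phi>)\<close>, and only the values of \<open>\<phi>\<close>
  on \<open>U\<close> matter.
\<close>

type_synonym 'a chart = "'a set \<times> ('a \<Rightarrow> complex)"

definition is_chart :: "'a topology \<Rightarrow> 'a chart \<Rightarrow> bool" where
  "is_chart M = (\<lambda>(U, \<phi>). openin M U \<and> open (\<phi> ` U) \<and>
     homeomorphic_map (subtopology M U) (top_of_set (\<phi> ` U)) \<phi>)"

definition compatible :: "enat \<Rightarrow> 'a chart \<Rightarrow> 'a chart \<Rightarrow> bool" where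
  "compatible r = (\<lambda>(U, \<phi>) (V, \<psi>).
     Cr_on r (\<psi> \<circ> inv_into U \<phi>) (\<phi> ` (U \<inter> V)) \<and>
     Cr_on r (\<phi> \<circ> inv_into V \<psi>) (\<psi> ` (U \<inter> V)))"

definition is_surface :: "enat \<Rightarrow> 'a topology \<Rightarrow> 'a chart set \<Rightarrow> bool" where
  "is_surface r M A \<longleftrightarrow>
     Hausdorff_space M \<and>
     (\<exists>B. countable B \<and> (\<forall>V\<in>B. openin M V) \<and>
        (\<forall>W x. openin M W \<and> x \<in> W \<longrightarrow> (\<exists>V\<in>B. x \<in> V \<and> V \<subseteq> W))) \<and>
     (\<forall>c\<in>A. is_chart M c) \<and>
     topspace M = (\<Union>c\<in>A. fst c) \<and>
     (\<forall>c\<in>A. \<forall>d\<in>A. compatible r c d)"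

text \<open>
  The atlas is not assumed maximal, so the coordinate charts of the surface are
  all the charts compatible with it.
\<close>

definition coordinate_disc :: "enat \<Rightarrow> 'a topology \<Rightarrow> 'a chart set \<Rightarrow> 'a chart \<Rightarrow> bool" where
  "coordinate_disc r M A c \<longleftrightarrow>
     is_chart M c \<and> (\<forall>d\<in>A. compatible r c d) \<and> (\<exists>z \<rho>. \<rho> > 0 \<and> snd c ` fst c = ball z \<rho>)"


section \<open>Immersed loops, regular homotopies and figure-eights\<close>

text \<open>Loops are maps of the real line with period $2\pi$.\<close>

definition is_loop :: "'a topology \<Rightarrow> (real \<Rightarrow> 'a) \<Rightarrow> bool" where
  "is_loop M \<alpha> \<longleftrightarrow> continuous_map euclideanreal M \<alpha> \<and> (\<forall>t. \<alpha> (t + 2 * pi) = \<alpha> t)"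

definition immersed_loop :: "nat \<Rightarrow> 'a topology \<Rightarrow> 'a chart set \<Rightarrow> (real \<Rightarrow> 'a) \<Rightarrow> bool" where
  "immersed_loop k M A \<alpha> \<longleftrightarrow> is_loop M \<alpha> \<and>
     (\<forall>(U, \<phi>)\<in>A. Ck_on k (\<phi> \<circ> \<alpha>) {t. \<alpha> t \<in> U} \<and>
        (\<forall>t. \<alpha> t \<in> U \<longrightarrow> vector_derivative (\<phi> \<circ> \<alpha>) (at t) \<noteq> 0))"

text \<open>
  Continuity in the $C^1$ sense: the position and, in every chart of the atlas,
  the velocity depend continuously on the pair of homotopy parameter and time.
\<close>

definition regularly_homotopic ::
    "'a topology \<Rightarrow> 'a chart set \<Rightarrow> (real \<Rightarrow> 'a) \<Rightarrow> (real \<Rightarrow> 'a) \<Rightarrow> bool" where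
  "regularly_homotopic M A \<alpha> \<beta> \<longleftrightarrow>
     (\<exists>h. h 0 = \<alpha> \<and> h 1 = \<beta> \<and>
        (\<forall>s\<in>{0..1}. immersed_loop 1 M A (h s)) \<and>
        continuous_map (top_of_set ({0..1} \<times> UNIV)) M (\<lambda>(s::real, t). h s t) \<and>
        (\<forall>(U, \<phi>)\<in>A. continuous_on {(s, t). s \<in> {0..1} \<and> h s t \<in> U}
            (\<lambda>(s, t). vector_derivative (\<phi> \<circ> h s) (at t))))"

definition standard_figure_eight :: "real \<Rightarrow> complex" where
  "standard_figure_eight t = of_real (cos t) * (1 + \<i> * of_real (sin t))"

text \<open>
  Here \<open>k\<close> is the class of the loop and \<open>r\<close> the class of the surface, hence of
  its coordinate charts.
\<close>

definition figure_eight ::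
    "enat \<Rightarrow> nat \<Rightarrow> 'a topology \<Rightarrow> 'a chart set \<Rightarrow> (real \<Rightarrow> 'a) \<Rightarrow> bool" where
  "figure_eight r k M A \<alpha> \<longleftrightarrow> immersed_loop k M A \<alpha> \<and>
     (\<exists>\<beta> U \<phi>. regularly_homotopic M A \<alpha> \<beta> \<and> coordinate_disc r M A (U, \<phi>) \<and>
        (\<forall>t. \<beta> t \<in> U \<and> \<phi> (\<beta> t) = standard_figure_eight t))"


section \<open>Immersions into space and Gauss curvature\<close>

definition local_param :: "('a \<Rightarrow> real^3) \<Rightarrow> 'a chart \<Rightarrow> complex \<Rightarrow> real^3" where
  "local_param f = (\<lambda>(U, \<phi>). f \<circ> inv_into U \<phi>)"

definition is_immersion :: "nat \<Rightarrow> 'a chart set \<Rightarrow> ('a \<Rightarrow> real^3) \<Rightarrow> bool" where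
  "is_immersion k A f \<longleftrightarrow>
     (\<forall>(U, \<phi>)\<in>A. Ck_on k (local_param f (U, \<phi>)) (\<phi> ` U) \<and>
        (\<forall>z\<in>\<phi> ` U. inj (frechet_derivative (local_param f (U, \<phi>)) (at z))))"

definition partial :: "complex \<Rightarrow> (complex \<Rightarrow> real^3) \<Rightarrow> complex \<Rightarrow> real^3" where
  "partial v X z = frechet_derivative X (at z) v"

definition unit_normal :: "(complex \<Rightarrow> real^3) \<Rightarrow> complex \<Rightarrow> real^3" where
  "unit_normal X z =
     (let n = cross3 (partial 1 X z) (partial \<i> X z) in n /\<^sub>R norm n)"

definition first_form :: "(complex \<Rightarrow> real^3) \<Rightarrow> complex \<Rightarrow> complex \<Rightarrow> complex \<Rightarrow> real" where
  "first_form X z v w = partial v X z \<bullet> partial w X z"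

definition second_form :: "(complex \<Rightarrow> real^3) \<Rightarrow> complex \<Rightarrow> complex \<Rightarrow> complex \<Rightarrow> real" where
  "second_form X z v w = partial v (partial w X) z \<bullet> unit_normal X z"

definition gauss_curvature :: "(complex \<Rightarrow> real^3) \<Rightarrow> complex \<Rightarrow> real" where
  "gauss_curvature X z =
     (second_form X z 1 1 * second_form X z \<i> \<i> - (second_form X z 1 \<i>)\<^sup>2) /
     (first_form X z 1 1 * first_form X z \<i> \<i> - (first_form X z 1 \<i>)\<^sup>2)"

text \<open>
  The Gauss curvature does not depend on the chart in which it is computed, so
  every chart of the atlas around a point may be used.
\<close>

definition positively_curved :: "'a chart set \<Rightarrow> ('a \<Rightarrow> real^3) \<Rightarrow> bool" where
  "positively_curved A f \<longleftrightarrow>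
     (\<forall>(U, \<phi>)\<in>A. \<forall>p\<in>U. gauss_curvature (local_param f (U, \<phi>)) (\<phi> p) > 0)"


section \<open>Tantrices and skew loops\<close>

definition tantrix :: "('a \<Rightarrow> real^3) \<Rightarrow> (real \<Rightarrow> 'a) \<Rightarrow> real \<Rightarrow> real^3" where
  "tantrix f \<alpha> t =
     (let v = vector_derivative (f \<circ> \<alpha>) (at t) in v /\<^sub>R norm v)"

definition skew_loop :: "('a \<Rightarrow> real^3) \<Rightarrow> (real \<Rightarrow> 'a) \<Rightarrow> bool" where
  "skew_loop f \<alpha> \<longleftrightarrow>
     (\<forall>s t. (\<nexists>m::int. t - s = 2 * pi * of_int m) \<longrightarrow>
        cross3 (vector_derivative (f \<circ> \<alpha>) (at t)) (vector_derivative (f \<circ> \<alpha>) (at s)) \<noteq> 0)"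


section \<open>The unit sphere as a smooth surface\<close>

abbreviation S2 :: "(real^3) topology" where
  "S2 \<equiv> top_of_set (sphere 0 1)"

text \<open>
  Stereographic projections from the two poles \<open>(0, 0, \<epsilon>)\<close>, \<open>\<epsilon> = 1\<close> or \<open>\<epsilon> = - 1\<close>.
\<close>

definition stereographic_chart :: "real \<Rightarrow> (real^3) chart" where
  "stereographic_chart \<epsilon> =
     ({x \<in> sphere 0 1. x $ 3 \<noteq> \<epsilon>},
      \<lambda>x. Complex (x $ 1 / (1 - \<epsilon> * x $ 3)) (x $ 2 / (1 - \<epsilon> * x $ 3)))"

definition S2_atlas :: "(real^3) chart set" where
  "S2_atlas = {stereographic_chart 1, stereographic_chart (- 1)}"

end

theory Submission
  imports Defs
begin

text \<open>
  Positive curvature singles out at every point of the surface the unit normal \<open>N\<close> towards which the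
  surface bends, and the tantrix \<open>\<tau>\<close> of a \<open>C\<^sup>2\<close> loop satisfies \<open>\<tau>' \<bullet> N > 0\<close>. So \<open>\<tau>\<close> is immersed, and
  its frame \<open>(\<tau>, \<tau>')\<close> can be deformed to \<open>(\<tau>, N)\<close>, which depends only on the first derivative of the
  loop and hence follows a regular homotopy on the surface. For a figure-eight contracted to a point
  the velocity direction has degree zero; therefore the frame loop of \<open>\<tau>\<close> lifts to a closed loop
  in the double cover \<open>S\<^sup>3\<close> of the rotation group.

  Conversely a closed lift makes an immersed spherical loop a figure-eight. Rotate the loop off the
  north pole and project it stereographically: the lift closes up if and only if the turning number
  \<open>k\<close> of the projection is even. By the Whitney--Graustein theorem the projection is determined by
  \<open>k\<close>, and a circle traversed \<open>k = 2m \<noteq> 0\<close> times can be tilted on the sphere into the \<open>m\<close>-fold Viviani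
  curve, which has turning number \<open>0\<close> when seen from another pole.

  If the loop is skew, then \<open>\<tau> t\<close> and \<open>\<tau> s\<close> span a plane for all \<open>t < s < t + 2\<pi>\<close>, and as \<open>s\<close> tends to \<open>t\<close>
  the frame spanned by the chord becomes \<open>(\<tau>, \<tau>')\<close>. Interchanging the two points twice, along
  \<open>(t, s) \<mapsto> (s, t + 2\<pi>)\<close>, multiplies the lift by the square of an imaginary unit quaternion, that is
  by \<open>-1\<close>; hence the lift of the frame of a skew loop is not closed.
\<close>

section \<open>Spin lifts of orthonormal frames\<close>

text \<open>The invariant behind the proof is the class of a frame loop in the fundamental group of
  SO(3), a group of order two. By Smale's classification it determines the regular homotopy class of
  an immersed spherical loop, and figure-eights are the trivial class; explicit moves take the place
  of that theorem here. The obstacle is regularity. A regular homotopy passes through loops that are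
  only C^1, whose tantrices are merely continuous, so the tangent frame of the tantrix is available
  only at the C^2 end and cannot be carried along. The normal replaces it, and for this the normal
  has to be one continuous field although no orientation of the surface is given. Strict local
  support, a condition that mentions no chart, singles out the same side in all charts. Skewness
  enters through the tantrix alone: \<open>\<tau> t\<close> and \<open>\<tau> s\<close> are neither
  equal nor opposite within a period, which is exactly what makes the chord frames exist.\<close>

definition mk3 :: "complex \<Rightarrow> real \<Rightarrow> real^3" where
  "mk3 w h = Re w *\<^sub>R axis 1 1 + Im w *\<^sub>R axis 2 1 + h *\<^sub>R axis 3 1"

lemma mk3_nth [simp]: "mk3 w h $ 1 = Re w" "mk3 w h $ 2 = Im w" "mk3 w h $ 3 = h"
  by (simp_all add: mk3_def axis_def)

lemma mk3_eq_iff [simp]: "mk3 w h = mk3 w' h' \<longleftrightarrow> w = w' \<and> h = h'"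
  by (auto simp: vec_eq_iff forall_3 complex_eq_iff)

lemma inner_real3: "(x::real^3) \<bullet> y = x$1 * y$1 + x$2 * y$2 + x$3 * y$3"
  by (simp add: inner_vec_def sum_3)

lemma norm_real3: "norm (x::real^3) = sqrt ((x$1)\<^sup>2 + (x$2)\<^sup>2 + (x$3)\<^sup>2)"
  by (simp add: norm_eq_sqrt_inner inner_real3 power2_eq_square)

lemma continuous_on_mk3 [continuous_intros]:
  "continuous_on S w \<Longrightarrow> continuous_on S h \<Longrightarrow> continuous_on S (\<lambda>x. mk3 (w x) (h x))"
  unfolding mk3_def by (intro continuous_intros)

text \<open>In \<open>real^3\<close> such a pair, completed by its cross product, is a rotation
  matrix, so these pairs are a copy of SO(3).\<close>

definition orthonormal2 :: "'a::real_inner \<Rightarrow> 'a \<Rightarrow> bool" where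
  "orthonormal2 u v \<longleftrightarrow> norm u = 1 \<and> norm v = 1 \<and> u \<bullet> v = 0"

text \<open>For a unit \<open>q = (a, b)\<close>, read as a quaternion, \<open>spin1\<close>,
  \<open>spin2\<close> and \<open>spin3\<close> are the columns of the rotation attached to it.
  \<open>spin1\<close> is the Hopf map, normalised so that \<open>a / b\<close> is the stereographic
  coordinate of the first column.\<close>

definition spin1 :: "complex \<times> complex \<Rightarrow> real^3" where
  "spin1 q = mk3 (2 * fst q * cnj (snd q)) ((cmod (fst q))\<^sup>2 - (cmod (snd q))\<^sup>2)"

definition spin2 :: "complex \<times> complex \<Rightarrow> real^3" where
  "spin2 q = mk3 ((cnj (snd q))\<^sup>2 - (fst q)\<^sup>2) (2 * Re (fst q * snd q))"

definition spin3 :: "complex \<times> complex \<Rightarrow> real^3" where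
  "spin3 q = mk3 (- \<i> * ((cnj (snd q))\<^sup>2 + (fst q)\<^sup>2)) (- 2 * Im (fst q * snd q))"

definition spin :: "complex \<times> complex \<Rightarrow> (real^3) \<times> (real^3)" where
  "spin q = (spin1 q, spin2 q)"

lemma continuous_on_spin: "continuous_on S spin"
  unfolding spin_def spin1_def spin2_def by (intro continuous_intros)

lemma norm_spinor: "norm q = 1 \<longleftrightarrow> (cmod (fst q))\<^sup>2 + (cmod (snd q))\<^sup>2 = 1"
  by (simp add: norm_prod_def)

lemma spin_minus [simp]: "spin (- q) = spin q"
  by (simp add: spin_def spin1_def spin2_def)

text \<open>The columns form a right-handed frame. Each is quadratic in \<open>q\<close>, so a
  product of two of them carries an extra squared norm of \<open>q\<close>, which is 1 on the unit
  sphere.\<close>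

lemma cross_spin:
  "cross3 (spin1 q) (spin2 q) = ((cmod (fst q))\<^sup>2 + (cmod (snd q))\<^sup>2) *\<^sub>R spin3 q"
  unfolding vec_eq_iff forall_3 cross_components vector_scaleR_component
  by (simp add: spin1_def spin2_def spin3_def cmod_power2)
    (simp add: power2_eq_square algebra_simps)

lemma orthonormal_spin:
  assumes "norm q = 1"
  shows "orthonormal2 (spin1 q) (spin2 q)"
proof -
  have 1: "(cmod (fst q))\<^sup>2 + (cmod (snd q))\<^sup>2 = 1"
    using assms by (simp add: norm_spinor)
  have "spin1 q \<bullet> spin1 q = ((cmod (fst q))\<^sup>2 + (cmod (snd q))\<^sup>2)\<^sup>2"
    unfolding inner_real3
    by (simp add: spin1_def cmod_power2) (simp add: power2_eq_square algebra_simps)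
  moreover have "spin2 q \<bullet> spin2 q = ((cmod (fst q))\<^sup>2 + (cmod (snd q))\<^sup>2)\<^sup>2"
    unfolding inner_real3
    by (simp add: spin2_def cmod_power2) (simp add: power2_eq_square algebra_simps)
  moreover have "spin1 q \<bullet> spin2 q = 0"
    unfolding inner_real3
    by (simp add: spin1_def spin2_def cmod_power2) (simp add: power2_eq_square algebra_simps)
  ultimately show ?thesis
    unfolding 1 by (simp add: orthonormal2_def norm_eq_1)
qed

text \<open>The first two columns determine the third by the cross product. Sum and difference of
  the horizontal parts of the last two give \<open>a^2\<close> and \<open>(cnj b)^2\<close>, so
  \<open>a\<close> and \<open>b\<close> are known up to separate signs; \<open>a * cnj b\<close>
  from the first column ties the two signs together.\<close>

lemma spin_eq_iff:
  assumes q: "norm q = 1" "norm q' = 1"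
  shows "spin q = spin q' \<longleftrightarrow> q' = q \<or> q' = - q"
proof
  assume eq: "spin q = spin q'"
  obtain a b a' b' where ab: "q = (a, b)" "q' = (a', b')" by (metis surj_pair)
  have "spin3 q = cross3 (spin1 q) (spin2 q)" "spin3 q' = cross3 (spin1 q') (spin2 q')"
    using q by (simp_all add: cross_spin norm_spinor)
  then have e3: "spin3 q = spin3 q'" using eq by (simp add: spin_def)
  have 1: "a * cnj b = a' * cnj b'"
    using eq by (simp add: spin_def spin1_def ab)
  have 2: "(cnj b)\<^sup>2 - a\<^sup>2 = (cnj b')\<^sup>2 - a'\<^sup>2" "(cnj b)\<^sup>2 + a\<^sup>2 = (cnj b')\<^sup>2 + a'\<^sup>2"
    using eq e3 by (auto simp: spin_def spin2_def spin3_def ab)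
  have "x = u \<and> y = v" if "x - y = u - v" "x + y = u + v" for x y u v :: complex
    using that by (simp add: complex_eq_iff)
  from this[OF 2] have sq: "a\<^sup>2 = a'\<^sup>2" "(cnj b)\<^sup>2 = (cnj b')\<^sup>2" by auto
  then have "a' = a \<or> a' = - a" "cnj b' = cnj b \<or> cnj b' = - cnj b"
    by (auto simp: power2_eq_iff)
  then have "a' = a \<or> a' = - a" "b' = b \<or> b' = - b"
    by (auto simp: complex_eq_iff)
  with 1 show "q' = q \<or> q' = - q"
    by (auto simp: ab)
qed auto

text \<open>A phase \<open>u\<close> turns the frame about its first vector by twice the argument of
  \<open>u\<close>: it moves along the Hopf fibre and adjusts the second vector once the first is
  right.\<close>

lemma spin_phase:
  assumes "cmod u = 1"
  shows "spin1 (u * a, u * b) = spin1 (a, b)"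
    and "spin2 (u * a, u * b) = Re (u\<^sup>2) *\<^sub>R spin2 (a, b) + Im (u\<^sup>2) *\<^sub>R spin3 (a, b)"
proof -
  have u: "u * cnj u = 1" using assms by (simp add: complex_norm_square[symmetric])
  have "u * a * (cnj u * cnj b) = a * cnj b * (u * cnj u)" by (simp add: algebra_simps)
  then show "spin1 (u * a, u * b) = spin1 (a, b)"
    using assms by (simp add: spin1_def norm_mult u mult.assoc)
  show "spin2 (u * a, u * b) = Re (u\<^sup>2) *\<^sub>R spin2 (a, b) + Im (u\<^sup>2) *\<^sub>R spin3 (a, b)"
    unfolding vec_eq_iff forall_3
    by (simp add: spin2_def spin3_def power2_eq_square algebra_simps)
qed

text \<open>The Hopf map reaches \<open>u\<close>. Then \<open>v\<close> lies in the plane of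
  \<open>e2\<close> and \<open>e3\<close>, and half of its angle in that plane is the phase that
  turns \<open>e2\<close> into \<open>v\<close>.\<close>

lemma spin_surj:
  assumes "orthonormal2 u v"
  obtains q where "norm q = 1" "spin q = (u, v)"
proof -
  have nu: "(u$1)\<^sup>2 + (u$2)\<^sup>2 + (u$3)\<^sup>2 = 1" using assms
    by (simp add: orthonormal2_def norm_real3)
  obtain q0 where q0: "norm q0 = 1" "spin1 q0 = u"
  proof (cases "u $ 3 = 1")
    case True
    have "norm (1::complex, 0::complex) = 1" by (simp add: norm_spinor)
    moreover have "spin1 (1, 0) = u" using True nu
      by (simp add: spin1_def vec_eq_iff forall_3)
    ultimately show ?thesis using that by blast
  next
    case False
    have "(u$3)\<^sup>2 \<le> 1" using nu by (smt (verit) zero_le_power2)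
    with False have lt: "u$3 < 1" by (simp add: abs_square_le_1)
    \<comment> \<open>With \<open>b\<close> real, the equations \<open>|a|^2 + |b|^2 = 1\<close> and
      \<open>|a|^2 - |b|^2 = u$3\<close> determine \<open>b\<close>, and \<open>2 * a * b\<close>
      has to be the horizontal part of \<open>u\<close>. Solving for \<open>a\<close> needs
      \<open>b\<close> nonzero, hence the separate case of the north pole.\<close>
    define b where "b = sqrt ((1 - u$3) / 2)"
    have b: "b > 0" "b\<^sup>2 = (1 - u$3) / 2" using lt by (auto simp: b_def)
    define a where "a = Complex (u$1) (u$2) / of_real (2 * b)"
    have "(cmod a)\<^sup>2 = ((u$1)\<^sup>2 + (u$2)\<^sup>2) / (4 * b\<^sup>2)"
      using b by (simp add: a_def norm_divide power_divide cmod_power2 power_mult_distrib)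
    also have "\<dots> = (1 + u$3) / 2"
      using nu lt unfolding b(2) by (simp add: field_simps power2_eq_square)
    finally have a: "(cmod a)\<^sup>2 = (1 + u$3) / 2" .
    have "norm (a, of_real b :: complex) = 1"
      using a b by (simp add: norm_spinor field_simps)
    moreover have "spin1 (a, of_real b) = u"
      using b a by (simp add: spin1_def vec_eq_iff forall_3) (simp add: a_def field_simps)
    ultimately show ?thesis using that by blast
  qed
  obtain a b where ab: "q0 = (a, b)" by (metis surj_pair)
  define e2 e3 where "e2 = spin2 q0" and "e3 = spin3 q0"
  have e3: "e3 = cross3 u e2" using cross_spin[of q0] q0 by (simp add: e2_def e3_def norm_spinor)
  have e2: "norm e2 = 1" "u \<bullet> e2 = 0"
    using orthonormal_spin[OF q0(1)] q0(2) by (simp_all add: orthonormal2_def e2_def)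
  define x y where "x = v \<bullet> e2" and "y = v \<bullet> e3"
  have uv: "u \<bullet> v = 0" "norm u = 1" "norm v = 1" using assms by (auto simp: orthonormal2_def)
  have e3': "e3 \<bullet> e3 = 1" "e2 \<bullet> e3 = 0" "u \<bullet> e3 = 0"
    using norm_cross_dot[of u e2] e2 uv unfolding e3
    by (simp_all add: dot_cross_self power2_norm_eq_inner)
  have e2': "e2 \<bullet> e2 = 1" "u \<bullet> u = 1" "v \<bullet> v = 1" using e2 uv by (simp_all add: norm_eq_1)
  define w where "w = v - (x *\<^sub>R e2 + y *\<^sub>R e3)"
  have w: "w \<bullet> u = 0" "w \<bullet> e2 = 0" "w \<bullet> e3 = 0"
    using uv e2 e3' e2' by (simp_all add: w_def inner_diff inner_add x_def y_def inner_commute)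
  have "cross3 w e3 = 0" using w by (simp add: e3 Lagrange)
  then have "w = 0"
    using norm_cross_dot[of w e3] w e3' by (simp add: norm_eq_sqrt_inner)
  then have v: "v = x *\<^sub>R e2 + y *\<^sub>R e3" by (simp add: w_def)
  have "x\<^sup>2 + y\<^sup>2 = 1"
    using e2'(3) unfolding v by (simp add: inner_add e3' e2' inner_commute power2_eq_square)
  then obtain \<theta> where \<theta>: "x = cos \<theta>" "y = sin \<theta>" using sincos_total_2pi by metis
  define c where "c = cis (\<theta> / 2)"
  have c2: "c\<^sup>2 = cis \<theta>" by (simp add: c_def power2_eq_square cis_mult)
  have c1: "cmod c = 1" by (simp add: c_def)
  have "norm (c * a, c * b) = 1" using q0(1) by (simp add: ab norm_spinor norm_mult c1)
  moreover have "spin (c * a, c * b) = (u, v)"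
    using spin_phase[OF c1, of a b] q0(2) by (simp add: spin_def c2 ab v \<theta> e2_def e3_def)
  ultimately show ?thesis using that by blast
qed

section \<open>The double cover of the rotation group by the three-sphere\<close>

text \<open>Such a map is the quotient by the antipodal involution. An evenly covered neighbourhood
  of \<open>p a\<close> is the image of the open hemisphere centred at \<open>a\<close>; its sheets
  are this hemisphere and the opposite one.\<close>

lemma covering_space_antipodal:
  fixes p :: "'a::euclidean_space \<Rightarrow> 'b::real_normed_vector"
  assumes p: "continuous_on (sphere 0 1) p"
    and eq: "\<And>x y. norm x = 1 \<Longrightarrow> norm y = 1 \<Longrightarrow> p x = p y \<longleftrightarrow> y = x \<or> y = - x"
  shows "covering_space (sphere 0 1) p (p ` sphere 0 1)"
proof
  show "continuous_on (sphere 0 1) p" "p ` sphere 0 1 = p ` sphere 0 1" using p by auto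
  fix y assume "y \<in> p ` sphere 0 1"
  then obtain a where a: "norm a = 1" "y = p a" by auto
  define V where "V = sphere 0 1 \<inter> {x. a \<bullet> x > 0}"
  define V' where "V' = sphere 0 1 \<inter> {x. a \<bullet> x < 0}"
  define T where "T = p ` V"
  have minus: "p (- x) = p x" if "norm x = 1" for x
    using eq[of x "- x"] that by simp
  have closed_im: "closed (p ` C)" if "closed C" "C \<subseteq> sphere 0 1" for C
    using that p by (metis compact_Int_closed compact_continuous_image compact_imp_closed
        compact_sphere continuous_on_subset inf.absorb_iff2)
  have open_im: "openin (top_of_set (p ` sphere 0 1)) (p ` (sphere 0 1 \<inter> O'))" if O: "open O'" for O'
  proof -
    \<comment> \<open>Openness comes from compactness: \<open>C\<close> collects the points for
      which neither they nor their antipodes lie in \<open>O'\<close>, and the image of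
      \<open>O'\<close> is the complement of the closed image of \<open>C\<close>.\<close>
    define C where "C = sphere 0 1 - O' - uminus ` O'"
    have "open (uminus ` O')" using O open_negations by blast
    then have "closed C" unfolding C_def using O by (simp add: closed_Diff)
    moreover have "p ` (sphere 0 1 \<inter> O') = p ` sphere 0 1 - p ` C"
    proof (intro set_eqI iffI)
      fix z assume "z \<in> p ` (sphere 0 1 \<inter> O')"
      then obtain x where x: "norm x = 1" "x \<in> O'" "z = p x" by auto
      have "z \<notin> p ` C"
      proof
        assume "z \<in> p ` C"
        then obtain x' where "x' \<in> C" "p x = p x'" "norm x' = 1" using x by (auto simp: C_def)
        then have "x' = x \<or> x' = - x" using eq x by blast
        then show False using \<open>x' \<in> C\<close> x by (auto simp: C_def)
      qed
      then show "z \<in> p ` sphere 0 1 - p ` C" using x by auto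
    next
      fix z assume z: "z \<in> p ` sphere 0 1 - p ` C"
      then obtain x where x: "norm x = 1" "z = p x" by auto
      then have "x \<in> O' \<or> x \<in> uminus ` O'" using z by (auto simp: C_def)
      then have "x \<in> O' \<or> - x \<in> O'" by auto
      then show "z \<in> p ` (sphere 0 1 \<inter> O')"
        using x minus by (metis IntI image_eqI mem_sphere_0 norm_minus_cancel)
    qed
    ultimately show ?thesis
      using closed_im[of C] openin_open_Int[of "- p ` C" "p ` sphere 0 1"]
      by (auto simp: C_def Diff_eq open_Compl)
  qed
  have opn: "open {x. a \<bullet> x > 0}" "open {x. a \<bullet> x < 0}"
    by (rule open_halfspace_gt open_halfspace_lt)+
  have V'T: "p ` V' = T"
  proof -
    have "V' = uminus ` V" by (force simp: V_def V'_def image_iff intro: bexI[of _ "- _"])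
    then show ?thesis using minus by (auto simp: T_def image_image V_def)
  qed
  have homeo: "\<exists>q. homeomorphism U T p q"
    if U: "U = sphere 0 1 \<inter> H" "open H" "p ` U = T" "\<And>x. x \<in> H \<Longrightarrow> - x \<notin> H" for U H
  proof (rule homeomorphism_injective_open_map)
    show "continuous_on U p" using p U by (auto intro: continuous_on_subset)
    show "p ` U = T" by fact
    show "inj_on p U"
    proof (rule inj_onI)
      fix x y assume *: "x \<in> U" "y \<in> U" "p x = p y"
      then have "y = x \<or> y = - x" using eq[of x y] U by auto
      then show "x = y" using U * by auto
    qed
    fix O' assume "openin (top_of_set U) O'"
    then obtain W where W: "open W" "O' = U \<inter> W" by (auto simp: openin_open)
    have "O' = sphere 0 1 \<inter> (H \<inter> W)" using W U by auto
    moreover have "p ` O' \<subseteq> T" using W U by auto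
    moreover have "T \<subseteq> p ` sphere 0 1" using U by auto
    ultimately show "openin (top_of_set T) (p ` O')"
      using open_im[of "H \<inter> W"] W U by (meson open_Int openin_subset_trans)
  qed blast
  show "\<exists>T. y \<in> T \<and> openin (top_of_set (p ` sphere 0 1)) T \<and>
         (\<exists>v. \<Union> v = sphere 0 1 \<inter> p -` T \<and>
            (\<forall>u\<in>v. openin (top_of_set (sphere 0 1)) u) \<and>
            pairwise disjnt v \<and> (\<forall>u\<in>v. \<exists>q. homeomorphism u T p q))"
  proof (intro exI conjI)
    have "a \<in> V" using a by (simp add: V_def norm_eq_1)
    then show "y \<in> T" using a by (auto simp: T_def)
    show "openin (top_of_set (p ` sphere 0 1)) T" unfolding T_def V_def by (intro open_im opn)
    show "\<Union> {V, V'} = sphere 0 1 \<inter> p -` T"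
    proof -
      have "x \<in> V \<union> V'" if x: "norm x = 1" "p x \<in> T" for x
      proof -
        obtain x' where x': "x' \<in> V" "p x' = p x" using x(2) unfolding T_def by (metis imageE)
        then have "x = x' \<or> x = - x'" using eq[of x' x] x by (auto simp: V_def)
        then show ?thesis using x' by (auto simp: V_def V'_def)
      qed
      moreover have "p x \<in> T" "norm x = 1" if "x \<in> V \<union> V'" for x
        using that V'T by (auto simp: T_def) (auto simp: V_def V'_def)
      ultimately show ?thesis by (simp add: set_eq_iff) blast
    qed
    show "\<forall>u\<in>{V, V'}. openin (top_of_set (sphere 0 1)) u"
      using opn by (auto simp: V_def V'_def openin_open)
    show "pairwise disjnt {V, V'}" by (auto simp: pairwise_def disjnt_def V_def V'_def)
    show "\<forall>u\<in>{V, V'}. \<exists>q. homeomorphism u T p q"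
      using homeo[of V "{x. a \<bullet> x > 0}"] homeo[of V' "{x. a \<bullet> x < 0}"] opn V'T
      by (auto simp: V_def V'_def T_def)
  qed
qed

lemma covering_space_spin: "covering_space (sphere 0 1) spin {(u, v). orthonormal2 u v}"
proof -
  have cov: "covering_space (sphere 0 1) spin (spin ` sphere 0 1)"
    by (rule covering_space_antipodal[OF continuous_on_spin spin_eq_iff])
  have eq: "spin ` sphere 0 1 = {(u, v). orthonormal2 u v}"
  proof (intro set_eqI iffI)
    fix x :: "(real^3) \<times> (real^3)" assume "x \<in> spin ` sphere 0 1"
    then obtain q where "norm q = 1" "x = spin q" by auto
    then show "x \<in> {(u, v). orthonormal2 u v}" by (simp add: orthonormal_spin spin_def)
  next
    fix x :: "(real^3) \<times> (real^3)" assume "x \<in> {(u, v). orthonormal2 u v}"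
    then obtain u v :: "real^3" where x: "x = (u, v)" "orthonormal2 u v" by auto
    then obtain q where "norm q = 1" "spin q = (u, v)" by (meson spin_surj)
    then show "x \<in> spin ` sphere 0 1" using x by (metis image_eqI mem_sphere_0)
  qed
  show ?thesis
    using cov unfolding eq .
qed

section \<open>Spinor lifts of frames and their sign over one period\<close>

definition spin_lift :: "'a::topological_space set \<Rightarrow> ('a \<Rightarrow> real^3) \<Rightarrow> ('a \<Rightarrow> real^3) \<Rightarrow>
    ('a \<Rightarrow> complex \<times> complex) \<Rightarrow> bool" where
  "spin_lift X e1 e2 Q \<longleftrightarrow> continuous_on X Q \<and> (\<forall>x\<in>X. norm (Q x) = 1 \<and> spin (Q x) = (e1 x, e2 x))"

lemma spin_lift_exists:
  fixes X :: "'a::real_normed_vector set"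
  assumes "convex X" "continuous_on X e1" "continuous_on X e2"
    and "\<And>x. x \<in> X \<Longrightarrow> orthonormal2 (e1 x) (e2 x)"
  obtains Q where "spin_lift X e1 e2 Q"
proof -
  have c: "continuous_on X (\<lambda>x. (e1 x, e2 x))" by (intro continuous_intros assms)
  have f: "(\<lambda>x. (e1 x, e2 x)) \<in> X \<rightarrow> {(u, v). orthonormal2 u v}" using assms by auto
  obtain Q where "continuous_on X Q" "Q \<in> X \<rightarrow> sphere 0 1" "\<And>x. x \<in> X \<Longrightarrow> spin (Q x) = (e1 x, e2 x)"
    using covering_space_lift[OF covering_space_spin convex_imp_simply_connected[OF assms(1)]
        convex_imp_locally_path_connected[OF assms(1)] c f] by metis
  then have "spin_lift X e1 e2 Q" by (auto simp: spin_lift_def Pi_iff)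
  then show ?thesis using that by blast
qed

text \<open>Pointwise two lifts agree up to sign. Their inner product is continuous with values 1
  and -1, so on a connected set the sign is global.\<close>

lemma spin_lift_unique:
  assumes "connected X" "spin_lift X e1 e2 Q" "spin_lift X e1 e2 Q'"
  shows "(\<forall>x\<in>X. Q' x = Q x) \<or> (\<forall>x\<in>X. Q' x = - Q x)"
proof (cases "X = {}")
  case False
  then obtain a where a: "a \<in> X" by auto
  have Q: "norm (Q x) = 1" "norm (Q' x) = 1" "spin (Q x) = spin (Q' x)" if "x \<in> X" for x
    using assms that by (auto simp: spin_lift_def)
  then have dich: "Q' x = Q x \<or> Q' x = - Q x" if "x \<in> X" for x
    using that spin_eq_iff by blast
  define g where "g x = Q x \<bullet> Q' x" for x
  have g: "g x = 1 \<longleftrightarrow> Q' x = Q x" "g x = - 1 \<longleftrightarrow> Q' x = - Q x" "g x = 1 \<or> g x = -1" if "x \<in> X" for x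
  proof -
    have "Q x \<bullet> Q x = 1" using Q(1)[OF that] by (simp add: norm_eq_1)
    moreover have "Q x \<noteq> - Q x"
    proof
      assume "Q x = - Q x"
      then have "2 *\<^sub>R Q x = 0" by (metis add.right_inverse scaleR_2)
      then show False using Q(1)[OF that] by simp
    qed
    ultimately show "g x = 1 \<longleftrightarrow> Q' x = Q x" "g x = - 1 \<longleftrightarrow> Q' x = - Q x" "g x = 1 \<or> g x = -1"
      using dich[OF that] by (auto simp: g_def)
  qed
  have "continuous_on X g" unfolding g_def
    using assms by (intro continuous_intros) (auto simp: spin_lift_def)
  moreover have "g ` X \<subseteq> {1, -1}" using g by auto
  then have "finite (g ` X)" by (meson finite.emptyI finite.insertI finite_subset)
  ultimately have "g constant_on X" using assms(1) continuous_finite_range_constant by blast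
  then obtain c where "\<forall>x\<in>X. g x = c" by (auto simp: constant_on_def)
  then show ?thesis using g a by metis
qed auto

text \<open>A lift of a periodic orthonormal frame changes over one period by a constant sign; the
  sign + says that the frame is a null-homotopic loop in SO(3).\<close>

definition even_frame :: "(real \<Rightarrow> real^3) \<Rightarrow> (real \<Rightarrow> real^3) \<Rightarrow> bool" where
  "even_frame e1 e2 \<longleftrightarrow> (\<exists>Q. spin_lift UNIV e1 e2 Q \<and> (\<forall>t. Q (t + 2 * pi) = Q t))"

text \<open>Lift over the whole strip. The lift shifted by a period is again a lift, so the two
  differ by one sign for all \<open>s\<close>, and this sign can be read off at
  \<open>s = a\<close>. Leaving \<open>a\<close> and \<open>b\<close> arbitrary lets a homotopy be
  used in either direction.\<close>

lemma even_frame_homotopy: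
  assumes c: "continuous_on ({0..1::real} \<times> UNIV) (\<lambda>(s, t). e1 s t)"
      "continuous_on ({0..1::real} \<times> UNIV) (\<lambda>(s, t). e2 s t)"
    and o: "\<And>s t. s \<in> {0..1} \<Longrightarrow> orthonormal2 (e1 s t) (e2 s t)"
    and per: "\<And>s t. s \<in> {0..1} \<Longrightarrow> e1 s (t + 2 * pi) = e1 s t"
      "\<And>s t. s \<in> {0..1} \<Longrightarrow> e2 s (t + 2 * pi) = e2 s t"
    and ab: "a \<in> {0..1}" "b \<in> {0..1}" and a: "even_frame (e1 a) (e2 a)"
  shows "even_frame (e1 b) (e2 b)"
proof -
  let ?X = "{0..1::real} \<times> (UNIV :: real set)"
  let ?e1 = "\<lambda>(s, t). e1 s t" and ?e2 = "\<lambda>(s, t). e2 s t"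
  have X: "convex ?X" "connected ?X" by (auto intro!: convex_Times convex_connected)
  obtain Q where Q: "spin_lift ?X ?e1 ?e2 Q"
    using spin_lift_exists[OF X(1) c] o by force
  define Q' where "Q' = Q \<circ> (\<lambda>(s, t). (s, t + 2 * pi))"
  have "spin_lift ?X ?e1 ?e2 Q'"
    unfolding spin_lift_def
  proof
    have "continuous_on ?X (\<lambda>(s, t). (s, t + 2 * pi))"
      by (auto simp: case_prod_unfold intro!: continuous_intros)
    then show "continuous_on ?X Q'" unfolding Q'_def
      by (rule continuous_on_compose)
        (use Q in \<open>auto simp: spin_lift_def intro: continuous_on_subset\<close>)
    show "\<forall>x\<in>?X. norm (Q' x) = 1 \<and> spin (Q' x) = (?e1 x, ?e2 x)"
      using Q per by (auto simp: spin_lift_def Q'_def)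
  qed
  from spin_lift_unique[OF X(2) Q this]
  have sgn: "(\<forall>x\<in>?X. Q' x = Q x) \<or> (\<forall>x\<in>?X. Q' x = - Q x)" .
  have slice: "spin_lift UNIV (e1 s) (e2 s) (\<lambda>t. Q (s, t))" if "s \<in> {0..1}" for s
    unfolding spin_lift_def
  proof
    have "continuous_on ?X Q" using Q by (simp add: spin_lift_def)
    moreover have "continuous_on UNIV (Pair s :: real \<Rightarrow> _)" by (intro continuous_intros)
    moreover have "range (Pair s) \<subseteq> ?X" using that by auto
    ultimately show "continuous_on UNIV (\<lambda>t. Q (s, t))"
      by (rule continuous_on_compose2)
  qed (use Q that in \<open>auto simp: spin_lift_def\<close>)
  obtain P where P: "spin_lift UNIV (e1 a) (e2 a) P" "\<And>t. P (t + 2 * pi) = P t"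
    using a by (auto simp: even_frame_def)
  have "(\<forall>t. P t = Q (a, t)) \<or> (\<forall>t. P t = - Q (a, t))"
    using spin_lift_unique[OF connected_UNIV slice[OF ab(1)] P(1)] by auto
  then have Qa: "Q (a, t + 2 * pi) = Q (a, t)" for t
    using P(2)[of t] by auto
  have "Q' (a, 0) \<noteq> - Q (a, 0)"
  proof
    assume "Q' (a, 0) = - Q (a, 0)"
    then have "Q (a, 0) = - Q (a, 0)" using Qa[of 0] by (simp add: Q'_def)
    then have "2 *\<^sub>R Q (a, 0) = 0" by (metis add.right_inverse scaleR_2)
    moreover have "norm (Q (a, 0)) = 1" using Q ab by (auto simp: spin_lift_def)
    ultimately show False by simp
  qed
  with sgn ab have "\<forall>x\<in>?X. Q' x = Q x" by auto
  then have "\<And>t. Q (b, t + 2 * pi) = Q (b, t)" using ab by (auto simp: Q'_def)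
  then show ?thesis using slice[OF ab(2)] unfolding even_frame_def by blast
qed

section \<open>Regular homotopies of $C^1$ loops and the Whitney--Graustein theorem\<close>

text \<open>The velocity is carried along as a function of its own, so that continuity in the C^1
  sense is plain joint continuity. The set \<open>X\<close> serves plane loops (\<open>UNIV\<close>)
  and spherical loops alike; the latter are measured in the ambient space and not in charts.\<close>

definition reg_homotopy :: "'a::real_normed_vector set \<Rightarrow> (real \<Rightarrow> real \<Rightarrow> 'a) \<Rightarrow> (real \<Rightarrow> real \<Rightarrow> 'a) \<Rightarrow> bool" where
  "reg_homotopy X h h' \<longleftrightarrow>
     continuous_on ({0..1} \<times> UNIV) (\<lambda>(s, t). h s t) \<and>
     continuous_on ({0..1} \<times> UNIV) (\<lambda>(s, t). h' s t) \<and>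
     (\<forall>s\<in>{0..1}. \<forall>t. (h s has_vector_derivative h' s t) (at t) \<and> h' s t \<noteq> 0 \<and>
        h s t \<in> X \<and> h s (t + 2 * pi) = h s t)"

definition reg_homotopic :: "'a::real_normed_vector set \<Rightarrow> (real \<Rightarrow> 'a) \<Rightarrow> (real \<Rightarrow> 'a) \<Rightarrow> bool" where
  "reg_homotopic X c0 c1 \<longleftrightarrow> (\<exists>h h'. reg_homotopy X h h' \<and> h 0 = c0 \<and> h 1 = c1)"

lemma continuous_on_curried:
  assumes "continuous_on D (\<lambda>(s, t). g s t)" "continuous_on S a" "continuous_on S b"
    and "\<And>x. x \<in> S \<Longrightarrow> (a x, b x) \<in> D"
  shows "continuous_on S (\<lambda>x. g (a x) (b x))"
  using continuous_on_compose2[OF assms(1) continuous_on_Pair[OF assms(2,3)]] assms(4) by auto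

lemma continuous_on_slice:
  assumes "continuous_on (S \<times> UNIV) (\<lambda>(s, t). h s t)" "s \<in> S"
  shows "continuous_on T (h s)"
  using continuous_on_curried[OF assms(1), of T "\<lambda>_. s" "\<lambda>t. t"] assms(2) by auto

lemma has_vector_derivative_shift:
  assumes "(c has_vector_derivative d) (at (t + a))"
  shows "((\<lambda>t. c (t + a)) has_vector_derivative d) (at t)"
proof -
  have "((\<lambda>t. t + a) has_vector_derivative 1) (at t)"
    by (auto intro!: derivative_eq_intros simp: has_vector_derivative_def)
  from vector_diff_chain_at[OF this assms] show ?thesis by (simp add: o_def)
qed

lemma continuous_on_concat:
  assumes c: "continuous_on ({0..1::real} \<times> (UNIV::real set)) (\<lambda>(s, t). g1 s t)"
      "continuous_on ({0..1::real} \<times> (UNIV::real set)) (\<lambda>(s, t). g2 s t)"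
    and eq: "\<And>t. g1 1 t = g2 0 t"
  shows "continuous_on ({0..1} \<times> UNIV) (\<lambda>(s, t). if s \<le> 1/2 then g1 (2 * s) t else g2 (2 * s - 1) t)"
proof -
  have c1: "continuous_on {x \<in> {0..1::real} \<times> (UNIV::real set). fst x \<le> 1/2} (\<lambda>x. g1 (2 * fst x) (snd x))"
    by (rule continuous_on_curried[OF c(1)]) (auto intro!: continuous_intros)
  have c2: "continuous_on {x \<in> {0..1::real} \<times> (UNIV::real set). 1/2 \<le> fst x} (\<lambda>x. g2 (2 * fst x - 1) (snd x))"
    by (rule continuous_on_curried[OF c(2)]) (auto intro!: continuous_intros)
  have gl: "g1 (2 * x) t = g2 (2 * x - 1) t" if "x * 2 = 1" for x t
    using eq[of t] that by (simp add: mult.commute)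
  have "continuous_on ({0..1} \<times> UNIV)
     (\<lambda>x. if fst x \<le> 1/2 then g1 (2 * fst x) (snd x) else g2 (2 * fst x - 1) (snd x))"
    by (rule continuous_on_cases_le[OF c1 c2]) (auto intro!: continuous_intros simp: gl)
  then show ?thesis by (simp add: case_prod_unfold)
qed

lemma reg_homotopic_trans:
  assumes "reg_homotopic X c0 c1" "reg_homotopic X c1 c2"
  shows "reg_homotopic X c0 c2"
proof -
  obtain h h' where h: "reg_homotopy X h h'" "h 0 = c0" "h 1 = c1"
    using assms(1) unfolding reg_homotopic_def by blast
  obtain g g' where g: "reg_homotopy X g g'" "g 0 = c1" "g 1 = c2"
    using assms(2) unfolding reg_homotopic_def by blast
  \<comment> \<open>At the junction the velocities match because \<open>c1\<close> has only one
    derivative; this is what makes the concatenated velocity continuous.\<close>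
  have "(c1 has_vector_derivative h' 1 t) (at t)" "(c1 has_vector_derivative g' 0 t) (at t)" for t
    using h g unfolding reg_homotopy_def by (metis atLeastAtMost_iff order_refl zero_le_one)+
  then have eq: "h' 1 t = g' 0 t" for t using vector_derivative_unique_at by blast
  define k where "k = (\<lambda>s t. if s \<le> 1/2 then h (2 * s) t else g (2 * s - 1) t)"
  define k' where "k' = (\<lambda>s t. if s \<le> 1/2 then h' (2 * s) t else g' (2 * s - 1) t)"
  have kl: "k s = h (2 * s)" "k' s = h' (2 * s)" "2 * s \<in> {0..1}" if "s \<in> {0..1}" "s \<le> 1/2" for s
    using that by (auto simp: k_def k'_def)
  have kg: "k s = g (2 * s - 1)" "k' s = g' (2 * s - 1)" "2 * s - 1 \<in> {0..1}"
    if "s \<in> {0..1}" "\<not> s \<le> 1/2" for s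
    using that by (auto simp: k_def k'_def)
  have "reg_homotopy X k k'"
    unfolding reg_homotopy_def
  proof (intro conjI ballI)
    show "continuous_on ({0..1} \<times> UNIV) (\<lambda>(s, t). k s t)" unfolding k_def
      using h g by (intro continuous_on_concat) (auto simp: reg_homotopy_def)
    show "continuous_on ({0..1} \<times> UNIV) (\<lambda>(s, t). k' s t)" unfolding k'_def
      using h g eq by (intro continuous_on_concat) (auto simp: reg_homotopy_def)
    fix s :: real assume s: "s \<in> {0..1}"
    show "\<forall>t. (k s has_vector_derivative k' s t) (at t) \<and> k' s t \<noteq> 0 \<and> k s t \<in> X \<and>
       k s (t + 2 * pi) = k s t"
    proof (cases "s \<le> 1/2")
      case True
      show ?thesis using h(1) kl[OF s True] unfolding reg_homotopy_def by metis
    next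
      case False
      show ?thesis using g(1) kg[OF s False] unfolding reg_homotopy_def by metis
    qed
  qed
  moreover have "k 0 = c0" "k 1 = c2" using h g by (auto simp: k_def)
  ultimately show ?thesis unfolding reg_homotopic_def by blast
qed

lemma reg_homotopic_sym:
  assumes "reg_homotopic X c0 c1"
  shows "reg_homotopic X c1 c0"
proof -
  obtain h h' where h: "reg_homotopy X h h'" "h 0 = c0" "h 1 = c1"
    using assms unfolding reg_homotopic_def by blast
  have flip: "continuous_on ({0..1} \<times> UNIV) (\<lambda>(s, t). k (1 - s) t)"
    if "continuous_on ({0..1::real} \<times> (UNIV::real set)) (\<lambda>(s, t). k s t)" for k :: "real \<Rightarrow> real \<Rightarrow> 'a"
    unfolding case_prod_unfold
    by (rule continuous_on_curried[OF that]) (auto intro!: continuous_intros)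
  have "reg_homotopy X (\<lambda>s. h (1 - s)) (\<lambda>s. h' (1 - s))"
    using h(1) by (auto simp: reg_homotopy_def intro!: flip)
  then show ?thesis using h unfolding reg_homotopic_def
    by (intro exI[of _ "\<lambda>s. h (1 - s)"] exI[of _ "\<lambda>s. h' (1 - s)"]) auto
qed

lemma reg_homotopic_shift:
  assumes d: "\<And>t. (c has_vector_derivative c' t) (at t)" "continuous_on UNIV c'"
    and c: "\<And>t. c' t \<noteq> 0" "\<And>t. c t \<in> X" "\<And>t. c (t + 2 * pi) = c t"
  shows "reg_homotopic X c (\<lambda>t. c (t + a))"
proof -
  have cc: "continuous_on UNIV c"
    using d(1) by (meson continuous_at_imp_continuous_on has_vector_derivative_continuous)
  have cont: "continuous_on ({0..1} \<times> UNIV) (\<lambda>(s, t). k (t + s * a))"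
    if "continuous_on UNIV k" for k :: "real \<Rightarrow> 'a"
    unfolding case_prod_unfold
    by (rule continuous_on_compose2[OF that]) (auto intro!: continuous_intros)
  have der: "((\<lambda>t. c (t + s * a)) has_vector_derivative c' (t + s * a)) (at t)" for s t
    using d(1) by (rule has_vector_derivative_shift)
  have per: "c (t + 2 * pi + s) = c (t + s)" for t s
    using c(3)[of "t + s"] by (simp add: algebra_simps)
  have "reg_homotopy X (\<lambda>s t. c (t + s * a)) (\<lambda>s t. c' (t + s * a))"
    unfolding reg_homotopy_def using der c per by (auto intro!: cont cc d(2))
  then show ?thesis unfolding reg_homotopic_def
    by (intro exI[of _ "\<lambda>s t. c (t + s * a)"] exI[of _ "\<lambda>s t. c' (t + s * a)"]) auto
qed

lemma reg_homotopic_map: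
  fixes F :: "'a::real_normed_vector \<Rightarrow> 'b::real_normed_vector"
  assumes h: "reg_homotopic X c0 c1"
    and F: "\<And>x. (F has_derivative F' x) (at x)" "continuous_on UNIV (\<lambda>(x, v). F' x v)"
      "\<And>x v. v \<noteq> 0 \<Longrightarrow> F' x v \<noteq> 0" "\<And>x. x \<in> X \<Longrightarrow> F x \<in> Y"
  shows "reg_homotopic Y (F \<circ> c0) (F \<circ> c1)"
proof -
  obtain h h' where h: "reg_homotopy X h h'" "h 0 = c0" "h 1 = c1"
    using assms unfolding reg_homotopic_def by blast
  have cF: "continuous_on UNIV F"
    using F(1) by (meson continuous_at_imp_continuous_on has_derivative_continuous)
  have ch: "continuous_on ({0..1} \<times> UNIV) (\<lambda>x. h (fst x) (snd x))"
    "continuous_on ({0..1} \<times> UNIV) (\<lambda>x. h' (fst x) (snd x))"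
    using h(1) by (auto simp: reg_homotopy_def case_prod_unfold)
  have "reg_homotopy Y (\<lambda>s t. F (h s t)) (\<lambda>s t. F' (h s t) (h' s t))"
    unfolding reg_homotopy_def
  proof (intro conjI ballI allI)
    show "continuous_on ({0..1} \<times> UNIV) (\<lambda>(s, t). F (h s t))"
      unfolding case_prod_unfold by (rule continuous_on_compose2[OF cF ch(1)]) auto
    show "continuous_on ({0..1} \<times> UNIV) (\<lambda>(s, t). F' (h s t) (h' s t))"
      unfolding case_prod_unfold by (rule continuous_on_curried[OF F(2) ch]) auto
    fix s t :: real assume s: "s \<in> {0..1}"
    have hs: "(h s has_vector_derivative h' s t) (at t)" "h' s t \<noteq> 0" "h s t \<in> X" "h s (t + 2 * pi) = h s t"
      using h(1) s by (auto simp: reg_homotopy_def)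
    have "((\<lambda>t. F (h s t)) has_derivative (\<lambda>x. F' (h s t) (x *\<^sub>R h' s t))) (at t)"
      using has_derivative_compose[OF hs(1)[unfolded has_vector_derivative_def] F(1)] .
    then show "((\<lambda>t. F (h s t)) has_vector_derivative F' (h s t) (h' s t)) (at t)"
      unfolding has_vector_derivative_def
      using has_derivative_linear[OF F(1), of "h s t"] by (simp add: linear_cmul)
    show "F' (h s t) (h' s t) \<noteq> 0" "F (h s t) \<in> Y" "F (h s (t + 2 * pi)) = F (h s t)"
      using hs F by auto
  qed
  then show ?thesis unfolding reg_homotopic_def
    by (intro exI[of _ "\<lambda>s t. F (h s t)"] exI[of _ "\<lambda>s t. F' (h s t) (h' s t)"]) (auto simp: h)
qed

section \<open>Closed plane loops built from prescribed velocities\<close>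

text \<open>The substitution \<open>u = t x\<close> makes the primitive of \<open>w\<close> meaningful for negative \<open>t\<close> as well.\<close>

definition primitive :: "(real \<Rightarrow> complex) \<Rightarrow> real \<Rightarrow> complex" where
  "primitive w t = t *\<^sub>R integral {0..1} (\<lambda>x. w (t * x))"

text \<open>The average over one period, rescaled to the unit interval. A continuous periodic
  velocity integrates to a closed loop once its mean is zero.\<close>

definition mean :: "(real \<Rightarrow> complex) \<Rightarrow> complex" where
  "mean v = integral {0..1} (\<lambda>x. v (2 * pi * x))"

lemma primitive_eq:
  assumes W: "\<And>x. \<bar>x\<bar> \<le> K \<Longrightarrow> (W has_vector_derivative w x) (at x within {-K..K})" and t: "\<bar>t\<bar> \<le> K"
  shows "primitive w t = W t - W 0"
proof -
  have "((\<lambda>x. W (t * x)) has_vector_derivative t *\<^sub>R w (t * x)) (at x within {0..1})"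
    if x: "x \<in> {0..1}" for x
  proof -
    have in_K: "t * y \<in> {-K..K}" if "y \<in> {0..1}" for y
    proof -
      have "\<bar>t * y\<bar> \<le> \<bar>t\<bar> * 1" using that unfolding abs_mult by (intro mult_left_mono) auto
      then show ?thesis using t by auto
    qed
    have "(W has_vector_derivative w (t * x)) (at (t * x) within (\<lambda>x. t * x) ` {0..1})"
      using in_K[OF x] in_K by (intro has_vector_derivative_within_subset[OF W]) auto
    moreover have "((\<lambda>x. t * x) has_vector_derivative t) (at x within {0..1})"
      by (auto intro!: derivative_eq_intros simp: has_vector_derivative_def)
    ultimately show ?thesis
      using vector_diff_chain_within[of "\<lambda>x. t * x" t x "{0..1}" W "w (t * x)"]
      by (simp add: o_def)
  qed
  then have "((\<lambda>x. t *\<^sub>R w (t * x)) has_integral W (t * 1) - W (t * 0)) {0..1}"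
    by (intro fundamental_theorem_of_calculus) auto
  then show ?thesis
    unfolding primitive_def by (metis integral_cmul integral_unique mult.right_neutral mult_zero_right)
qed

lemma primitive_has_derivative:
  assumes w: "continuous_on UNIV w"
  shows "(primitive w has_vector_derivative w t) (at t)"
proof -
  define K where "K = \<bar>t\<bar> + 1"
  have "continuous_on {-K..K} w" using w continuous_on_subset by blast
  then obtain W where W: "\<And>x. x \<in> {-K..K} \<Longrightarrow> (W has_vector_derivative w x) (at x within {-K..K})"
    using antiderivative_continuous by blast
  have pe: "primitive w x = W x - W 0" if "x \<in> {-K<..<K}" for x
    using that by (intro primitive_eq[of K] W) auto
  have tK: "t \<in> {-K<..<K}" by (auto simp: K_def)
  have "(W has_vector_derivative w t) (at t within {-K<..<K})"
    by (rule has_vector_derivative_within_subset[OF W]) (use tK in auto)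
  then have "(W has_vector_derivative w t) (at t)"
    using has_vector_derivative_within_open[OF tK open_greaterThanLessThan] by blast
  then have "((\<lambda>x. W x - W 0) has_vector_derivative w t) (at t)"
    by (auto intro!: derivative_eq_intros)
  then show ?thesis
    by (rule has_vector_derivative_transform_within_open[OF _ open_greaterThanLessThan tK]) (simp add: pe)
qed

lemma derivative_primitive_unique:
  assumes c: "\<And>t. (c has_vector_derivative w t) (at t)"
  shows "c t = c 0 + primitive w t"
  using primitive_eq[of "\<bar>t\<bar>" c w t] c by (simp add: has_vector_derivative_at_within)

lemma continuous_on_primitive:
  fixes w :: "real \<Rightarrow> real \<Rightarrow> complex"
  assumes w: "continuous_on ({0..1} \<times> UNIV) (\<lambda>(s, t). w s t)"
  shows "continuous_on ({0..1} \<times> UNIV) (\<lambda>(s, t). primitive (w s) t)"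
proof -
  have "continuous_on (({0..1::real} \<times> UNIV) \<times> cbox 0 (1::real)) (\<lambda>(y, x). w (fst y) (snd y * x))"
    unfolding case_prod_unfold
    by (rule continuous_on_curried[OF w]) (auto intro!: continuous_intros)
  from integral_continuous_on_param[OF this]
  show ?thesis unfolding primitive_def case_prod_unfold
    by (intro continuous_intros) auto
qed

lemma continuous_on_mean:
  fixes w :: "real \<Rightarrow> real \<Rightarrow> complex"
  assumes w: "continuous_on ({0..1} \<times> UNIV) (\<lambda>(s, t). w s t)"
  shows "continuous_on {0..1} (\<lambda>s. mean (w s))"
proof -
  have "continuous_on ({0..1::real} \<times> cbox 0 (1::real)) (\<lambda>(s, x). w s (2 * pi * x))"
    unfolding case_prod_unfold
    by (rule continuous_on_curried[OF w]) (auto intro!: continuous_intros)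
  from integral_continuous_on_param[OF this] show ?thesis unfolding mean_def by simp
qed

lemma integrable_rescale:
  assumes "continuous_on UNIV (v :: real \<Rightarrow> 'a::banach)"
  shows "(\<lambda>x. v (a * x)) integrable_on {0..1}"
  by (intro integrable_continuous_real continuous_on_compose2[OF assms]) (auto intro!: continuous_intros)

lemma primitive_2pi: "primitive w (2 * pi) = (2 * pi) *\<^sub>R mean w"
  by (simp add: primitive_def mean_def)

lemma primitive_periodic:
  assumes w: "continuous_on UNIV w" and per: "\<And>t. w (t + 2 * pi) = w t" and m: "mean w = 0"
  shows "primitive w (t + 2 * pi) = primitive w t"
proof -
  have "((\<lambda>t. primitive w (t + 2 * pi)) has_vector_derivative w t) (at t)" for t
    using has_vector_derivative_shift[OF primitive_has_derivative[OF w, of "t + 2 * pi"]]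
    by (simp add: per)
  from derivative_primitive_unique[OF this, of t]
  show ?thesis using primitive_2pi[of w] m by simp
qed

lemma mean_diff_const:
  assumes "continuous_on UNIV v"
  shows "mean (\<lambda>t. v t - a) = mean v - a"
  unfolding mean_def by (subst integral_diff) (use integrable_rescale[OF assms] in auto)

lemma mean_derivative_eq_0:
  assumes c: "\<And>t. (c has_vector_derivative w t) (at t)" and "c (2 * pi) = c 0"
  shows "mean w = 0"
  using derivative_primitive_unique[OF c, of "2 * pi"] assms(2) primitive_2pi[of w] by simp

text \<open>Whitney's device: subtracting the mean turns any periodic family of velocities into
  velocities of closed loops. A regular homotopy can thus be prescribed by velocities alone,
  provided that none of them equals its mean.\<close>

lemma reg_homotopic_velocities:
  fixes v :: "real \<Rightarrow> real \<Rightarrow> complex"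
  assumes v: "continuous_on ({0..1} \<times> UNIV) (\<lambda>(s, t). v s t)"
    and per: "\<And>s t. s \<in> {0..1} \<Longrightarrow> v s (t + 2 * pi) = v s t"
    and ne: "\<And>s t. s \<in> {0..1} \<Longrightarrow> v s t \<noteq> mean (v s)"
    and c0: "\<And>t. (c0 has_vector_derivative v 0 t - mean (v 0)) (at t)"
    and c1: "\<And>t. (c1 has_vector_derivative v 1 t - mean (v 1)) (at t)"
  shows "reg_homotopic UNIV c0 c1"
proof -
  define w where "w s t = v s t - mean (v s)" for s t
  \<comment> \<open>Velocities determine the loops up to translation; moving the base point linearly
    between the two starting points makes both ends exact.\<close>
  define b where "b s = (1 - s) *\<^sub>R c0 0 + s *\<^sub>R c1 0" for s
  define h where "h s t = b s + primitive (w s) t" for s t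
  have cm: "continuous_on ({0..1} \<times> UNIV) (\<lambda>x. mean (v (fst x)))"
    by (rule continuous_on_compose2[OF continuous_on_mean[OF v]]) (auto intro!: continuous_intros)
  have cw: "continuous_on ({0..1} \<times> UNIV) (\<lambda>(s, t). w s t)"
    using v cm unfolding w_def case_prod_unfold by (intro continuous_intros)
  have w1: "continuous_on UNIV (w s)" "continuous_on UNIV (v s)" if "s \<in> {0..1}" for s
    using continuous_on_slice[OF cw that] continuous_on_slice[OF v that] .
  have "mean (w s) = 0" if "s \<in> {0..1}" for s
    using mean_diff_const[OF w1(2)[OF that], of "mean (v s)"] by (simp add: w_def[abs_def])
  then have hp: "h s (t + 2 * pi) = h s t" if "s \<in> {0..1}" for s t
    using primitive_periodic[OF w1(1)[OF that]] that per unfolding h_def by (simp add: w_def)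
  have "reg_homotopy UNIV h w"
    unfolding reg_homotopy_def
  proof (intro conjI ballI allI)
    show "continuous_on ({0..1} \<times> UNIV) (\<lambda>(s, t). h s t)"
      using continuous_on_primitive[OF cw] unfolding h_def b_def case_prod_unfold
      by (intro continuous_intros)
    fix s t :: real assume s: "s \<in> {0..1}"
    show "(h s has_vector_derivative w s t) (at t)"
      unfolding h_def using primitive_has_derivative[OF w1(1)[OF s]]
      by (auto intro!: derivative_eq_intros)
    show "w s t \<noteq> 0" "h s (t + 2 * pi) = h s t" using ne[OF s] hp[OF s] by (auto simp: w_def)
  qed (auto intro: cw)
  moreover have "h 0 t = c0 t" "h 1 t = c1 t" for t
    using derivative_primitive_unique[OF c0, of t] derivative_primitive_unique[OF c1, of t]
    by (simp_all add: h_def b_def w_def[abs_def])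
  then have "h 0 = c0" "h 1 = c1" by auto
  ultimately show ?thesis unfolding reg_homotopic_def by blast
qed


section \<open>Velocity angles, turning numbers and their invariance\<close>

definition polar_loop :: "(real \<Rightarrow> complex) \<Rightarrow> (real \<Rightarrow> real) \<Rightarrow> (real \<Rightarrow> real) \<Rightarrow> int \<Rightarrow> bool" where
  "polar_loop c r \<theta> k \<longleftrightarrow> continuous_on UNIV r \<and> continuous_on UNIV \<theta> \<and>
     (\<forall>t. r t > 0 \<and> (c has_vector_derivative of_real (r t) * cis (\<theta> t)) (at t) \<and>
        c (t + 2 * pi) = c t \<and> \<theta> (t + 2 * pi) = \<theta> t + 2 * pi * of_int k)"

definition turning_number :: "(real \<Rightarrow> complex) \<Rightarrow> int \<Rightarrow> bool" where
  "turning_number c k \<longleftrightarrow> (\<exists>r \<theta>. polar_loop c r \<theta> k)"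

lemma cis_add_period: "\<theta>' = \<theta> + 2 * pi * of_int k \<Longrightarrow> cis \<theta>' = cis \<theta>"
  by (simp add: cis_mult[symmetric] cis_multiple_2pi)

lemma derivative_periodic:
  assumes "\<And>t. (c has_vector_derivative v t) (at t)" "\<And>t. c (t + a) = c t"
  shows "v (t + a) = v t"
proof -
  have "(c has_vector_derivative v (t + a)) (at t)"
    using has_vector_derivative_shift[OF assms(1)[of "t + a"]] by (simp add: assms(2))
  then show ?thesis using assms(1) vector_derivative_unique_at by blast
qed

lemma polar_loop_radius_periodic:
  assumes "polar_loop c r \<theta> k"
  shows "r (t + 2 * pi) = r t"
proof -
  have "(c has_vector_derivative of_real (r t) * cis (\<theta> t)) (at t)" "c (t + 2 * pi) = c t" for t
    using assms unfolding polar_loop_def by blast+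
  then have "of_real (r (t + 2 * pi)) * cis (\<theta> (t + 2 * pi)) = of_real (r t) * cis (\<theta> t)"
    by (rule derivative_periodic)
  then have "cmod (of_real (r (t + 2 * pi)) * cis (\<theta> (t + 2 * pi))) = cmod (of_real (r t) * cis (\<theta> t))"
    by simp
  then show ?thesis using assms by (simp add: norm_mult polar_loop_def less_imp_le)
qed

lemma continuous_Ints_constant:
  fixes f :: "'a::topological_space \<Rightarrow> real"
  assumes "connected S" "continuous_on S f" "\<And>x. x \<in> S \<Longrightarrow> f x \<in> \<int>"
  shows "f constant_on S"
proof (rule continuous_discrete_range_constant[OF assms(1,2)])
  fix x assume x: "x \<in> S"
  have "1 \<le> norm (f y - f x)" if "y \<in> S" "f y \<noteq> f x" for y
    using that assms(3) x Ints_nonzero_abs_ge1[of "f y - f x"] by auto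
  then show "\<exists>e>0. \<forall>y. y \<in> S \<and> f y \<noteq> f x \<longrightarrow> e \<le> norm (f y - f x)"
    by (intro exI[of _ 1]) auto
qed

lemma norm_mean_cis_le:
  assumes \<theta>: "continuous_on UNIV \<theta>"
  shows "cmod (mean (\<lambda>t. cis (\<theta> t))) \<le> 1"
proof -
  have "cmod (integral {0..1} (\<lambda>x. cis (\<theta> (2 * pi * x)))) \<le> 1 * (1 - 0)"
    by (rule integral_bound)
      (auto intro!: continuous_intros continuous_on_compose2[OF \<theta>])
  then show ?thesis by (simp add: mean_def)
qed

text \<open>Strict convexity of the disc: an average of unit vectors is a unit vector only if all of
  them agree. After rotation by \<open>- \<theta> t\<close> equality would force the cosine to be 1
  throughout, so the angle would be constant modulo \<open>2 * pi\<close>, hence constant by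
  continuity.\<close>

lemma mean_cis_neq:
  assumes \<theta>: "continuous_on UNIV \<theta>" and u: "u \<in> {0..2 * pi}" "\<theta> u \<noteq> \<theta> 0"
  shows "cis (\<theta> t) \<noteq> mean (\<lambda>t. cis (\<theta> t))"
proof
  assume eq: "cis (\<theta> t) = mean (\<lambda>t. cis (\<theta> t))"
  let ?g = "\<lambda>x. \<theta> (2 * pi * x) - \<theta> t"
  have cg: "continuous_on {0..1} ?g"
    by (intro continuous_intros continuous_on_compose2[OF \<theta>]) auto
  have int: "(\<lambda>x. cis (\<theta> (2 * pi * x))) integrable_on {0..1}"
    by (intro integrable_continuous_real continuous_intros continuous_on_compose2[OF \<theta>]) auto
  then have "((\<lambda>x. cis (\<theta> (2 * pi * x))) has_integral cis (\<theta> t)) {0..1}"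
    unfolding eq mean_def by (rule integrable_integral)
  from has_integral_mult_right[OF this, of "cis (- \<theta> t)"]
  have "((\<lambda>x. cis (?g x)) has_integral 1) {0..1}" by (simp add: cis_mult)
  from has_integral_Re[OF this] have cos: "((\<lambda>x. cos (?g x)) has_integral 1) {0..1}" by simp
  have "((\<lambda>x::real. 1 :: real) has_integral 1) {0..1}" using has_integral_const_real[of "1::real" 0 1] by simp
  from has_integral_diff[OF this cos] have "((\<lambda>x. 1 - cos (?g x)) has_integral 0) {0..1}" by simp
  then have "integral {0..1} (\<lambda>x. 1 - cos (?g x)) = 0" by (rule integral_unique)
  moreover have "continuous_on {0..1} (\<lambda>x. 1 - cos (?g x))" by (intro continuous_intros cg)
  ultimately have "\<forall>x\<in>{0..1}. 1 - cos (?g x) = 0"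
    by (subst (asm) integral_eq_0_iff) auto
  then have "?g x / (2 * pi) \<in> \<int>" if "x \<in> {0..1}" for x
  proof -
    have "cos (?g x) = 1" using \<open>\<forall>x\<in>{0..1}. 1 - cos (?g x) = 0\<close> that by auto
    then obtain n :: int where "?g x = of_int n * 2 * pi" using cos_one_2pi_int by auto
    then show ?thesis by auto
  qed
  moreover have "continuous_on {0..1} (\<lambda>x. ?g x / (2 * pi))" by (intro continuous_intros cg) auto
  ultimately have "(\<lambda>x. ?g x / (2 * pi)) constant_on {0..1}"
    by (intro continuous_Ints_constant) auto
  then obtain a where a: "?g x / (2 * pi) = a" if "x \<in> {0..1}" for x by (auto simp: constant_on_def)
  have "?g (u / (2 * pi)) / (2 * pi) = ?g 0 / (2 * pi)"
    using a[of "u / (2 * pi)"] a[of 0] u by (simp add: field_simps)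
  then show False using u by simp
qed

text \<open>The speed is interpolated to 1 with the angle fixed. Since the original velocity has
  mean zero, the mean at stage \<open>s\<close> has norm at most \<open>s\<close>, while the speed
  is \<open>(1 - s) * r t + s\<close>, which is larger for \<open>s < 1\<close>. Only
  \<open>s = 1\<close> needs the strict convexity of \<open>mean_cis_neq\<close>.\<close>

lemma homotopic_unit_speed:
  assumes c: "polar_loop c r \<theta> k" and u: "u \<in> {0..2 * pi}" "\<theta> u \<noteq> \<theta> 0"
  shows "reg_homotopic UNIV c (primitive (\<lambda>t. cis (\<theta> t) - mean (\<lambda>t. cis (\<theta> t))))"
proof -
  define v where "v s t = of_real ((1 - s) * r t + s) * cis (\<theta> t)" for s t
  let ?m = "mean (\<lambda>t. cis (\<theta> t))"
  have r: "continuous_on UNIV r" "\<And>t. r t > 0" and \<theta>: "continuous_on UNIV \<theta>"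
    and per: "\<And>t. \<theta> (t + 2 * pi) = \<theta> t + 2 * pi * of_int k"
    and d: "\<And>t. (c has_vector_derivative of_real (r t) * cis (\<theta> t)) (at t)"
    and cp: "\<And>t. c (t + 2 * pi) = c t"
    using c by (auto simp: polar_loop_def)
  have m0: "mean (\<lambda>t. of_real (r t) * cis (\<theta> t)) = 0"
    using mean_derivative_eq_0[OF d] cp[of 0] by simp
  have int: "(\<lambda>x. of_real (r (2 * pi * x)) * cis (\<theta> (2 * pi * x))) integrable_on {0..1}"
    "(\<lambda>x. cis (\<theta> (2 * pi * x))) integrable_on {0..1}"
    by (intro integrable_continuous_real continuous_intros continuous_on_compose2[OF \<theta>]
        continuous_on_compose2[OF r(1)]; auto)+
  have mv: "mean (v s) = of_real s * ?m" for s
  proof -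
    have "mean (v s) = integral {0..1} (\<lambda>x. of_real (1 - s) * (of_real (r (2 * pi * x)) * cis (\<theta> (2 * pi * x)))
        + of_real s * cis (\<theta> (2 * pi * x)))"
      unfolding mean_def v_def by (simp add: algebra_simps)
    also have "\<dots> = of_real (1 - s) * mean (\<lambda>t. of_real (r t) * cis (\<theta> t)) + of_real s * ?m"
      unfolding mean_def using int
      by (subst integral_add) (auto intro!: integrable_on_mult_right)
    finally show ?thesis by (simp add: m0)
  qed
  show ?thesis
  proof (rule reg_homotopic_velocities[of v])
    show "continuous_on ({0..1} \<times> UNIV) (\<lambda>(s, t). v s t)"
      unfolding v_def case_prod_unfold
      by (intro continuous_intros continuous_on_compose2[OF \<theta>] continuous_on_compose2[OF r(1)]) auto
    fix s t :: real assume s: "s \<in> {0..1}"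
    show "v s (t + 2 * pi) = v s t"
      using polar_loop_radius_periodic[OF c] cis_add_period[OF per] by (simp add: v_def)
    show "v s t \<noteq> mean (v s)"
    proof
      assume eq: "v s t = mean (v s)"
      have pos: "(1 - s) * r t \<ge> 0" using s r(2)[of t] by (simp add: less_imp_le)
      have "cmod (v s t) = (1 - s) * r t + s"
        using s pos unfolding v_def norm_mult norm_of_real norm_cis by simp
      moreover have "cmod (mean (v s)) \<le> s"
        using norm_mean_cis_le[OF \<theta>] s by (simp add: mv norm_mult mult_left_le)
      ultimately have "(1 - s) * r t \<le> 0" using eq by simp
      then have "s = 1" using s r(2)[of t] by (simp add: mult_le_0_iff)
      then have "cis (\<theta> t) = ?m" using eq mv[of 1] by (simp add: v_def)
      then show False using mean_cis_neq[OF \<theta> u] by simp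
    qed
  next
    fix t
    show "(c has_vector_derivative v 0 t - mean (v 0)) (at t)"
      using d[of t] mv[of 0] by (simp add: v_def)
    show "(primitive (\<lambda>t. cis (\<theta> t) - mean (\<lambda>t. cis (\<theta> t))) has_vector_derivative v 1 t - mean (v 1)) (at t)"
      unfolding mv
      using primitive_has_derivative[of "\<lambda>t. cis (\<theta> t) - mean (\<lambda>t. cis (\<theta> t))" t] \<theta>
      by (simp add: v_def continuous_intros)
  qed
qed

text \<open>At unit speed, convex combinations of two angles with the same increment over a period
  keep that increment, so their velocities are periodic. The hypothesis on \<open>u\<close> says
  that no combination is constant on a period, which keeps the velocity away from its mean.\<close>

lemma homotopic_angles:
  assumes c0: "polar_loop c0 r0 \<theta>0 k" and c1: "polar_loop c1 r1 \<theta>1 k"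
    and u: "\<And>s. s \<in> {0..1} \<Longrightarrow> \<exists>u\<in>{0..2 * pi}. (1 - s) * \<theta>0 u + s * \<theta>1 u \<noteq> (1 - s) * \<theta>0 0 + s * \<theta>1 0"
  shows "reg_homotopic UNIV c0 c1"
proof -
  have \<theta>: "continuous_on UNIV \<theta>0" "continuous_on UNIV \<theta>1"
    and per: "\<And>t. \<theta>0 (t + 2 * pi) = \<theta>0 t + 2 * pi * of_int k"
      "\<And>t. \<theta>1 (t + 2 * pi) = \<theta>1 t + 2 * pi * of_int k"
    using c0 c1 by (auto simp: polar_loop_def)
  define N where "N \<theta> = primitive (\<lambda>t. cis (\<theta> t) - mean (\<lambda>t. cis (\<theta> t)))" for \<theta>
  have N: "(N \<theta> has_vector_derivative cis (\<theta> t) - mean (\<lambda>t. cis (\<theta> t))) (at t)"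
    if "continuous_on UNIV \<theta>" for \<theta> t
    unfolding N_def using that by (intro primitive_has_derivative continuous_intros)
  define v where "v s t = cis ((1 - s) * \<theta>0 t + s * \<theta>1 t)" for s t
  have "reg_homotopic UNIV (N \<theta>0) (N \<theta>1)"
  proof (rule reg_homotopic_velocities[of v])
    show "continuous_on ({0..1} \<times> UNIV) (\<lambda>(s, t). v s t)"
      unfolding v_def case_prod_unfold
      by (intro continuous_intros continuous_on_compose2[OF \<theta>(1)] continuous_on_compose2[OF \<theta>(2)]) auto
    fix s t :: real assume s: "s \<in> {0..1}"
    show "v s (t + 2 * pi) = v s t"
      unfolding v_def by (rule cis_add_period[of _ _ k], unfold per) (simp add: algebra_simps)
    show "v s t \<noteq> mean (v s)"
    proof -
      obtain u where "u \<in> {0..2 * pi}" "(1 - s) * \<theta>0 u + s * \<theta>1 u \<noteq> (1 - s) * \<theta>0 0 + s * \<theta>1 0"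
        using u[OF s] by blast
      then show ?thesis
        unfolding v_def by (intro mean_cis_neq[of _ u] continuous_intros \<theta>)
    qed
  qed (use N[OF \<theta>(1)] N[OF \<theta>(2)] in \<open>auto simp: v_def[abs_def]\<close>)
  moreover have "reg_homotopic UNIV c0 (N \<theta>0)"
    unfolding N_def using u[of 0] by (auto intro: homotopic_unit_speed[OF c0])
  moreover have "reg_homotopic UNIV (N \<theta>1) c1"
    unfolding N_def using u[of 1] by (auto intro: reg_homotopic_sym homotopic_unit_speed[OF c1])
  ultimately show ?thesis by (meson reg_homotopic_trans)
qed

lemma periodic_attains_max:
  assumes "continuous_on UNIV (g :: real \<Rightarrow> real)" "\<And>t. g (t + 2 * pi) = g t"
  obtains a where "\<And>t. g t \<le> g a"
proof -
  have "continuous_on {0..2 * pi} g" using assms(1) continuous_on_subset by blast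
  then obtain a where a: "\<forall>t\<in>{0..2 * pi}. g t \<le> g a"
    using continuous_attains_sup[of "{0..2 * pi}" g] by force
  have "g t \<le> g a" for t
  proof -
    define n where "n = \<lfloor>t / (2 * pi)\<rfloor>"
    interpret periodic_fun_simple g "2 * pi" by unfold_locales (rule assms(2))
    have "g t = g (t - of_int n * (2 * pi))" using minus_of_int[of t n] by simp
    also have "\<dots> \<le> g a"
      unfolding n_def using floor_divide_lower[of "2 * pi" t] floor_divide_upper[of "2 * pi" t]
      by (intro a[rule_format]) (auto simp: algebra_simps)
    finally show ?thesis .
  qed
  then show ?thesis using that by blast
qed

lemma polar_loop_shift:
  assumes "polar_loop c r \<theta> k"
  shows "polar_loop (\<lambda>t. c (t + a)) (\<lambda>t. r (t + a)) (\<lambda>t. \<theta> (t + a)) k"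
    and "reg_homotopic UNIV c (\<lambda>t. c (t + a))"
proof -
  have r: "continuous_on UNIV r" and \<theta>: "continuous_on UNIV \<theta>"
    and c: "\<And>t. r t > 0" "\<And>t. (c has_vector_derivative of_real (r t) * cis (\<theta> t)) (at t)"
      "\<And>t. c (t + 2 * pi) = c t" "\<And>t. \<theta> (t + 2 * pi) = \<theta> t + 2 * pi * of_int k"
    using assms by (auto simp: polar_loop_def)
  have "c (t + 2 * pi + a) = c (t + a)" "\<theta> (t + 2 * pi + a) = \<theta> (t + a) + 2 * pi * of_int k" for t
    using c(3,4)[of "t + a"] by (simp_all add: algebra_simps)
  then show "polar_loop (\<lambda>t. c (t + a)) (\<lambda>t. r (t + a)) (\<lambda>t. \<theta> (t + a)) k"
    unfolding polar_loop_def
    using c by (auto intro!: has_vector_derivative_shift continuous_on_compose2[OF r]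
        continuous_on_compose2[OF \<theta>] continuous_intros)
  have "r t \<noteq> 0" for t using c(1)[of t] by simp
  then show "reg_homotopic UNIV c (\<lambda>t. c (t + a))"
    by (intro reg_homotopic_shift[OF c(2)]) (auto intro!: continuous_intros r \<theta> c(3))
qed

text \<open>A closed loop has mean velocity zero, which is impossible for positive multiples of one
  fixed direction.\<close>

lemma polar_loop_not_constant:
  assumes c: "polar_loop c r \<theta> k"
  shows "\<exists>u\<in>{0..2 * pi}. \<theta> u \<noteq> \<theta> 0"
proof (rule ccontr)
  assume contr: "\<not> ?thesis"
  have const: "\<theta> (2 * pi * x) = \<theta> 0" if "x \<in> {0..1}" for x
  proof -
    have "2 * pi * x \<in> {0..2 * pi}" using that by (auto simp: mult_le_cancel_left1)
    then show ?thesis using contr by blast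
  qed
  have r: "continuous_on UNIV r" and d: "\<And>t. (c has_vector_derivative of_real (r t) * cis (\<theta> t)) (at t)"
    and pos: "\<And>t. r t > 0" and cp: "c (0 + 2 * pi) = c 0" using c unfolding polar_loop_def by blast+
  have cr: "continuous_on {0..1} (\<lambda>x. r (2 * pi * x))"
    by (intro continuous_on_compose2[OF r] continuous_intros) auto
  have "0 = mean (\<lambda>t. of_real (r t) * cis (\<theta> t))"
    using mean_derivative_eq_0[OF d] cp by simp
  also have "\<dots> = integral {0..1} (\<lambda>x. of_real (r (2 * pi * x)) * cis (\<theta> 0))"
    unfolding mean_def by (intro integral_cong) (simp add: const)
  also have "\<dots> = of_real (integral {0..1} (\<lambda>x. r (2 * pi * x))) * cis (\<theta> 0)"
    using integral_linear[OF integrable_continuous_real[OF cr] bounded_linear_of_real[where 'a = complex]]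
    by (simp add: o_def)
  finally have "integral {0..1} (\<lambda>x. r (2 * pi * x)) = 0" by simp
  then have "\<forall>x\<in>{0..1::real}. r (2 * pi * x) = 0"
    by (subst (asm) integral_eq_0_iff[OF cr]) (auto intro: less_imp_le pos)
  then have "r (2 * pi * 0) = 0" by (meson atLeastAtMost_iff order_refl zero_le_one)
  then show False using pos[of 0] by simp
qed

theorem Whitney_Graustein:
  assumes "turning_number c0 k" "turning_number c1 k"
  shows "reg_homotopic UNIV c0 c1"
proof -
  obtain r0 \<theta>0 r1 \<theta>1 where c: "polar_loop c0 r0 \<theta>0 k" "polar_loop c1 r1 \<theta>1 k"
    using assms by (auto simp: turning_number_def)
  show ?thesis
  proof (cases "k = 0")
    case False
    \<comment> \<open>Every convex combination of the angles grows by \<open>2 * pi * k\<close> over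
      a period, so for \<open>k \<noteq> 0\<close> the point \<open>2 * pi\<close> witnesses that it
      is not constant.\<close>
    have "(1 - s) * \<theta>0 (2 * pi) + s * \<theta>1 (2 * pi) \<noteq> (1 - s) * \<theta>0 0 + s * \<theta>1 0" for s
    proof -
      have "\<theta>0 (0 + 2 * pi) = \<theta>0 0 + 2 * pi * of_int k" "\<theta>1 (0 + 2 * pi) = \<theta>1 0 + 2 * pi * of_int k"
        using c unfolding polar_loop_def by blast+
      then show ?thesis using False by (simp add: algebra_simps)
    qed
    then show ?thesis by (intro homotopic_angles[OF c]) (auto intro!: bexI[of _ "2 * pi"])
  next
    case True
    text \<open>Placing the maxima of both angles at the same parameter keeps every convex combination
      of the two angles nonconstant.\<close>
    have max: "\<exists>a. \<forall>t. \<theta> t \<le> \<theta> a" if "polar_loop c r \<theta> k" for c r \<theta>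
    proof -
      have "continuous_on UNIV \<theta>" "\<And>t. \<theta> (t + 2 * pi) = \<theta> t"
        using that True by (simp_all add: polar_loop_def)
      then show ?thesis using periodic_attains_max by metis
    qed
    obtain a0 a1 where a: "\<And>t. \<theta>0 t \<le> \<theta>0 a0" "\<And>t. \<theta>1 t \<le> \<theta>1 a1"
      using max c by metis
    define \<phi>0 \<phi>1 where "\<phi>0 t = \<theta>0 (t + a0)" and "\<phi>1 t = \<theta>1 (t + a1)" for t
    have le: "\<phi>0 t \<le> \<phi>0 0" "\<phi>1 t \<le> \<phi>1 0" for t using a by (auto simp: \<phi>0_def \<phi>1_def)
    have p: "polar_loop (\<lambda>t. c0 (t + a0)) (\<lambda>t. r0 (t + a0)) \<phi>0 k"
      "polar_loop (\<lambda>t. c1 (t + a1)) (\<lambda>t. r1 (t + a1)) \<phi>1 k"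
      using polar_loop_shift(1)[OF c(1), of a0] polar_loop_shift(1)[OF c(2), of a1]
      by (simp_all add: \<phi>0_def[abs_def] \<phi>1_def[abs_def])
    obtain u0 u1 where u: "u0 \<in> {0..2 * pi}" "\<phi>0 u0 \<noteq> \<phi>0 0" "u1 \<in> {0..2 * pi}" "\<phi>1 u1 \<noteq> \<phi>1 0"
      using polar_loop_not_constant[OF p(1)] polar_loop_not_constant[OF p(2)] by blast
    have "reg_homotopic UNIV (\<lambda>t. c0 (t + a0)) (\<lambda>t. c1 (t + a1))"
    proof (rule homotopic_angles[OF p])
      fix s :: real assume s: "s \<in> {0..1}"
      show "\<exists>u\<in>{0..2 * pi}. (1 - s) * \<phi>0 u + s * \<phi>1 u \<noteq> (1 - s) * \<phi>0 0 + s * \<phi>1 0"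
      \<comment> \<open>For \<open>s < 1\<close> the first angle has positive weight and drops
        strictly at \<open>u0\<close>, while the second cannot exceed its value at 0. At
        \<open>s = 1\<close> only the second angle is left and \<open>u1\<close> is the
        witness.\<close>
      proof (cases "s = 1")
        case True
        then show ?thesis using u by auto
      next
        case False
        have "(1 - s) * \<phi>0 u0 < (1 - s) * \<phi>0 0" using False s u le[of u0] by auto
        moreover have "s * \<phi>1 u0 \<le> s * \<phi>1 0" using s le by (intro mult_left_mono) auto
        ultimately show ?thesis using u by (intro bexI[of _ u0]) auto
      qed
    qed
    moreover have "reg_homotopic UNIV c0 (\<lambda>t. c0 (t + a0))" "reg_homotopic UNIV (\<lambda>t. c1 (t + a1)) c1"
      using polar_loop_shift(2)[OF c(1)] reg_homotopic_sym[OF polar_loop_shift(2)[OF c(2)]] .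
    ultimately show ?thesis by (meson reg_homotopic_trans)
  qed
qed

text \<open>The line is contractible, so the velocity has a continuous logarithm, whose imaginary
  part is the angle. By periodicity its increment over a period is a multiple of
  \<open>2 * pi\<close>, and by continuity the same multiple everywhere.\<close>

lemma turning_number_exists:
  assumes d: "\<And>t. (c has_vector_derivative c' t) (at t)" "continuous_on UNIV c'"
    and c: "\<And>t. c' t \<noteq> 0" "\<And>t. c (t + 2 * pi) = c t"
  obtains k where "turning_number c k"
proof -
  obtain g where g: "continuous_on UNIV g" "\<And>t. c' t = exp (g t)"
    by (rule continuous_logarithm_on_contractible[OF d(2) contractible_UNIV]) (use c(1) in auto)
  have per: "c' (t + 2 * pi) = c' t" for t using derivative_periodic[OF d(1) c(2)] .
  define f where "f t = (Im (g (t + 2 * pi)) - Im (g t)) / (2 * pi)" for t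
  have "f t \<in> \<int>" for t
  proof -
    have "exp (g (t + 2 * pi)) = exp (g t)" using per[of t] unfolding g(2) .
    then obtain n :: int where "g (t + 2 * pi) = g t + (of_int (2 * n) * pi) * \<i>"
      unfolding exp_eq by blast
    then have "f t = of_int n" by (simp add: f_def)
    then show ?thesis by simp
  qed
  moreover have "continuous_on UNIV f" unfolding f_def
    by (intro continuous_intros continuous_on_compose2[OF g(1)]) auto
  ultimately have "f constant_on UNIV" by (intro continuous_Ints_constant) auto
  then obtain a where a: "\<And>t. f t = a" by (auto simp: constant_on_def)
  then obtain k where k: "a = of_int k" using \<open>\<And>t. f t \<in> \<int>\<close> by (metis Ints_cases)
  have "Im (g (t + 2 * pi)) = Im (g t) + 2 * pi * of_int k" for t
    using a[of t] unfolding k f_def by (simp add: field_simps)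
  moreover have "(c has_vector_derivative of_real (exp (Re (g t))) * cis (Im (g t))) (at t)" for t
    using d(1)[of t] unfolding g(2) exp_eq_polar[of "g t"] .
  ultimately have "polar_loop c (\<lambda>t. exp (Re (g t))) (\<lambda>t. Im (g t)) k"
    unfolding polar_loop_def using c(2) g(1) by (auto intro!: continuous_intros)
  then show ?thesis using that unfolding turning_number_def by blast
qed

text \<open>If the velocity direction omits one value, a fixed branch of the argument is a
  continuous periodic angle. The constant \<open>\<zeta>\<close> rotates the omitted direction onto
  the negative real axis, where the principal branch is cut.\<close>

lemma turning_number_slit:
  assumes d: "\<And>t. (c has_vector_derivative \<zeta> * w t) (at t)"
    and c: "\<And>t. c (t + 2 * pi) = c t"
    and w: "continuous_on UNIV w" "\<And>t. w t \<notin> \<real>\<^sub>\<le>\<^sub>0" and \<zeta>: "\<zeta> \<noteq> 0"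
  shows "turning_number c 0"
proof -
  have "\<zeta> * w (t + 2 * pi) = \<zeta> * w t" for t using derivative_periodic[OF d c] .
  then have per: "w (t + 2 * pi) = w t" for t using \<zeta> by simp
  have "w t \<noteq> 0" for t using w(2)[of t] by auto
  then have "\<zeta> * w t = of_real (cmod \<zeta> * cmod (w t)) * cis (Arg \<zeta> + Arg (w t))" for t
    using rcis_cmod_Arg[of \<zeta>] rcis_cmod_Arg[of "w t"] rcis_mult[of "cmod \<zeta>" "Arg \<zeta>" "cmod (w t)" "Arg (w t)"]
    unfolding rcis_def by simp
  moreover have "continuous_on UNIV (\<lambda>t. Arg (w t))"
    using w by (intro continuous_on_compose2[of "- \<real>\<^sub>\<le>\<^sub>0" Arg UNIV w] continuous_on_Arg) auto
  ultimately have "polar_loop c (\<lambda>t. cmod \<zeta> * cmod (w t)) (\<lambda>t. Arg \<zeta> + Arg (w t)) 0"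
    unfolding polar_loop_def using d c \<zeta> per \<open>\<And>t. w t \<noteq> 0\<close>
    by (auto intro!: continuous_intros w(1))
  then show ?thesis unfolding turning_number_def by blast
qed

lemma turning_number_cis:
  assumes "k \<noteq> 0"
  shows "turning_number (\<lambda>t. cis (of_int k * t)) k"
proof -
  define \<zeta> where "\<zeta> = \<i> * of_int k"
  have "((\<lambda>t. cis (of_int k * t)) has_vector_derivative \<zeta> * cis (of_int k * t)) (at t)" for t
    by (auto intro!: derivative_eq_intros simp: \<zeta>_def has_vector_derivative_def scaleR_conv_of_real)
  moreover have "\<zeta> * cis x = of_real (cmod \<zeta>) * cis (Arg \<zeta> + x)" for x
    using rcis_cmod_Arg[of \<zeta>] unfolding rcis_def by (simp add: cis_mult[symmetric] mult.assoc[symmetric])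
  ultimately have "((\<lambda>t. cis (of_int k * t)) has_vector_derivative
      of_real (cmod \<zeta>) * cis (Arg \<zeta> + of_int k * t)) (at t)" for t
    by simp
  moreover have "cis (of_int k * (t + 2 * pi)) = cis (of_int k * t)" for t
    by (rule cis_add_period[of _ _ k]) (simp add: algebra_simps)
  moreover have "Arg \<zeta> + of_int k * (t + 2 * pi) = Arg \<zeta> + of_int k * t + 2 * pi * of_int k" for t
    by (simp add: algebra_simps)
  moreover have "cmod \<zeta> > 0" using assms by (simp add: \<zeta>_def)
  ultimately have "polar_loop (\<lambda>t. cis (of_int k * t)) (\<lambda>t. cmod \<zeta>) (\<lambda>t. Arg \<zeta> + of_int k * t) k"
    unfolding polar_loop_def by (auto intro!: continuous_intros simp del: distrib_left)
  then show ?thesis unfolding turning_number_def by blast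
qed

lemma standard_figure_eight_derivative:
  "(standard_figure_eight has_vector_derivative Complex (- sin t) (cos (2 * t))) (at t)"
proof -
  have "standard_figure_eight = (\<lambda>t. Complex (cos t) (cos t * sin t))"
    by (auto simp: standard_figure_eight_def complex_eq_iff)
  moreover have "((\<lambda>t. Complex (cos t) (cos t * sin t)) has_vector_derivative
      Complex (- sin t) (cos (2 * t))) (at t)"
    by (auto intro!: derivative_eq_intros simp: has_vector_derivative_complex_iff cos_double power2_eq_square)
  ultimately show ?thesis by simp
qed

lemma standard_figure_eight_periodic: "standard_figure_eight (t + 2 * pi) = standard_figure_eight t"
  by (simp add: standard_figure_eight_def)

lemma standard_figure_eight_velocity: "Complex (cos (2 * t)) (sin t) \<notin> \<real>\<^sub>\<le>\<^sub>0"
proof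
  assume "Complex (cos (2 * t)) (sin t) \<in> \<real>\<^sub>\<le>\<^sub>0"
  then have "sin t = 0" "cos (2 * t) \<le> 0" by (auto simp: complex_nonpos_Reals_iff)
  then show False by (simp add: cos_double cos_squared_eq)
qed

lemma turning_number_figure_eight: "turning_number standard_figure_eight 0"
proof (rule turning_number_slit)
  \<comment> \<open>The standard figure-eight never moves straight down: the direction
    \<open>- \<i>\<close> is omitted, and dividing by \<open>\<i>\<close> places it at the
    cut.\<close>
  show "(standard_figure_eight has_vector_derivative \<i> * Complex (cos (2 * t)) (sin t)) (at t)" for t
  proof -
    have "\<i> * Complex (cos (2 * t)) (sin t) = Complex (- sin t) (cos (2 * t))"
      by (simp add: complex_eq_iff)
    then show ?thesis using standard_figure_eight_derivative by simp
  qed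
  show "continuous_on UNIV (\<lambda>t. Complex (cos (2 * t)) (sin t))"
    by (intro continuous_on_Complex continuous_intros)
qed (use standard_figure_eight_periodic standard_figure_eight_velocity in auto)

section \<open>Immersed loops on the sphere\<close>

lemma bounded_linear_mk3: "bounded_linear (\<lambda>p. mk3 (fst p) (snd p))"
  unfolding mk3_def
  by (intro bounded_linear_add bounded_linear_scaleR_const bounded_linear_compose[OF bounded_linear_Re]
      bounded_linear_compose[OF bounded_linear_Im] bounded_linear_fst bounded_linear_snd)

lemma has_derivative_mk3:
  assumes "(w has_derivative w') (at x within S)" "(h has_derivative h') (at x within S)"
  shows "((\<lambda>t. mk3 (w t) (h t)) has_derivative (\<lambda>v. mk3 (w' v) (h' v))) (at x within S)"
  using bounded_linear.has_derivative[OF bounded_linear_mk3 has_derivative_Pair[OF assms]] by simp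

lemma has_vector_derivative_mk3:
  assumes "(w has_vector_derivative w') (at x within S)" "(h has_vector_derivative h') (at x within S)"
  shows "((\<lambda>t. mk3 (w t) (h t)) has_vector_derivative mk3 w' h') (at x within S)"
proof -
  have "mk3 (x *\<^sub>R w') (x *\<^sub>R h') = x *\<^sub>R mk3 w' h'" for x by (simp add: mk3_def algebra_simps)
  then show ?thesis
    using has_derivative_mk3[OF assms[unfolded has_vector_derivative_def]]
    by (simp add: has_vector_derivative_def)
qed

section \<open>Stereographic projection and its spinor\<close>

definition den :: "complex \<Rightarrow> real" where
  "den z = 1 + (Re z)\<^sup>2 + (Im z)\<^sup>2"

definition dot2 :: "complex \<Rightarrow> complex \<Rightarrow> real" where
  "dot2 z v = Re z * Re v + Im z * Im v"

text \<open>The inverse of the projection \<open>stereo 1\<close> from the north pole. Its conformal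
  factor is \<open>2 / den z\<close>, and \<open>sphere_velocity z\<close> is its
  differential.\<close>

definition sphere_point :: "complex \<Rightarrow> real^3" where
  "sphere_point z = mk3 (of_real (2 / den z) * z) (1 - 2 / den z)"

definition sphere_velocity :: "complex \<Rightarrow> complex \<Rightarrow> real^3" where
  "sphere_velocity z v =
     mk3 (of_real (2 / den z) * v - of_real (4 * dot2 z v / (den z)\<^sup>2) * z) (4 * dot2 z v / (den z)\<^sup>2)"

definition stereo :: "real \<Rightarrow> real^3 \<Rightarrow> complex" where
  "stereo \<epsilon> x = Complex (x $ 1 / (1 - \<epsilon> * x $ 3)) (x $ 2 / (1 - \<epsilon> * x $ 3))"

lemma den_pos: "den z > 0"
  by (simp add: den_def add_pos_nonneg)

lemma den_cmod: "den z = 1 + (cmod z)\<^sup>2"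
  by (simp add: den_def cmod_power2)

lemma continuous_on_den [continuous_intros]: "continuous_on S f \<Longrightarrow> continuous_on S (\<lambda>x. den (f x))"
  unfolding den_def by (intro continuous_intros)

lemma sphere_point_has_derivative:
  "(sphere_point has_derivative sphere_velocity z) (at z)"
proof -
  have d: "den z \<noteq> 0" using den_pos[of z] by simp
  have den': "(den has_derivative (\<lambda>v. 2 * dot2 z v)) (at z)"
    unfolding den_def[abs_def] dot2_def
    by (auto intro!: derivative_eq_intros simp: algebra_simps)
  have q: "((\<lambda>z. 2 / den z) has_derivative (\<lambda>v. - (4 * dot2 z v / (den z)\<^sup>2))) (at z)"
    by (rule has_derivative_eq_rhs[OF has_derivative_divide'[OF has_derivative_const den' d]])
      (auto simp: fun_eq_iff power2_eq_square)
  have eq: "of_real (2 / den z) * v + of_real (- (4 * dot2 z v / (den z)\<^sup>2)) * z =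
      of_real (2 / den z) * v - of_real (4 * dot2 z v / (den z)\<^sup>2) * z" for v
    by simp
  have "((\<lambda>x. 1 - 2 / den x) has_derivative (\<lambda>v. 4 * dot2 z v / (den z)\<^sup>2)) (at z)"
    by (rule has_derivative_eq_rhs[OF has_derivative_diff[OF has_derivative_const q]]) auto
  from has_derivative_mk3[OF has_derivative_mult[OF has_derivative_of_real[OF q] has_derivative_ident] this]
  show ?thesis
    unfolding sphere_point_def[abs_def] sphere_velocity_def[abs_def] eq .
qed

lemma norm_sphere_point: "norm (sphere_point z) = 1"
proof -
  define q where "q = 2 / den z"
  have "q * den z = 2" using den_pos[of z] by (simp add: q_def)
  then have q: "q * (1 + (Re z)\<^sup>2 + (Im z)\<^sup>2) = 2" by (simp only: den_def)
  have "(norm (sphere_point z))\<^sup>2 = (q * Re z)\<^sup>2 + (q * Im z)\<^sup>2 + (1 - q)\<^sup>2"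
    by (simp add: norm_real3 sphere_point_def q_def[symmetric] add_nonneg_nonneg)
  also have "\<dots> = 1 + q * (q * (1 + (Re z)\<^sup>2 + (Im z)\<^sup>2) - 2)"
    by (simp add: power2_eq_square algebra_simps)
  finally have "(norm (sphere_point z))\<^sup>2 = 1\<^sup>2" using q by simp
  then show ?thesis by (rule power2_eq_imp_eq) auto
qed

lemma sphere_point_nth3: "sphere_point z $ 3 < 1"
  using den_pos[of z] by (simp add: sphere_point_def)

lemma stereo_sphere_point: "stereo 1 (sphere_point z) = z"
  using den_pos[of z] by (simp add: stereo_def sphere_point_def complex_eq_iff)

lemma norm1_nth3:
  assumes "norm (x::real^3) = 1"
  shows "(x$1)\<^sup>2 + (x$2)\<^sup>2 = 1 - (x$3)\<^sup>2" "\<bar>x$3\<bar> \<le> 1"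
proof -
  show *: "(x$1)\<^sup>2 + (x$2)\<^sup>2 = 1 - (x$3)\<^sup>2" using assms by (simp add: norm_real3)
  have "(x$3)\<^sup>2 \<le> 1" using * by (smt (verit) zero_le_power2)
  then show "\<bar>x$3\<bar> \<le> 1" by (simp add: abs_square_le_1)
qed

lemma sphere_point_stereo:
  assumes "norm x = 1" "x $ 3 \<noteq> 1"
  shows "sphere_point (stereo 1 x) = x"
proof -
  have lt: "1 - x$3 > 0" using norm1_nth3(2)[OF assms(1)] assms(2) by auto
  have "den (stereo 1 x) = 1 + ((x$1)\<^sup>2 + (x$2)\<^sup>2) / (1 - x$3)\<^sup>2"
    by (simp add: den_def stereo_def power_divide add_divide_distrib)
  also have "\<dots> = 1 + (1 - x$3) * (1 + x$3) / (1 - x$3)\<^sup>2"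
    unfolding norm1_nth3(1)[OF assms(1)] by (simp add: power2_eq_square algebra_simps)
  also have "\<dots> = 1 + (1 + x$3) / (1 - x$3)" using lt by (simp add: power2_eq_square)
  also have "\<dots> = 2 / (1 - x$3)" using lt by (simp add: field_simps)
  finally have "2 / den (stereo 1 x) = 1 - x$3" using lt by simp
  then show ?thesis using lt unfolding sphere_point_def
    by (simp add: vec_eq_iff forall_3 stereo_def)
qed

lemma sphere_velocity_scale: "sphere_velocity z (of_real r * v) = r *\<^sub>R sphere_velocity z v"
  by (simp add: sphere_velocity_def vec_eq_iff forall_3 dot2_def algebra_simps add_divide_distrib)

text \<open>The height component is a multiple of \<open>dot2 z v\<close>; once it vanishes, the
  horizontal part is just \<open>2 / den z\<close> times \<open>v\<close>.\<close>

lemma sphere_velocity_nonzero: "v \<noteq> 0 \<Longrightarrow> sphere_velocity z v \<noteq> 0"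
proof
  assume "v \<noteq> 0" "sphere_velocity z v = 0"
  then have "4 * dot2 z v / (den z)\<^sup>2 = 0" "of_real (2 / den z) * v - of_real (4 * dot2 z v / (den z)\<^sup>2) * z = 0"
    unfolding sphere_velocity_def
    by (metis mk3_nth(3) zero_index, metis mk3_nth(1,2) complex_eq_iff zero_complex.sel zero_index)
  then show False using \<open>v \<noteq> 0\<close> den_pos[of z] by simp
qed

lemma continuous_on_sphere_velocity: "continuous_on UNIV (\<lambda>(z, v). sphere_velocity z v)"
proof -
  have "den z \<noteq> 0" for z using den_pos[of z] by simp
  then show ?thesis
    unfolding sphere_velocity_def dot2_def case_prod_unfold
    by (auto intro!: continuous_intros)
qed

text \<open>Along a plane curve \<open>z\<close> with velocity angle \<open>\<theta>\<close> and turning number \<open>k\<close> this spinor lifts the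
  frame of the stereographic image, and over one period it picks up the sign \<open>(-1)^k\<close>.\<close>

lemma spin_stereo:
  fixes z \<theta>
  defines "u \<equiv> cis (- \<theta> / 2) / of_real (sqrt (den z))"
  shows "norm (z * u, u) = 1" "spin1 (z * u, u) = sphere_point z"
    "spin2 (z * u, u) = (den z / 2) *\<^sub>R sphere_velocity z (cis \<theta>)"
proof -
  have dp: "den z > 0" by (rule den_pos)
  have cu: "(cmod u)\<^sup>2 = 1 / den z" using dp by (simp add: u_def norm_divide power_divide)
  have cz: "(cmod z)\<^sup>2 = den z - 1" by (simp add: den_cmod)
  have uu: "u * cnj u = of_real (1 / den z)" using cu by (simp add: complex_norm_square[symmetric])
  have u2: "u\<^sup>2 = cis (- \<theta>) / of_real (den z)"
    using dp by (simp add: u_def power_divide power2_eq_square cis_mult of_real_mult[symmetric] del: of_real_mult)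
  have cu2: "(cnj u)\<^sup>2 = cis \<theta> / of_real (den z)"
    using arg_cong[OF u2, of cnj] by (simp add: cis_cnj)
  show "norm (z * u, u) = 1"
    using dp by (simp add: norm_spinor norm_mult power_mult_distrib cu cz) (simp add: field_simps)
  have "2 * (z * u) * cnj u = 2 * z * (u * cnj u)" by (simp add: algebra_simps)
  also have "\<dots> = of_real (2 / den z) * z" by (simp add: uu)
  finally have "2 * (z * u) * cnj u = of_real (2 / den z) * z" .
  moreover have "(cmod (z * u))\<^sup>2 - (cmod u)\<^sup>2 = 1 - 2 / den z"
    using dp by (simp add: norm_mult power_mult_distrib cu cz) (simp add: field_simps)
  ultimately show "spin1 (z * u, u) = sphere_point z"
    by (simp add: spin1_def sphere_point_def)
  have "spin2 (z * u, u) = mk3 ((cnj u)\<^sup>2 - z\<^sup>2 * u\<^sup>2) (2 * Re (z * u\<^sup>2))"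
    by (simp add: spin2_def power_mult_distrib power2_eq_square mult.assoc)
  also have "\<dots> = mk3 ((cis \<theta> - z\<^sup>2 * cis (- \<theta>)) / of_real (den z)) (2 * dot2 z (cis \<theta>) / den z)"
    unfolding u2 cu2 using dp by (simp add: diff_divide_distrib dot2_def Re_divide_of_real)
  also have "\<dots> = (den z / 2) *\<^sub>R sphere_velocity z (cis \<theta>)"
  proof -
    \<comment> \<open>Add and subtract \<open>|z|^2 * cis \<theta>\<close>: what is subtracted is
      \<open>z\<close> times the sum of \<open>cnj z * cis \<theta>\<close> and its conjugate, that
      is, twice the inner product.\<close>
    have 1: "cis \<theta> - z\<^sup>2 * cis (- \<theta>) = of_real (den z) * cis \<theta> - of_real (2 * dot2 z (cis \<theta>)) * z"
      by (simp add: complex_eq_iff den_def dot2_def power2_eq_square algebra_simps)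
    show ?thesis unfolding 1 using dp
      by (simp add: vec_eq_iff forall_3 sphere_velocity_def field_simps power2_eq_square Re_divide_of_real Im_divide_of_real)
  qed
  finally show "spin2 (z * u, u) = (den z / 2) *\<^sub>R sphere_velocity z (cis \<theta>)" .
qed

text \<open>The explicit lift of \<open>spin_stereo\<close> agrees up to a global sign with the
  given closed lift, so it is closed too. It contains half of the angle, hence gains the factor
  \<open>cis (- pi * k)\<close> over a period, and this must be 1.\<close>

lemma even_turning_number:
  assumes c: "polar_loop z r \<theta> k"
    and e: "even_frame (\<lambda>t. sphere_point (z t))
      (\<lambda>t. sgn (sphere_velocity (z t) (of_real (r t) * cis (\<theta> t))))"
  shows "even k"
proof -
  have r: "r t > 0" and \<theta>: "continuous_on UNIV \<theta>"
    and zd: "(z has_vector_derivative of_real (r t) * cis (\<theta> t)) (at t)"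
    and zp: "z (t + 2 * pi) = z t" and tp: "\<theta> (t + 2 * pi) = \<theta> t + 2 * pi * of_int k" for t
    using c by (auto simp: polar_loop_def)
  have cz: "continuous_on UNIV z"
    using zd by (meson continuous_at_imp_continuous_on has_vector_derivative_continuous)
  define u where "u t = cis (- \<theta> t / 2) / of_real (sqrt (den (z t)))" for t
  define Q where "Q t = (z t * u t, u t)" for t
  have Q: "norm (Q t) = 1" "spin1 (Q t) = sphere_point (z t)"
    "spin2 (Q t) = (den (z t) / 2) *\<^sub>R sphere_velocity (z t) (cis (\<theta> t))" for t
    using spin_stereo[of "z t" "\<theta> t"] by (simp_all add: Q_def u_def)
  have "sgn (sphere_velocity (z t) (of_real (r t) * cis (\<theta> t))) = spin2 (Q t)" for t
  proof -
    have "norm (spin2 (Q t)) = 1" using orthonormal_spin[OF Q(1)] by (simp add: orthonormal2_def)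
    moreover have "sphere_velocity (z t) (of_real (r t) * cis (\<theta> t)) = (r t * 2 / den (z t)) *\<^sub>R spin2 (Q t)"
      using den_pos[of "z t"] by (simp add: Q(3) sphere_velocity_scale)
    moreover have "r t * 2 / den (z t) > 0" using r den_pos[of "z t"] by simp
    moreover have "sgn (a *\<^sub>R y) = y" if "norm y = 1" "a > 0" for a and y :: "real^3"
      using that by (simp add: sgn_scaleR) (simp add: sgn_div_norm)
    ultimately show ?thesis by metis
  qed
  then have spin: "spin (Q t) = (sphere_point (z t), sgn (sphere_velocity (z t) (of_real (r t) * cis (\<theta> t))))" for t
    by (simp add: spin_def Q(2))
  have "continuous_on UNIV Q"
  proof -
    have "sqrt (den (z t)) \<noteq> 0" for t using den_pos[of "z t"] by simp
    then show ?thesis unfolding Q_def u_def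
      by (auto intro!: continuous_intros \<theta> cz)
  qed
  with spin Q have lift: "spin_lift UNIV (\<lambda>t. sphere_point (z t))
      (\<lambda>t. sgn (sphere_velocity (z t) (of_real (r t) * cis (\<theta> t)))) Q"
    by (simp add: spin_lift_def)
  obtain P where P: "spin_lift UNIV (\<lambda>t. sphere_point (z t))
      (\<lambda>t. sgn (sphere_velocity (z t) (of_real (r t) * cis (\<theta> t)))) P" "\<And>t. P (t + 2 * pi) = P t"
    using e by (auto simp: even_frame_def)
  have "Q (0 + 2 * pi) = Q 0"
    using spin_lift_unique[OF connected_UNIV lift P(1)] P(2)[of 0] by auto
  then have "u (0 + 2 * pi) = u 0" by (simp add: Q_def)
  moreover have "u (0 + 2 * pi) = cis (- pi * of_int k) * u 0"
  proof -
    have eq: "- \<theta> (0 + 2 * pi) / 2 = - pi * of_int k + - \<theta> 0 / 2" using tp[of 0] by (simp add: field_simps)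
    show ?thesis unfolding u_def eq zp cis_mult[symmetric] by simp
  qed
  moreover have "u 0 \<noteq> 0" using den_pos[of "z 0"] by (simp add: u_def)
  ultimately have "cis (- pi * of_int k) = 1" by simp
  then have "cos (pi * of_int k) = 1" by (simp add: complex_eq_iff)
  then show ?thesis by (simp split: if_splits)
qed

section \<open>Rotating a spherical loop away from the pole\<close>

text \<open>The rotation by \<open>pi\<close> about the axis \<open>u\<close> in three-space, that
  is, twice the projection to \<open>u\<close> minus the identity. The vector \<open>u\<close> is
  not normalised, so that it may run along a segment.\<close>

definition half_turn :: "'a::real_inner \<Rightarrow> 'a \<Rightarrow> 'a" where
  "half_turn u x = (2 * (x \<bullet> u) / (u \<bullet> u)) *\<^sub>R u - x"

lemma inner_half_turn: "u \<noteq> 0 \<Longrightarrow> half_turn u x \<bullet> half_turn u y = x \<bullet> y"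
  by (simp add: half_turn_def inner_diff inner_commute)

lemma norm_half_turn: "u \<noteq> 0 \<Longrightarrow> norm (half_turn u x) = norm x"
  by (simp add: norm_eq_sqrt_inner inner_half_turn)

lemma bounded_linear_half_turn: "bounded_linear (half_turn u)"
proof -
  have "half_turn u = (\<lambda>x. (x \<bullet> ((2 / (u \<bullet> u)) *\<^sub>R u)) *\<^sub>R u - x)"
    by (simp add: half_turn_def fun_eq_iff)
  moreover have "bounded_linear (\<lambda>x. (x \<bullet> ((2 / (u \<bullet> u)) *\<^sub>R u)) *\<^sub>R u - x)"
    by (intro bounded_linear_sub bounded_linear_scaleR_const bounded_linear_inner_left bounded_linear_ident)
  ultimately show ?thesis by simp
qed

lemma half_turn_self: "u \<noteq> 0 \<Longrightarrow> half_turn u u = u"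
  by (simp add: half_turn_def scaleR_2)

lemma half_turn_half_turn: "u \<noteq> 0 \<Longrightarrow> half_turn u (half_turn u x) = x"
  by (simp add: half_turn_def inner_diff algebra_simps)

text \<open>The half-turn about the bisector of two unit vectors exchanges them.\<close>

lemma half_turn_sum: "norm m = 1 \<Longrightarrow> norm n = 1 \<Longrightarrow> n + m \<noteq> 0 \<Longrightarrow> half_turn (n + m) m = n"
proof -
  assume 1: "norm m = 1" "norm n = 1" and ne: "n + m \<noteq> 0"
  have i: "m \<bullet> m = 1" "n \<bullet> n = 1" using 1 by (simp_all add: norm_eq_1)
  have eq: "(n + m) \<bullet> (n + m) = 2 * (m \<bullet> (n + m))"
    using i by (simp add: inner_add inner_commute)
  moreover have "(n + m) \<bullet> (n + m) \<noteq> 0" using ne by simp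
  ultimately have "2 * (m \<bullet> (n + m)) / ((n + m) \<bullet> (n + m)) = 1" by (metis divide_self)
  then have "half_turn (n + m) m = 1 *\<^sub>R (n + m) - m" by (simp only: half_turn_def)
  then show ?thesis by simp
qed

definition sphere_loop :: "(real \<Rightarrow> real^3) \<Rightarrow> (real \<Rightarrow> real^3) \<Rightarrow> bool" where
  "sphere_loop \<tau> \<tau>' \<longleftrightarrow> continuous_on UNIV \<tau>' \<and>
     (\<forall>t. (\<tau> has_vector_derivative \<tau>' t) (at t) \<and> \<tau>' t \<noteq> 0 \<and> norm (\<tau> t) = 1 \<and> \<tau> (t + 2 * pi) = \<tau> t)"

lemma sphere_loop_tangent:
  assumes "\<And>t. (\<tau> has_vector_derivative v t) (at t)" "\<And>t. norm (\<tau> t :: 'a::real_inner) = 1"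
  shows "\<tau> t \<bullet> v t = 0"
proof -
  have "((\<lambda>t. \<tau> t \<bullet> \<tau> t) has_vector_derivative (\<tau> t \<bullet> v t + v t \<bullet> \<tau> t)) (at t)"
    using has_derivative_inner[OF assms(1)[unfolded has_vector_derivative_def] assms(1)[unfolded has_vector_derivative_def]]
    by (simp add: has_vector_derivative_def algebra_simps)
  moreover have "(\<lambda>t. \<tau> t \<bullet> \<tau> t) = (\<lambda>_. 1)" using assms(2) by (simp add: norm_eq_1)
  ultimately have "\<tau> t \<bullet> v t + v t \<bullet> \<tau> t = 0"
    by (metis has_vector_derivative_const vector_derivative_unique_at)
  then show ?thesis by (simp add: inner_commute)
qed

lemma sphere_loop_continuous: "sphere_loop \<tau> \<tau>' \<Longrightarrow> continuous_on UNIV \<tau>"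
  unfolding sphere_loop_def
  by (meson continuous_at_imp_continuous_on has_vector_derivative_continuous)

text \<open>A product of two half-turns. It gives an explicit path of isometries: the identity at
  \<open>s = 0\<close>, and a map carrying \<open>m\<close> to \<open>n\<close> at
  \<open>s = 1\<close>, where the second axis is the bisector. The axis \<open>n + s m\<close>
  degenerates only for \<open>m = - n\<close>.\<close>

definition rotation :: "'a::real_inner \<Rightarrow> 'a \<Rightarrow> real \<Rightarrow> 'a \<Rightarrow> 'a" where
  "rotation n m s x = half_turn n (half_turn (n + s *\<^sub>R m) x)"

lemma rotation_family:
  fixes n m :: "'a::real_inner"
  assumes nm: "norm n = 1" "norm m = 1" "m \<noteq> - n" and s: "s \<in> {0..1}"
  shows "n + s *\<^sub>R m \<noteq> 0" "rotation n m s x \<bullet> rotation n m s y = x \<bullet> y"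
    "norm (rotation n m s x) = norm x" "bounded_linear (rotation n m s)"
    "rotation n m 0 x = x" "rotation n m 1 m = n"
proof -
  show ne: "n + s *\<^sub>R m \<noteq> 0"
  proof
    assume 0: "n + s *\<^sub>R m = 0"
    then have "n = - (s *\<^sub>R m)" by (simp add: eq_neg_iff_add_eq_0)
    then have "1 = \<bar>s\<bar>" using nm by (metis mult.right_neutral norm_minus_cancel norm_scaleR)
    then have "s = 1" using s by simp
    then show False using 0 nm(3) by (simp add: eq_neg_iff_add_eq_0 add.commute)
  qed
  have n0: "n \<noteq> 0" using nm by auto
  show "rotation n m s x \<bullet> rotation n m s y = x \<bullet> y"
    by (simp add: rotation_def inner_half_turn n0 ne)
  show "norm (rotation n m s x) = norm x" by (simp add: rotation_def norm_half_turn n0 ne)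
  show "bounded_linear (rotation n m s)"
    unfolding rotation_def[abs_def]
    by (intro bounded_linear_compose[OF bounded_linear_half_turn bounded_linear_half_turn])
  show "rotation n m 0 x = x" by (simp add: rotation_def half_turn_half_turn n0)
  have "n + m \<noteq> 0" using nm(3) by (simp add: eq_neg_iff_add_eq_0 add.commute)
  then show "rotation n m 1 m = n"
    by (simp add: rotation_def half_turn_sum nm half_turn_self n0)
qed

lemma continuous_on_rotation:
  fixes n m :: "'a::real_inner"
  assumes nm: "norm n = 1" "norm m = 1" "m \<noteq> - n" and f: "continuous_on UNIV (f :: real \<Rightarrow> 'a)"
  shows "continuous_on ({0..1} \<times> UNIV) (\<lambda>(s, t). rotation n m s (f t))"
proof -
  have "(n + s *\<^sub>R m) \<bullet> (n + s *\<^sub>R m) \<noteq> 0" if "s \<in> {0..1}" for s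
    using rotation_family(1)[OF nm that] by simp
  moreover have "n \<bullet> n \<noteq> 0" using nm by (simp add: norm_eq_1)
  ultimately show ?thesis
    unfolding rotation_def half_turn_def case_prod_unfold
    by (auto intro!: continuous_intros continuous_on_compose2[OF f])
qed

lemma rotate_sphere_loop:
  fixes n m :: "real^3"
  assumes nm: "norm n = 1" "norm m = 1" "m \<noteq> - n" and \<tau>: "sphere_loop \<tau> \<tau>'"
  defines "\<rho> \<equiv> rotation n m 1"
  shows "sphere_loop (\<rho> \<circ> \<tau>) (\<rho> \<circ> \<tau>')" "reg_homotopic (sphere 0 1) \<tau> (\<rho> \<circ> \<tau>)"
    "even_frame \<tau> (\<lambda>t. sgn (\<tau>' t)) \<Longrightarrow> even_frame (\<rho> \<circ> \<tau>) (\<lambda>t. sgn ((\<rho> \<circ> \<tau>') t))"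
proof -
  let ?R = "rotation n m"
  note R = rotation_family[OF nm]
  have ct: "continuous_on UNIV \<tau>" and ct': "continuous_on UNIV \<tau>'"
    using sphere_loop_continuous[OF \<tau>] \<tau> by (auto simp: sphere_loop_def)
  have d: "(\<tau> has_vector_derivative \<tau>' t) (at t)" "\<tau>' t \<noteq> 0" "norm (\<tau> t) = 1" "\<tau> (t + 2 * pi) = \<tau> t" for t
    using \<tau> by (auto simp: sphere_loop_def)
  have per: "\<tau>' (t + 2 * pi) = \<tau>' t" for t using derivative_periodic[OF d(1) d(4)] .
  have Rd: "((\<lambda>t. ?R s (\<tau> t)) has_vector_derivative ?R s (\<tau>' t)) (at t)" if "s \<in> {0..1}" for s t
    by (rule bounded_linear.has_vector_derivative[OF R(4)[OF that] d(1)])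
  have Rn: "?R s (\<tau>' t) \<noteq> 0" if "s \<in> {0..1}" for s t
    using R(3)[OF that, of "\<tau>' t"] d(2)[of t] by auto
  have hom: "reg_homotopy (sphere 0 1) (\<lambda>s t. ?R s (\<tau> t)) (\<lambda>s t. ?R s (\<tau>' t))"
    unfolding reg_homotopy_def
    using continuous_on_rotation[OF nm ct] continuous_on_rotation[OF nm ct'] Rd Rn R(3) d(3,4) by auto
  then show "reg_homotopic (sphere 0 1) \<tau> (\<rho> \<circ> \<tau>)"
    unfolding reg_homotopic_def \<rho>_def using R(5)[of 0]
    by (intro exI[of _ "\<lambda>s t. ?R s (\<tau> t)"] exI[of _ "\<lambda>s t. ?R s (\<tau>' t)"]) (auto simp: o_def)
  have "continuous_on UNIV (\<lambda>t. ?R 1 (\<tau>' t))"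
    using continuous_on_slice[OF continuous_on_rotation[OF nm ct'], of 1] by simp
  then show "sphere_loop (\<rho> \<circ> \<tau>) (\<rho> \<circ> \<tau>')"
    unfolding sphere_loop_def \<rho>_def o_def using Rd[of 1] Rn[of 1] R(3)[of 1] d(3,4) by simp
  have cs: "continuous_on UNIV (\<lambda>t. sgn (\<tau>' t))"
    using ct' d(2) by (intro continuous_on_sgn) auto
  assume e: "even_frame \<tau> (\<lambda>t. sgn (\<tau>' t))"
  have "even_frame (\<lambda>t. ?R 1 (\<tau> t)) (\<lambda>t. ?R 1 (sgn (\<tau>' t)))"
  proof (rule even_frame_homotopy[where a = 0 and b = 1 and ?e1.0 = "\<lambda>s t. ?R s (\<tau> t)" and ?e2.0 = "\<lambda>s t. ?R s (sgn (\<tau>' t))"])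
    show "even_frame (\<lambda>t. ?R 0 (\<tau> t)) (\<lambda>t. ?R 0 (sgn (\<tau>' t)))" using e R(5)[of 0] by simp
    fix s t :: real assume s: "s \<in> {0..1}"
    show "orthonormal2 (?R s (\<tau> t)) (?R s (sgn (\<tau>' t)))"
      using R(2,3)[OF s] d(2,3) sphere_loop_tangent[OF d(1) d(3), of t]
      by (simp add: orthonormal2_def norm_sgn) (simp add: sgn_div_norm)
  qed (use continuous_on_rotation[OF nm ct] continuous_on_rotation[OF nm cs] d(4) per in auto)
  moreover have "?R 1 (sgn x) = sgn (?R 1 x)" for x
    using R(3)[of 1 x] bounded_linear.linear[OF R(4)[of 1]] by (simp add: sgn_div_norm linear_cmul)
  ultimately show "even_frame (\<rho> \<circ> \<tau>) (\<lambda>t. sgn ((\<rho> \<circ> \<tau>') t))"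
    by (simp add: \<rho>_def o_def)
qed

text \<open>The cone over a differentiable curve is a differentiable image of the plane, hence a
  null set in three-space. This is how a differentiable spherical curve is seen to omit a
  direction.\<close>

lemma negligible_cone:
  fixes \<tau> :: "real \<Rightarrow> real^3"
  assumes "\<And>t. (\<tau> has_vector_derivative \<tau>' t) (at t)"
  shows "negligible (range (\<lambda>(r, t). r *\<^sub>R \<tau> t))"
proof (rule negligible_differentiable_image_lowdim)
  show "DIM(real \<times> real) < DIM(real^3)" by simp
  have d: "\<tau> differentiable at t" for t using assms by (rule differentiableI_vector)
  have "(\<lambda>p. \<tau> (snd p)) differentiable at p" for p :: "real \<times> real"
    using differentiable_chain_at[of snd p \<tau>] d
    by (simp add: o_def bounded_linear_imp_differentiable bounded_linear_snd)
  moreover have "fst differentiable at p" for p :: "real \<times> real"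
    by (simp add: bounded_linear_imp_differentiable bounded_linear_fst)
  ultimately show "(\<lambda>(r, t). r *\<^sub>R \<tau> t) differentiable_on UNIV"
    unfolding differentiable_on_def case_prod_unfold
    by (auto intro!: differentiable_scaleR)
qed

lemma sphere_loop_misses_point:
  fixes n :: "real^3"
  assumes \<tau>: "sphere_loop \<tau> \<tau>'"
  obtains m where "norm m = 1" "m \<noteq> - n" "m \<notin> range \<tau>"
proof -
  have d: "\<And>t. (\<tau> has_vector_derivative \<tau>' t) (at t)" using \<tau> by (simp add: sphere_loop_def)
  \<comment> \<open>The second set is the line through \<open>- n\<close>, the cone over a constant
    curve; avoiding it keeps \<open>m\<close> away from the one direction that
    \<open>rotation\<close> cannot carry to \<open>n\<close>.\<close>
  have "negligible (range (\<lambda>(r::real, t). r *\<^sub>R \<tau> t) \<union> range (\<lambda>(r::real, t::real). r *\<^sub>R (- n)))"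
    by (intro negligible_Un negligible_cone[OF d] negligible_cone[OF has_vector_derivative_const])
  then obtain x where x: "x \<notin> range (\<lambda>(r::real, t). r *\<^sub>R \<tau> t)" "x \<notin> range (\<lambda>(r::real, t::real). r *\<^sub>R (- n))"
    using non_negligible_UNIV by (metis UNIV_eq_I Un_iff)
  have x1: "x \<noteq> r *\<^sub>R \<tau> t" "x \<noteq> r *\<^sub>R (- n)" for r t
    using x by (auto simp: image_iff)
  have "x \<noteq> 0" using x1(2)[of 0] by simp
  then have eq: "x = norm x *\<^sub>R sgn x" by (simp add: sgn_div_norm)
  show ?thesis
  proof
    show "norm (sgn x) = 1" using \<open>x \<noteq> 0\<close> by (simp add: norm_sgn)
    show "sgn x \<noteq> - n" "sgn x \<notin> range \<tau>" using x1 eq by (metis, metis rangeE)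
  qed
qed

section \<open>Even multiples of the equator and the Viviani curve\<close>

text \<open>
  A circle traversed an even number \<open>2m\<close> of times is homotopic through immersions to the \<open>m\<close>-fold
  Viviani curve \<open>(cos\<^sup>2 s, cos s sin s, sin s)\<close>, \<open>s = m t\<close>: tilt the great circle
  \<open>(cos s, sin s, 0)\<close> while rotating it about the third axis at the same speed.
\<close>

definition tilt :: "int \<Rightarrow> real \<Rightarrow> real \<Rightarrow> real^3" where
  "tilt m s t = (let a = cos (of_int m * t); b = sin (of_int m * t); \<kappa> = cos (s * pi / 2); \<eta> = sin (s * pi / 2)
     in mk3 (Complex (a\<^sup>2 - b\<^sup>2 * \<kappa>) (a * b * (1 + \<kappa>))) (b * \<eta>))"

definition tilt' :: "int \<Rightarrow> real \<Rightarrow> real \<Rightarrow> real^3" where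
  "tilt' m s t = (let a = cos (of_int m * t); b = sin (of_int m * t); \<kappa> = cos (s * pi / 2); \<eta> = sin (s * pi / 2)
     in of_int m *\<^sub>R mk3 (Complex (- 2 * a * b * (1 + \<kappa>)) ((a\<^sup>2 - b\<^sup>2) * (1 + \<kappa>))) (a * \<eta>))"

lemma has_vector_derivative_Complex:
  "(f has_vector_derivative f') (at x within S) \<Longrightarrow> (g has_vector_derivative g') (at x within S) \<Longrightarrow>
   ((\<lambda>x. Complex (f x) (g x)) has_vector_derivative Complex f' g') (at x within S)"
  by (simp add: has_vector_derivative_complex_iff has_real_derivative_iff_has_vector_derivative)

lemma sin_cos_of_int_period:
  "sin (of_int m * (t + 2 * pi)) = sin (of_int m * t)" "cos (of_int m * (t + 2 * pi)) = cos (of_int m * t)"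
proof -
  have "cis (of_int m * (t + 2 * pi)) = cis (of_int m * t)"
    by (rule cis_add_period[of _ _ m]) (simp add: algebra_simps)
  then show "sin (of_int m * (t + 2 * pi)) = sin (of_int m * t)"
    "cos (of_int m * (t + 2 * pi)) = cos (of_int m * t)"
    by (simp_all add: complex_eq_iff)
qed

text \<open>The tilt stays between 0 and a right angle, so \<open>\<kappa> \<ge> 0\<close> and the
  factor \<open>1 + \<kappa>\<close> is positive. A vanishing velocity would then force
  \<open>a * b = 0\<close> and equal squares of \<open>a\<close> and \<open>b\<close>, against their
  sum being 1.\<close>

lemma tilt_homotopy:
  assumes m: "m \<noteq> 0"
  shows "reg_homotopy (sphere 0 1) (tilt m) (tilt' m)"
  unfolding reg_homotopy_def
proof (intro conjI ballI allI)
  let ?X = "{0..1::real} \<times> (UNIV :: real set)"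
  have c: "continuous_on ?X (\<lambda>x. cos (of_int m * snd x))" "continuous_on ?X (\<lambda>x. sin (of_int m * snd x))"
    "continuous_on ?X (\<lambda>x. cos (fst x * pi / 2))" "continuous_on ?X (\<lambda>x. sin (fst x * pi / 2))"
    by (auto intro!: continuous_intros)
  show "continuous_on ?X (\<lambda>(s, t). tilt m s t)"
    unfolding tilt_def Let_def case_prod_unfold
    by (intro continuous_on_mk3 continuous_on_Complex continuous_on_mult continuous_on_diff
        continuous_on_add continuous_on_power continuous_on_const c)
  show "continuous_on ?X (\<lambda>(s, t). tilt' m s t)"
    unfolding tilt'_def Let_def case_prod_unfold
    by (intro continuous_on_mk3 continuous_on_Complex continuous_on_mult continuous_on_diff
        continuous_on_scaleR continuous_on_add continuous_on_power continuous_on_const c)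
  fix s t :: real assume s: "s \<in> {0..1}"
  define a b \<kappa> \<eta> where d: "a = cos (of_int m * t)" "b = sin (of_int m * t)" "\<kappa> = cos (s * pi / 2)" "\<eta> = sin (s * pi / 2)"
  have ab: "a\<^sup>2 + b\<^sup>2 = 1" "\<kappa>\<^sup>2 + \<eta>\<^sup>2 = 1" by (simp_all add: d)
  have \<kappa>: "\<kappa> \<ge> 0" unfolding d using s pi_gt_zero
    by (intro cos_ge_zero) (auto simp: mult_le_cancel_right1 intro: order_trans[of _ 0])
  have t1: "tilt m s t = mk3 (Complex (a\<^sup>2 - b\<^sup>2 * \<kappa>) (a * b * (1 + \<kappa>))) (b * \<eta>)"
    "tilt' m s t = of_int m *\<^sub>R mk3 (Complex (- 2 * a * b * (1 + \<kappa>)) ((a\<^sup>2 - b\<^sup>2) * (1 + \<kappa>))) (a * \<eta>)"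
    by (simp_all add: tilt_def tilt'_def Let_def d)
  show "tilt' m s t \<noteq> 0"
  proof
    assume "tilt' m s t = 0"
    then have z: "mk3 (Complex (- 2 * a * b * (1 + \<kappa>)) ((a\<^sup>2 - b\<^sup>2) * (1 + \<kappa>))) (a * \<eta>) = 0"
      using m by (simp add: t1)
    have "- 2 * a * b * (1 + \<kappa>) = 0" "(a\<^sup>2 - b\<^sup>2) * (1 + \<kappa>) = 0"
      using arg_cong[OF z, of "\<lambda>x. x $ 1"] arg_cong[OF z, of "\<lambda>x. x $ 2"] by simp_all
    then have "a = 0 \<or> b = 0" "a\<^sup>2 = b\<^sup>2" using \<kappa> by auto
    then show False using ab by auto
  qed
  have "(norm (tilt m s t))\<^sup>2 = (a\<^sup>2 - b\<^sup>2 * \<kappa>)\<^sup>2 + (a * b * (1 + \<kappa>))\<^sup>2 + (b * \<eta>)\<^sup>2"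
    by (simp add: norm_real3 t1)
  also have "\<dots> = (a\<^sup>2 + b\<^sup>2 * \<kappa>\<^sup>2) * (a\<^sup>2 + b\<^sup>2) + b\<^sup>2 * \<eta>\<^sup>2"
    by (simp add: power2_eq_square algebra_simps)
  also have "\<dots> = a\<^sup>2 + b\<^sup>2 * (\<kappa>\<^sup>2 + \<eta>\<^sup>2)" unfolding ab(1) by (simp add: algebra_simps)
  also have "\<dots> = 1\<^sup>2" by (simp add: ab)
  finally have "norm (tilt m s t) = 1" by (rule power2_eq_imp_eq) auto
  then show "tilt m s t \<in> sphere 0 1" by simp
  show "tilt m s (t + 2 * pi) = tilt m s t"
    unfolding tilt_def sin_cos_of_int_period ..
  have "((\<lambda>t. mk3 (Complex ((cos (of_int m * t))\<^sup>2 - (sin (of_int m * t))\<^sup>2 * \<kappa>)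
      (cos (of_int m * t) * sin (of_int m * t) * (1 + \<kappa>))) (sin (of_int m * t) * \<eta>))
    has_vector_derivative mk3 (Complex (of_int m * (- 2 * a * b * (1 + \<kappa>))) (of_int m * ((a\<^sup>2 - b\<^sup>2) * (1 + \<kappa>)))) (of_int m * (a * \<eta>))) (at t)"
    unfolding d(1,2)
    by (intro has_vector_derivative_mk3 has_vector_derivative_Complex;
        unfold has_real_derivative_iff_has_vector_derivative[symmetric];
        auto intro!: derivative_eq_intros simp: power2_eq_square algebra_simps)
  moreover have "mk3 (Complex (of_int m * (- 2 * a * b * (1 + \<kappa>))) (of_int m * ((a\<^sup>2 - b\<^sup>2) * (1 + \<kappa>)))) (of_int m * (a * \<eta>)) = tilt' m s t"
    unfolding t1 by (simp add: vec_eq_iff forall_3)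
  ultimately show "(tilt m s has_vector_derivative tilt' m s t) (at t)"
    unfolding tilt_def[abs_def] Let_def d(3,4) by simp
qed

text \<open>Without tilt the motion along the great circle and the rotation about the third axis add
  up, so the equator is run at speed \<open>2 * m\<close>. This is why the construction reaches even
  turning numbers.\<close>

lemma tilt_0: "tilt m 0 = sphere_point \<circ> (\<lambda>t. cis (of_int (2 * m) * t))"
proof
  fix t
  have c: "cis (of_int (2 * m) * t) = Complex ((cos (of_int m * t))\<^sup>2 - (sin (of_int m * t))\<^sup>2)
      (cos (of_int m * t) * sin (of_int m * t) * 2)"
    using cos_double[of "of_int m * t"] sin_double[of "of_int m * t"] by (simp add: complex_eq_iff algebra_simps)
  have "den (cis (of_int (2 * m) * t)) = 2" by (simp add: den_cmod)
  then show "tilt m 0 t = (sphere_point \<circ> (\<lambda>t. cis (of_int (2 * m) * t))) t"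
    unfolding tilt_def sphere_point_def Let_def o_def c by simp
qed

lemma tilt_1: "tilt m 1 t = mk3 (Complex ((cos (of_int m * t))\<^sup>2) (cos (of_int m * t) * sin (of_int m * t))) (sin (of_int m * t))"
  by (simp add: tilt_def Let_def)

lemma reg_homotopy_sphere_loop:
  "reg_homotopy (sphere 0 1) h h' \<Longrightarrow> s \<in> {0..1} \<Longrightarrow> sphere_loop (h s) (h' s)"
  unfolding reg_homotopy_def sphere_loop_def using continuous_on_slice by fastforce

text \<open>A quarter turn that brings the point \<open>- axis 1 1\<close> to the north pole. The
  Viviani curve has nonnegative first coordinate, so it stays away from this new centre of
  projection.\<close>

lemma rotation_Viviani:
  fixes x :: "real^3"
  shows "rotation (axis 3 1) (- axis 1 1) 1 x = mk3 (Complex (x $ 3) (x $ 2)) (- x $ 1)"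
  by (simp add: rotation_def half_turn_def inner_real3 vec_eq_iff forall_3 axis_def field_simps)

text \<open>The projected curve is the lemniscate of Bernoulli, run \<open>|m|\<close> times. Its
  velocity is \<open>- \<i> * m * \<omega>\<close>, simplified with the relation \<open>ab\<close>.
  If \<open>\<omega>\<close> is real, then \<open>a = 0\<close> and \<open>b^2 = 1\<close>, so its
  real part is positive: the velocity direction omits a value.\<close>

lemma turning_number_Viviani:
  assumes "m \<noteq> 0"
  shows "turning_number (\<lambda>t. stereo 1 (rotation (axis 3 1) (- axis 1 1) 1 (tilt m 1 t))) 0"
proof -
  define a b where "a t = cos (of_int m * t)" and "b t = sin (of_int m * t)" for t :: real
  have ab: "(a t)\<^sup>2 + (b t)\<^sup>2 = 1" for t by (simp add: a_def b_def)
  define D where "D t = 1 + (a t)\<^sup>2" for t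
  have D: "D t > 0" for t by (simp add: D_def add_pos_nonneg)
  define \<omega> where "\<omega> t = Complex ((b t)\<^sup>2 - 2 * (a t)\<^sup>2) (a t * (2 + (b t)\<^sup>2)) / of_real ((D t)\<^sup>2)" for t
  have eq: "(\<lambda>t. stereo 1 (rotation (axis 3 1) (- axis 1 1) 1 (tilt m 1 t))) =
      (\<lambda>t. Complex (b t / D t) (a t * b t / D t))"
    by (simp add: rotation_Viviani tilt_1 stereo_def a_def b_def D_def)
  have da: "(a has_real_derivative - of_int m * b t) (at t)" "(b has_real_derivative of_int m * a t) (at t)" for t
    unfolding a_def[abs_def] b_def[abs_def] by (auto intro!: derivative_eq_intros)
  have dD: "(D has_real_derivative - 2 * of_int m * a t * b t) (at t)" for t
    unfolding D_def[abs_def] by (auto intro!: derivative_eq_intros da simp: power2_eq_square)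
  have D0: "D t \<noteq> 0" for t using D[of t] by simp
  have n1: "of_int m * a t * D t - b t * (- 2 * of_int m * a t * b t) = of_int m * (a t * (2 + (b t)\<^sup>2))" for t
  proof -
    have "a t * D t + 2 * a t * (b t)\<^sup>2 = a t * (1 + ((a t)\<^sup>2 + (b t)\<^sup>2) + (b t)\<^sup>2)"
      by (simp add: D_def power2_eq_square algebra_simps)
    then have "of_int m * (a t * D t + 2 * a t * (b t)\<^sup>2) = of_int m * (a t * (1 + 1 + (b t)\<^sup>2))"
      unfolding ab by simp
    then show ?thesis by (simp add: power2_eq_square algebra_simps)
  qed
  have n2: "(- of_int m * b t * b t + of_int m * a t * a t) * D t - a t * b t * (- 2 * of_int m * a t * b t)
      = of_int m * (2 * (a t)\<^sup>2 - (b t)\<^sup>2)" for t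
  proof -
    have "((a t)\<^sup>2 - (b t)\<^sup>2) * D t + 2 * (a t)\<^sup>2 * (b t)\<^sup>2 = (a t)\<^sup>2 - (b t)\<^sup>2 + (a t)\<^sup>2 * ((a t)\<^sup>2 + (b t)\<^sup>2)"
      by (simp add: D_def power2_eq_square algebra_simps)
    then have "of_int m * (((a t)\<^sup>2 - (b t)\<^sup>2) * D t + 2 * (a t)\<^sup>2 * (b t)\<^sup>2) =
        of_int m * ((a t)\<^sup>2 - (b t)\<^sup>2 + (a t)\<^sup>2 * 1)"
      unfolding ab by simp
    then show ?thesis by (simp add: power2_eq_square algebra_simps)
  qed
  have d1: "((\<lambda>t. b t / D t) has_vector_derivative of_int m * (a t * (2 + (b t)\<^sup>2)) / (D t)\<^sup>2) (at t)" for t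
    unfolding has_real_derivative_iff_has_vector_derivative[symmetric]
    by (rule DERIV_cong[OF DERIV_divide[OF da(2) dD D0]]) (simp only: n1 power2_eq_square)
  have d2: "((\<lambda>t. a t * b t / D t) has_vector_derivative of_int m * (2 * (a t)\<^sup>2 - (b t)\<^sup>2) / (D t)\<^sup>2) (at t)" for t
  proof -
    have "((\<lambda>t. a t * b t) has_real_derivative (- of_int m * b t * b t + of_int m * a t * a t)) (at t)"
      by (rule DERIV_cong[OF DERIV_mult[OF da]]) (simp add: algebra_simps)
    from DERIV_divide[OF this dD D0] show ?thesis
      unfolding has_real_derivative_iff_has_vector_derivative[symmetric]
      by (rule DERIV_cong) (simp only: n2 power2_eq_square)
  qed
  have vel: "Complex (of_int m * (a t * (2 + (b t)\<^sup>2)) / (D t)\<^sup>2) (of_int m * (2 * (a t)\<^sup>2 - (b t)\<^sup>2) / (D t)\<^sup>2)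
      = (- \<i> * of_int m) * \<omega> t" for t
    by (simp add: complex_eq_iff \<omega>_def Re_divide_of_real Im_divide_of_real algebra_simps add_divide_distrib diff_divide_distrib)
  show ?thesis unfolding eq
  proof (rule turning_number_slit[where w = \<omega>])
    show "((\<lambda>t. Complex (b t / D t) (a t * b t / D t)) has_vector_derivative (- \<i> * of_int m) * \<omega> t) (at t)" for t
      unfolding vel[symmetric] by (rule has_vector_derivative_Complex[OF d1 d2])
    show "Complex (b (t + 2 * pi) / D (t + 2 * pi)) (a (t + 2 * pi) * b (t + 2 * pi) / D (t + 2 * pi)) =
      Complex (b t / D t) (a t * b t / D t)" for t
      unfolding D_def a_def b_def sin_cos_of_int_period ..
    show "continuous_on UNIV \<omega>"
    proof -
      have ab: "continuous_on UNIV a" "continuous_on UNIV b"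
        unfolding a_def[abs_def] b_def[abs_def] by (intro continuous_intros)+
      moreover have "continuous_on UNIV D" unfolding D_def[abs_def] by (intro continuous_intros ab)
      moreover have "complex_of_real ((D t)\<^sup>2) \<noteq> 0" for t using D0[of t] by simp
      ultimately show ?thesis
        unfolding \<omega>_def[abs_def]
        by (intro continuous_on_divide continuous_on_Complex continuous_intros) blast+
    qed
    show "\<omega> t \<notin> \<real>\<^sub>\<le>\<^sub>0" for t
    proof
      assume "\<omega> t \<in> \<real>\<^sub>\<le>\<^sub>0"
      then have Re: "((b t)\<^sup>2 - 2 * (a t)\<^sup>2) / (D t)\<^sup>2 \<le> 0" and Im: "a t * (2 + (b t)\<^sup>2) / (D t)\<^sup>2 = 0"
        unfolding complex_nonpos_Reals_iff \<omega>_def Re_divide_of_real Im_divide_of_real by simp_all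
      have "2 + (b t)\<^sup>2 \<noteq> 0" by (smt (verit) zero_le_power2)
      then have "a t = 0" using Im D0[of t] by simp
      then have "(b t)\<^sup>2 = 1" using ab[of t] by simp
      then show False using Re \<open>a t = 0\<close> by (simp add: D_def)
    qed
    show "- \<i> * of_int m \<noteq> (0::complex)" using assms by simp
  qed
qed

lemma sphere_point_homotopic:
  "reg_homotopic UNIV z w \<Longrightarrow> reg_homotopic (sphere 0 1) (sphere_point \<circ> z) (sphere_point \<circ> w)"
  by (rule reg_homotopic_map[OF _ sphere_point_has_derivative continuous_on_sphere_velocity sphere_velocity_nonzero])
    (auto simp: norm_sphere_point)

lemma stereo_sphere_loop:
  assumes \<tau>: "sphere_loop \<tau> \<tau>'" and n: "\<And>t. \<tau> t $ 3 \<noteq> 1"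
  obtains z' where "\<And>t. ((stereo 1 \<circ> \<tau>) has_vector_derivative z' t) (at t)" "continuous_on UNIV z'"
    "\<And>t. z' t \<noteq> 0" "\<And>t. \<tau>' t = sphere_velocity (stereo 1 (\<tau> t)) (z' t)"
    "\<And>t. stereo 1 (\<tau> (t + 2 * pi)) = stereo 1 (\<tau> t)"
proof -
  have c': "continuous_on UNIV \<tau>'" and d: "(\<tau> has_vector_derivative \<tau>' t) (at t)" and ne: "\<tau>' t \<noteq> 0"
    and n1: "norm (\<tau> t) = 1" and per: "\<tau> (t + 2 * pi) = \<tau> t" for t
    using \<tau> by (auto simp: sphere_loop_def)
  have c: "continuous_on UNIV \<tau>" using sphere_loop_continuous[OF \<tau>] .
  have dn: "((\<lambda>t. \<tau> t $ i) has_real_derivative \<tau>' t $ i) (at t)" for t i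
    using bounded_linear.has_vector_derivative[OF bounded_linear_vec_nth d]
    by (simp add: has_real_derivative_iff_has_vector_derivative)
  have D0: "1 - \<tau> t $ 3 \<noteq> 0" for t using n[of t] by simp
  define p where "p i t = (\<tau>' t $ i * (1 - \<tau> t $ 3) - \<tau> t $ i * (0 - \<tau>' t $ 3)) / ((1 - \<tau> t $ 3) * (1 - \<tau> t $ 3))" for i t
  have dp: "((\<lambda>t. \<tau> t $ i / (1 - \<tau> t $ 3)) has_vector_derivative p i t) (at t)" for i t
    unfolding has_real_derivative_iff_has_vector_derivative[symmetric] p_def
    by (rule DERIV_divide[OF dn DERIV_diff[OF DERIV_const dn] D0])
  define z' where "z' t = Complex (p 1 t) (p 2 t)" for t
  have zd: "((stereo 1 \<circ> \<tau>) has_vector_derivative z' t) (at t)" for t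
    using has_vector_derivative_Complex[OF dp dp] by (simp add: stereo_def o_def z'_def)
  \<comment> \<open>Since \<open>sphere_point\<close> inverts the projection, the chain rule
    exhibits \<open>\<tau>'\<close> as the image of \<open>z'\<close>; so \<open>z'\<close> cannot
    vanish, and its quotient formula serves only for continuity.\<close>
  have S: "sphere_point \<circ> (stereo 1 \<circ> \<tau>) = \<tau>"
    using sphere_point_stereo[OF n1 n] by auto
  have "((sphere_point \<circ> (stereo 1 \<circ> \<tau>)) has_vector_derivative sphere_velocity (stereo 1 (\<tau> t)) (z' t)) (at t)" for t
  proof -
    have "linear (sphere_velocity (stereo 1 (\<tau> t)))"
      by (rule has_derivative_linear[OF sphere_point_has_derivative])
    then show ?thesis
      using has_derivative_compose[OF zd[of t, unfolded has_vector_derivative_def] sphere_point_has_derivative]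
      by (simp add: has_vector_derivative_def o_def linear_cmul)
  qed
  then have vel: "\<tau>' t = sphere_velocity (stereo 1 (\<tau> t)) (z' t)" for t
    unfolding S using d vector_derivative_unique_at by blast
  have "z' t \<noteq> 0" for t
  proof
    assume "z' t = 0"
    then have "\<tau>' t = 0" using vel[of t] by (simp add: sphere_velocity_def vec_eq_iff forall_3 dot2_def)
    then show False using ne by simp
  qed
  moreover have "continuous_on UNIV z'"
    unfolding z'_def[abs_def] p_def using D0
    by (intro continuous_intros continuous_on_Complex continuous_on_component c c') auto
  ultimately show ?thesis using that[of z'] zd vel per by auto
qed

theorem even_sphere_loop_homotopic:
  assumes \<tau>: "sphere_loop \<tau> \<tau>'" and e: "even_frame \<tau> (\<lambda>t. sgn (\<tau>' t))"
  shows "reg_homotopic (sphere 0 1) \<tau> (sphere_point \<circ> standard_figure_eight)"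
proof -
  let ?n = "axis 3 1 :: real^3"
  have n: "norm ?n = 1" by (simp add: norm_axis_1)
  obtain m where m: "norm m = 1" "m \<noteq> - ?n" "m \<notin> range \<tau>" using sphere_loop_misses_point[OF \<tau>] by metis
  define \<rho> where "\<rho> = rotation ?n m 1"
  note rot = rotate_sphere_loop[OF n m(1,2) \<tau>, folded \<rho>_def]
  have miss: "(\<rho> \<circ> \<tau>) t $ 3 \<noteq> 1" for t
  proof
    assume 1: "(\<rho> \<circ> \<tau>) t $ 3 = 1"
    have "norm (\<rho> (\<tau> t)) = 1" using rot(1) by (simp add: sphere_loop_def)
    then have "((\<rho> (\<tau> t)) $ 1)\<^sup>2 + ((\<rho> (\<tau> t)) $ 2)\<^sup>2 = 0" using norm1_nth3(1) 1 by simp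
    then have "\<rho> (\<tau> t) = ?n" using 1 by (simp add: vec_eq_iff forall_3 axis_def sum_power2_eq_zero_iff)
    also have "\<dots> = \<rho> m" using rotation_family(6)[OF n m(1,2), of 1] by (simp add: \<rho>_def)
    finally have "\<rho> (\<tau> t - m) = 0"
      using rotation_family(4)[OF n m(1,2), of 1] by (simp add: \<rho>_def linear_diff bounded_linear.linear)
    then have "norm (\<tau> t - m) = 0"
      using rotation_family(3)[OF n m(1,2), of 1 "\<tau> t - m"] by (simp add: \<rho>_def)
    then show False using m(3) by auto
  qed
  obtain z' where z: "\<And>t. ((stereo 1 \<circ> (\<rho> \<circ> \<tau>)) has_vector_derivative z' t) (at t)" "continuous_on UNIV z'"
    "\<And>t. z' t \<noteq> 0" "\<And>t. (\<rho> \<circ> \<tau>') t = sphere_velocity (stereo 1 ((\<rho> \<circ> \<tau>) t)) (z' t)"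
    "\<And>t. stereo 1 ((\<rho> \<circ> \<tau>) (t + 2 * pi)) = stereo 1 ((\<rho> \<circ> \<tau>) t)"
    using stereo_sphere_loop[OF rot(1) miss] by blast
  define w where "w = stereo 1 \<circ> (\<rho> \<circ> \<tau>)"
  have Sw: "sphere_point \<circ> w = \<rho> \<circ> \<tau>"
  proof
    fix t
    have "norm ((\<rho> \<circ> \<tau>) t) = 1" using rot(1) by (simp add: sphere_loop_def)
    from sphere_point_stereo[OF this miss] show "(sphere_point \<circ> w) t = (\<rho> \<circ> \<tau>) t"
      by (simp add: w_def)
  qed
  obtain k where k: "turning_number w k"
    using turning_number_exists[OF z(1,2,3)] z(5) unfolding w_def by auto
  then obtain r \<theta> where p: "polar_loop w r \<theta> k" by (auto simp: turning_number_def)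
  have "z' t = of_real (r t) * cis (\<theta> t)" for t
    using p z(1)[of t] vector_derivative_unique_at unfolding polar_loop_def w_def by blast
  then have "(\<lambda>t. sgn ((\<rho> \<circ> \<tau>') t)) = (\<lambda>t. sgn (sphere_velocity (w t) (of_real (r t) * cis (\<theta> t))))"
    unfolding z(4) by (simp add: w_def)
  moreover have "\<rho> \<circ> \<tau> = (\<lambda>t. sphere_point (w t))" using Sw by (simp add: o_def)
  ultimately have "even k" using even_turning_number[OF p] rot(3)[OF e] by simp
  have "reg_homotopic (sphere 0 1) (sphere_point \<circ> w) (sphere_point \<circ> standard_figure_eight)"
  proof (cases "k = 0")
    case True
    then show ?thesis using k turning_number_figure_eight
      by (intro sphere_point_homotopic Whitney_Graustein) auto
  next
    case False
    obtain j where j: "k = 2 * j" using \<open>even k\<close> by blast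
    with False have j0: "j \<noteq> 0" by simp
    have h1: "reg_homotopic (sphere 0 1) (sphere_point \<circ> w) (tilt j 0)"
      unfolding tilt_0 using k turning_number_cis[OF False] unfolding j
      by (intro sphere_point_homotopic Whitney_Graustein) auto
    have h2: "reg_homotopic (sphere 0 1) (tilt j 0) (tilt j 1)"
      using tilt_homotopy[OF j0] unfolding reg_homotopic_def by blast
    let ?R = "rotation ?n (- axis 1 1) 1"
    have m1: "norm (- axis 1 1 :: real^3) = 1" by (simp add: norm_axis_1)
    have "(- axis 1 1 :: real^3) $ 3 \<noteq> (- ?n) $ 3" by (simp add: axis_def)
    then have m2: "(- axis 1 1 :: real^3) \<noteq> - ?n" by metis
    have V: "sphere_loop (tilt j 1) (tilt' j 1)"
      by (rule reg_homotopy_sphere_loop[OF tilt_homotopy[OF j0]]) simp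
    have h3: "reg_homotopic (sphere 0 1) (tilt j 1) (?R \<circ> tilt j 1)"
      by (rule rotate_sphere_loop(2)[OF n m1 m2 V])
    have "sphere_loop (?R \<circ> tilt j 1) (?R \<circ> tilt' j 1)"
      by (rule rotate_sphere_loop(1)[OF n m1 m2 V])
    then have "norm (?R (tilt j 1 t)) = 1" for t by (simp add: sphere_loop_def)
    moreover have "?R (tilt j 1 t) $ 3 \<noteq> 1" for t
    proof -
      have "?R (tilt j 1 t) $ 3 = - (cos (of_int j * t))\<^sup>2" by (simp add: rotation_Viviani tilt_1)
      also have "\<dots> \<noteq> 1" by (smt (verit) zero_le_power2)
      finally show ?thesis .
    qed
    ultimately have eq: "?R \<circ> tilt j 1 = sphere_point \<circ> (\<lambda>t. stereo 1 (?R (tilt j 1 t)))"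
      by (auto simp: sphere_point_stereo)
    have h4: "reg_homotopic (sphere 0 1) (?R \<circ> tilt j 1) (sphere_point \<circ> standard_figure_eight)"
      unfolding eq using turning_number_Viviani[OF j0] turning_number_figure_eight
      by (intro sphere_point_homotopic Whitney_Graustein) auto
    show ?thesis using h1 h2 h3 h4 by (meson reg_homotopic_trans)
  qed
  from reg_homotopic_trans[OF rot(2) this[unfolded Sw]] show ?thesis .
qed

section \<open>Spherical loops in space read in the stereographic charts\<close>

lemma Ck_on_1I:
  assumes "\<And>t. t \<in> S \<Longrightarrow> (g has_vector_derivative d t) (at t)" "continuous_on S d"
  shows "Ck_on 1 g S"
proof -
  have "frechet_derivative g (at t) = (\<lambda>v. v *\<^sub>R d t)" if "t \<in> S" for t
    using frechet_derivative_at[OF assms(1)[OF that, unfolded has_vector_derivative_def]] by simp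
  then have "continuous_on S (\<lambda>x. frechet_derivative g (at x) v)" for v
    using continuous_on_cong[of S S "\<lambda>x. v *\<^sub>R d x" "\<lambda>x. frechet_derivative g (at x) v"] assms(2)
    by (auto intro!: continuous_intros)
  then show ?thesis
    using assms(1) by (auto simp: One_nat_def intro: differentiableI_vector)
qed

lemma stereo_has_vector_derivative:
  assumes d: "(\<tau> has_vector_derivative v) (at t)" and n: "1 - \<epsilon> * \<tau> t $ 3 \<noteq> 0"
  shows "((stereo \<epsilon> \<circ> \<tau>) has_vector_derivative
     Complex ((v $ 1 * (1 - \<epsilon> * \<tau> t $ 3) + \<tau> t $ 1 * (\<epsilon> * v $ 3)) / (1 - \<epsilon> * \<tau> t $ 3)\<^sup>2)
       ((v $ 2 * (1 - \<epsilon> * \<tau> t $ 3) + \<tau> t $ 2 * (\<epsilon> * v $ 3)) / (1 - \<epsilon> * \<tau> t $ 3)\<^sup>2)) (at t)"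
proof -
  have dn: "((\<lambda>t. \<tau> t $ i) has_real_derivative v $ i) (at t)" for i
    using bounded_linear.has_vector_derivative[OF bounded_linear_vec_nth d]
    by (simp add: has_real_derivative_iff_has_vector_derivative)
  have "((\<lambda>t. \<tau> t $ i / (1 - \<epsilon> * \<tau> t $ 3)) has_vector_derivative
     (v $ i * (1 - \<epsilon> * \<tau> t $ 3) + \<tau> t $ i * (\<epsilon> * v $ 3)) / (1 - \<epsilon> * \<tau> t $ 3)\<^sup>2) (at t)" for i
    unfolding has_real_derivative_iff_has_vector_derivative[symmetric]
    by (rule DERIV_cong[OF DERIV_divide[OF dn DERIV_diff[OF DERIV_const DERIV_cmult[OF dn]] n]])
      (simp add: power2_eq_square)
  from has_vector_derivative_Complex[OF this this] show ?thesis by (simp add: stereo_def o_def)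
qed

text \<open>If both numerators vanish, pairing them with the horizontal part of \<open>x\<close>
  eliminates \<open>v $ 1\<close> and \<open>v $ 2\<close> by tangency and leaves
  \<open>D * v $ 3 * \<epsilon> = 0\<close>. So the height component vanishes, and then the other
  two.\<close>

lemma stereo_velocity_nonzero:
  assumes x: "norm (x::real^3) = 1" "x \<bullet> v = 0" "v \<noteq> 0" and \<epsilon>: "\<epsilon> = 1 \<or> \<epsilon> = - 1" "x $ 3 \<noteq> \<epsilon>"
  shows "Complex ((v $ 1 * (1 - \<epsilon> * x $ 3) + x $ 1 * (\<epsilon> * v $ 3)) / (1 - \<epsilon> * x $ 3)\<^sup>2)
       ((v $ 2 * (1 - \<epsilon> * x $ 3) + x $ 2 * (\<epsilon> * v $ 3)) / (1 - \<epsilon> * x $ 3)\<^sup>2) \<noteq> 0"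
proof
  define D where "D = 1 - \<epsilon> * x $ 3"
  assume "Complex ((v $ 1 * (1 - \<epsilon> * x $ 3) + x $ 1 * (\<epsilon> * v $ 3)) / (1 - \<epsilon> * x $ 3)\<^sup>2)
       ((v $ 2 * (1 - \<epsilon> * x $ 3) + x $ 2 * (\<epsilon> * v $ 3)) / (1 - \<epsilon> * x $ 3)\<^sup>2) = 0"
  moreover have D: "D \<noteq> 0" using \<epsilon> by (auto simp: D_def)
  ultimately have 0: "v $ 1 * D + x $ 1 * (\<epsilon> * v $ 3) = 0" "v $ 2 * D + x $ 2 * (\<epsilon> * v $ 3) = 0"
    by (simp_all add: complex_eq_iff D_def)
  have e2: "\<epsilon> * \<epsilon> = 1" using \<epsilon> by auto
  have n: "(x$1)\<^sup>2 + (x$2)\<^sup>2 = 1 - (x$3)\<^sup>2" using norm1_nth3(1)[OF x(1)] .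
  have i: "x$1 * v$1 + x$2 * v$2 = - x$3 * v$3" using x(2) by (simp add: inner_real3)
  have "0 = x$1 * (v $ 1 * D + x $ 1 * (\<epsilon> * v $ 3)) + x$2 * (v $ 2 * D + x $ 2 * (\<epsilon> * v $ 3))"
    unfolding 0 by simp
  also have "\<dots> = (x$1 * v$1 + x$2 * v$2) * D + ((x$1)\<^sup>2 + (x$2)\<^sup>2) * \<epsilon> * v$3"
    by (simp add: power2_eq_square algebra_simps)
  also have "\<dots> = - x$3 * v$3 * D + (1 - (\<epsilon> * \<epsilon>) * (x$3)\<^sup>2) * \<epsilon> * v$3" unfolding i n e2 by simp
  also have "\<dots> = - x$3 * v$3 * D + (D * (1 + \<epsilon> * x$3)) * \<epsilon> * v$3"
    by (simp add: D_def power2_eq_square algebra_simps)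
  also have "\<dots> = D * v$3 * ((\<epsilon> * \<epsilon>) * x$3 - x$3 + \<epsilon>)" by (simp add: algebra_simps)
  also have "\<dots> = D * v$3 * \<epsilon>" unfolding e2 by simp
  finally have "v$3 = 0" using D \<epsilon> by auto
  then have "v$1 = 0" "v$2 = 0" using 0 D by auto
  then show False using \<open>v$3 = 0\<close> x(3) by (simp add: vec_eq_iff forall_3)
qed

lemma S2_atlas_eq: "S2_atlas = (\<lambda>\<epsilon>. ({x \<in> sphere 0 1. x $ 3 \<noteq> \<epsilon>}, stereo \<epsilon>)) ` {1, -1}"
  by (simp add: S2_atlas_def stereographic_chart_def stereo_def[abs_def])

lemma ball_S2_atlas:
  "(\<forall>(U, \<phi>)\<in>S2_atlas. P U \<phi>) \<longleftrightarrow> (\<forall>\<epsilon>\<in>{1, -1}. P {x \<in> sphere 0 1. x $ 3 \<noteq> \<epsilon>} (stereo \<epsilon>))"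
  by (auto simp: S2_atlas_eq)

lemma sphere_loop_immersed:
  assumes \<tau>: "sphere_loop \<tau> \<tau>'"
  shows "immersed_loop 1 S2 S2_atlas \<tau>"
proof -
  have c': "continuous_on UNIV \<tau>'" and d: "(\<tau> has_vector_derivative \<tau>' t) (at t)" and ne: "\<tau>' t \<noteq> 0"
    and n1: "norm (\<tau> t) = 1" and per: "\<tau> (t + 2 * pi) = \<tau> t" for t
    using \<tau> by (auto simp: sphere_loop_def)
  have c: "continuous_on UNIV \<tau>" using sphere_loop_continuous[OF \<tau>] .
  have "Ck_on 1 (stereo \<epsilon> \<circ> \<tau>) {t. \<tau> t \<in> {x \<in> sphere 0 1. x $ 3 \<noteq> \<epsilon>}} \<and>
     (\<forall>t. \<tau> t \<in> {x \<in> sphere 0 1. x $ 3 \<noteq> \<epsilon>} \<longrightarrow> vector_derivative (stereo \<epsilon> \<circ> \<tau>) (at t) \<noteq> 0)"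
    if \<epsilon>: "\<epsilon> \<in> {1, -1}" for \<epsilon>
  proof -
    let ?S = "{t. \<tau> t \<in> {x \<in> sphere 0 1. x $ 3 \<noteq> \<epsilon>}}"
    have D: "1 - \<epsilon> * \<tau> t $ 3 \<noteq> 0" if "t \<in> ?S" for t using that \<epsilon> by auto
    let ?d = "\<lambda>t. Complex ((\<tau>' t $ 1 * (1 - \<epsilon> * \<tau> t $ 3) + \<tau> t $ 1 * (\<epsilon> * \<tau>' t $ 3)) / (1 - \<epsilon> * \<tau> t $ 3)\<^sup>2)
       ((\<tau>' t $ 2 * (1 - \<epsilon> * \<tau> t $ 3) + \<tau> t $ 2 * (\<epsilon> * \<tau>' t $ 3)) / (1 - \<epsilon> * \<tau> t $ 3)\<^sup>2)"
    note vd = stereo_has_vector_derivative[OF d D]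
    have "continuous_on ?S ?d"
      using D continuous_on_subset[OF c subset_UNIV] continuous_on_subset[OF c' subset_UNIV]
      by (intro continuous_on_Complex continuous_intros) auto
    with vd have "Ck_on 1 (stereo \<epsilon> \<circ> \<tau>) ?S" by (rule Ck_on_1I)
    moreover have "vector_derivative (stereo \<epsilon> \<circ> \<tau>) (at t) \<noteq> 0" if "t \<in> ?S" for t
      unfolding vector_derivative_at[OF vd[OF that]]
      using n1[of t] sphere_loop_tangent[OF d n1] ne \<epsilon> that by (intro stereo_velocity_nonzero) auto
    ultimately show ?thesis by blast
  qed
  moreover have "is_loop S2 \<tau>"
    using c n1 per by (auto simp: is_loop_def continuous_map_in_subtopology)
  ultimately show ?thesis unfolding immersed_loop_def ball_S2_atlas by blast
qed

lemma reg_homotopic_sphere: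
  assumes "reg_homotopic (sphere 0 1) \<tau> \<beta>"
  shows "regularly_homotopic S2 S2_atlas \<tau> \<beta>"
proof -
  obtain h h' where h: "reg_homotopy (sphere 0 1) h h'" "h 0 = \<tau>" "h 1 = \<beta>"
    using assms unfolding reg_homotopic_def by blast
  have c: "continuous_on ({0..1} \<times> UNIV) (\<lambda>(s, t). h s t)" "continuous_on ({0..1} \<times> UNIV) (\<lambda>(s, t). h' s t)"
    and d: "\<And>s t. s \<in> {0..1} \<Longrightarrow> (h s has_vector_derivative h' s t) (at t)"
    and hS: "\<And>s t. s \<in> {0..1} \<Longrightarrow> h s t \<in> sphere 0 1"
    using h(1) by (auto simp: reg_homotopy_def)
  have "continuous_on {(s, t). s \<in> {0..1} \<and> h s t \<in> {x \<in> sphere 0 1. x $ 3 \<noteq> \<epsilon>}}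
      (\<lambda>(s, t). vector_derivative (stereo \<epsilon> \<circ> h s) (at t))" if \<epsilon>: "\<epsilon> \<in> {1, -1}" for \<epsilon>
  proof -
    let ?S = "{(s, t). s \<in> {0..1} \<and> h s t \<in> {x \<in> sphere 0 1. x $ 3 \<noteq> \<epsilon>}}"
    let ?d = "\<lambda>x v::real^3. Complex ((v $ 1 * (1 - \<epsilon> * x $ 3) + x $ 1 * (\<epsilon> * v $ 3)) / (1 - \<epsilon> * x $ 3)\<^sup>2)
       ((v $ 2 * (1 - \<epsilon> * x $ 3) + x $ 2 * (\<epsilon> * v $ 3)) / (1 - \<epsilon> * x $ 3)\<^sup>2)"
    have D: "1 - \<epsilon> * h (fst p) (snd p) $ 3 \<noteq> 0" if "p \<in> ?S" for p using that \<epsilon> by auto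
    have "continuous_on ?S (\<lambda>p. h (fst p) (snd p))" "continuous_on ?S (\<lambda>p. h' (fst p) (snd p))"
      by (rule continuous_on_curried[OF c(1)] continuous_on_curried[OF c(2)];
          auto intro!: continuous_intros)+
    then have "continuous_on ?S (\<lambda>p. ?d (h (fst p) (snd p)) (h' (fst p) (snd p)))"
      using D by (intro continuous_on_Complex continuous_intros) auto
    moreover have "(case p of (s, t) \<Rightarrow> vector_derivative (stereo \<epsilon> \<circ> h s) (at t)) = ?d (h (fst p) (snd p)) (h' (fst p) (snd p))"
      if "p \<in> ?S" for p
    proof -
      have "fst p \<in> {0..1}" using that by auto
      then show ?thesis
        using vector_derivative_at[OF stereo_has_vector_derivative[OF d D[OF that]]]
        by (simp add: case_prod_unfold)
    qed
    ultimately show ?thesis by (rule continuous_on_eq[OF _ sym])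
  qed
  moreover have "continuous_map (top_of_set ({0..1} \<times> UNIV)) S2 (\<lambda>(s::real, t). h s t)"
    using c(1) hS by (auto simp: continuous_map_in_subtopology)
  moreover have "\<forall>s\<in>{0..1}. immersed_loop 1 S2 S2_atlas (h s)"
    using sphere_loop_immersed reg_homotopy_sphere_loop[OF h(1)] by blast
  ultimately show ?thesis
    unfolding regularly_homotopic_def ball_S2_atlas using h(2,3) by blast
qed

section \<open>Transition maps and a coordinate disc on the sphere\<close>

lemma frechet_derivative_cong_open:
  assumes "open S" "x \<in> S" "\<And>x. x \<in> S \<Longrightarrow> f x = g x"
  shows "f differentiable at x \<longleftrightarrow> g differentiable at x"
    "f differentiable at x \<Longrightarrow> frechet_derivative f (at x) = frechet_derivative g (at x)"
proof -
  have "(f has_derivative D) (at x) \<longleftrightarrow> (g has_derivative D) (at x)" for D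
    using has_derivative_transform_within_open[OF _ assms(1,2), of f D UNIV g]
      has_derivative_transform_within_open[OF _ assms(1,2), of g D UNIV f] assms(3) by auto
  then show "f differentiable at x \<longleftrightarrow> g differentiable at x"
    "f differentiable at x \<Longrightarrow> frechet_derivative f (at x) = frechet_derivative g (at x)"
    by (simp_all add: differentiable_def frechet_derivative_def)
qed

lemma Ck_on_cong:
  assumes "open S" "\<And>x. x \<in> S \<Longrightarrow> f x = g x" "Ck_on k f S"
  shows "Ck_on k g S"
  using assms(2,3)
proof (induction k arbitrary: f g)
  case 0
  then show ?case using continuous_on_cong[of S S f g] by simp
next
  case (Suc k)
  note c = frechet_derivative_cong_open[OF assms(1) _ Suc.prems(1)]
  have d: "f differentiable at x" if "x \<in> S" for x using Suc.prems(2) that by simp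
  have "Ck_on k (\<lambda>x. frechet_derivative g (at x) v) S" for v
    by (rule Suc.IH[of "\<lambda>x. frechet_derivative f (at x) v"]) (use Suc.prems(2) c(2) d in auto)
  then show ?case using c(1) d by auto
qed

lemma Ck_on_const: "Ck_on k (\<lambda>x. c) S"
  by (induction k arbitrary: c) (auto simp: frechet_derivative_const)

lemma Ck_on_id: "Ck_on k (\<lambda>x. x) S"
  by (cases k) (auto simp: frechet_derivative_ident Ck_on_const)

text \<open>This family is closed under directional derivatives, which only change \<open>c\<close>
  and raise \<open>n\<close> by one; hence the induction on \<open>k\<close> for all
  \<open>c\<close> and \<open>n\<close>. The change between the stereographic charts is the case
  \<open>c = 1\<close>, \<open>n = 1\<close>.\<close>

lemma Ck_on_inverse_cnj:
  assumes "open S" "0 \<notin> S"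
  shows "Ck_on k (\<lambda>z. c * inverse (cnj z) ^ n) S"
proof (induction k arbitrary: c n)
  case 0
  show ?case using assms by (auto intro!: continuous_intros)
next
  case (Suc k)
  have d: "((\<lambda>z. c * inverse (cnj z) ^ n) has_derivative
      (\<lambda>v. (- c * of_nat n * cnj v) * inverse (cnj z) ^ (n + 1))) (at z)" if "z \<in> S" for z
  proof -
    have z: "cnj z \<noteq> 0" using that assms by auto
    have "((\<lambda>w. c * inverse w ^ n) has_field_derivative - c * of_nat n * inverse (cnj z) ^ (n + 1)) (at (cnj z))"
      by (rule DERIV_cong[OF DERIV_cmult[OF DERIV_power[OF DERIV_inverse[OF z]]]])
        (cases n; simp add: algebra_simps)
    then have "((\<lambda>w. c * inverse w ^ n) has_derivative (\<lambda>v. - c * of_nat n * inverse (cnj z) ^ (n + 1) * v)) (at (cnj z))"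
      unfolding has_field_derivative_def .
    from has_derivative_compose[OF bounded_linear_imp_has_derivative[OF bounded_linear_cnj] this]
    show ?thesis by (rule has_derivative_eq_rhs) (simp add: fun_eq_iff algebra_simps)
  qed
  have "Ck_on k (\<lambda>z. frechet_derivative (\<lambda>z. c * inverse (cnj z) ^ n) (at z) v) S" for v
    using assms(1)
  proof (rule Ck_on_cong[OF _ _ Suc.IH])
    fix z assume "z \<in> S"
    show "(- c * of_nat n * cnj v) * inverse (cnj z) ^ (n + 1) = frechet_derivative (\<lambda>z. c * inverse (cnj z) ^ n) (at z) v"
      using frechet_derivative_at[OF d[OF \<open>z \<in> S\<close>]] by metis
  qed
  then show ?case using d by (auto simp: differentiable_def)
qed


text \<open>A coordinate disc must have a ball as image, while a full stereographic chart covers the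
  whole plane. The standard figure-eight has squared modulus at most 2, so the radius 2 is
  ample.\<close>

definition sphere_disc :: "(real^3) set" where
  "sphere_disc = {x \<in> sphere 0 1. x $ 3 \<noteq> 1 \<and> cmod (stereo 1 x) < 2}"

lemma continuous_on_stereo:
  assumes "\<And>x. x \<in> X \<Longrightarrow> 1 - \<epsilon> * x $ 3 \<noteq> 0"
  shows "continuous_on X (stereo \<epsilon>)"
  unfolding stereo_def[abs_def] using assms
  by (intro continuous_on_Complex continuous_intros) auto

lemma stereo_sphere_disc: "stereo 1 ` sphere_disc = ball 0 2"
proof
  show "stereo 1 ` sphere_disc \<subseteq> ball 0 2" by (auto simp: sphere_disc_def)
  show "ball 0 2 \<subseteq> stereo 1 ` sphere_disc"
  proof
    fix z assume "z \<in> ball (0::complex) 2"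
    then have "sphere_point z \<in> sphere_disc"
      using sphere_point_nth3[of z] by (simp add: sphere_disc_def norm_sphere_point stereo_sphere_point)
    then show "z \<in> stereo 1 ` sphere_disc" by (metis image_eqI stereo_sphere_point)
  qed
qed

lemma sphere_disc_chart: "is_chart S2 (sphere_disc, stereo 1)"
proof -
  let ?V = "{x \<in> sphere 0 1. x $ 3 \<noteq> (1::real)}"
  have "?V = sphere 0 1 \<inter> {x::real^3. x $ 3 \<noteq> 1}" by auto
  moreover have "open {x::real^3. x $ 3 \<noteq> 1}"
    by (intro open_Collect_neq continuous_intros)
  ultimately have V: "openin S2 ?V" by (simp add: openin_open_Int)
  have c: "continuous_on ?V (stereo 1)" by (rule continuous_on_stereo) auto
  have "openin (top_of_set ?V) (?V \<inter> stereo 1 -` ball 0 2)"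
    by (rule continuous_openin_preimage_gen[OF c]) simp
  moreover have "?V \<inter> stereo 1 -` ball 0 2 = sphere_disc" by (auto simp: sphere_disc_def)
  ultimately have "openin (top_of_set ?V) sphere_disc" by simp
  from openin_trans[OF this V] have U: "openin S2 sphere_disc" .
  have sub: "subtopology S2 sphere_disc = top_of_set sphere_disc"
  proof -
    have "sphere 0 1 \<inter> sphere_disc = sphere_disc" by (auto simp: sphere_disc_def)
    then show ?thesis by (simp only: subtopology_subtopology)
  qed
  have "homeomorphic_maps (top_of_set sphere_disc) (top_of_set (ball 0 2)) (stereo 1) sphere_point"
    unfolding homeomorphic_maps_def
  proof (intro conjI)
    have "continuous_on sphere_disc (stereo 1)"
      by (rule continuous_on_stereo) (auto simp: sphere_disc_def)
    then show "continuous_map (top_of_set sphere_disc) (top_of_set (ball 0 2)) (stereo 1)"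
      using stereo_sphere_disc by (auto simp: continuous_map_in_subtopology)
    have "continuous_on (ball 0 2) sphere_point"
      using sphere_point_has_derivative by (meson continuous_at_imp_continuous_on has_derivative_continuous)
    moreover have "sphere_point z \<in> sphere_disc" if "z \<in> ball 0 2" for z
      using that sphere_point_nth3[of z] by (simp add: sphere_disc_def norm_sphere_point stereo_sphere_point)
    ultimately show "continuous_map (top_of_set (ball 0 2)) (top_of_set sphere_disc) sphere_point"
      by (auto simp: continuous_map_in_subtopology)
  qed (auto simp: stereo_sphere_point sphere_disc_def sphere_point_stereo)
  then have "homeomorphic_map (subtopology S2 sphere_disc) (top_of_set (ball 0 2)) (stereo 1)"
    unfolding sub homeomorphic_map_maps by blast
  then show ?thesis using U by (simp add: is_chart_def stereo_sphere_disc)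
qed

lemma inj_on_stereo: "\<epsilon> \<in> {1, -1} \<Longrightarrow> inj_on (stereo \<epsilon>) {x \<in> sphere 0 1. x $ 3 \<noteq> \<epsilon>}"
proof (rule inj_onI)
  fix x y :: "real^3"
  assume \<epsilon>: "\<epsilon> \<in> {1, -1}" and x: "x \<in> {x \<in> sphere 0 1. x $ 3 \<noteq> \<epsilon>}" and y: "y \<in> {x \<in> sphere 0 1. x $ 3 \<noteq> \<epsilon>}"
    and eq: "stereo \<epsilon> x = stereo \<epsilon> y"
  \<comment> \<open>For \<open>\<epsilon> = - 1\<close> this is the reflection in the equatorial
    plane, which exchanges the two projections; for \<open>\<epsilon> = 1\<close> it is the
    identity.\<close>
  define F where "F x = mk3 (Complex (x $ 1) (x $ 2)) (\<epsilon> * x $ 3)" for x :: "real^3"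
  have e2: "\<epsilon> * \<epsilon> = 1" using \<epsilon> by auto
  have F: "stereo \<epsilon> x = stereo 1 (F x)" "norm (F x) = norm x" for x
    using e2 by (auto simp: F_def stereo_def norm_real3 power_mult_distrib power2_eq_square)
  have "F x $ 3 \<noteq> 1" "F y $ 3 \<noteq> 1" using x y \<epsilon> by (auto simp: F_def)
  moreover have "norm (F x) = 1" "norm (F y) = 1" using x y unfolding F(2) by auto
  ultimately have "sphere_point (stereo 1 (F x)) = F x" "sphere_point (stereo 1 (F y)) = F y"
    using sphere_point_stereo by blast+
  moreover have "stereo 1 (F x) = stereo 1 (F y)" using eq by (simp only: F(1))
  ultimately have "F x = F y" by metis
  then have "x $ 1 = y $ 1" "x $ 2 = y $ 2" "\<epsilon> * x $ 3 = \<epsilon> * y $ 3"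
    by (simp_all add: F_def)
  moreover have "\<epsilon> \<noteq> 0" using \<epsilon> by auto
  ultimately show "x = y" by (simp add: vec_eq_iff forall_3)
qed

text \<open>The two stereographic coordinates of a point lie on the same ray and their moduli
  multiply to 1, because the squared horizontal radius is
  \<open>(1 - x $ 3) * (1 + x $ 3)\<close>.\<close>

lemma stereo_inversion:
  assumes "norm x = 1" "x $ 3 \<noteq> 1" "x $ 3 \<noteq> - 1"
  shows "stereo (- 1) x = inverse (cnj (stereo 1 x))" "stereo 1 x = inverse (cnj (stereo (- 1) x))"
proof -
  have n: "(x$1)\<^sup>2 + (x$2)\<^sup>2 = (1 - x$3) * (1 + x$3)"
    using norm1_nth3(1)[OF assms(1)] by (simp add: power2_eq_square algebra_simps)
  have D: "1 - x$3 \<noteq> 0" "1 + x$3 \<noteq> 0" using assms by auto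
  have "stereo (- 1) x * cnj (stereo 1 x) = of_real (((x$1)\<^sup>2 + (x$2)\<^sup>2) / ((1 - x$3) * (1 + x$3)))"
    by (simp add: complex_eq_iff stereo_def power2_eq_square add_divide_distrib algebra_simps)
  then have 1: "stereo (- 1) x * cnj (stereo 1 x) = 1" using D by (simp add: n)
  then show "stereo (- 1) x = inverse (cnj (stereo 1 x))" by (metis inverse_unique mult.commute)
  have "stereo 1 x * cnj (stereo (- 1) x) = 1" using arg_cong[OF 1, of cnj] by (simp add: mult.commute)
  then show "stereo 1 x = inverse (cnj (stereo (- 1) x))" by (metis inverse_unique mult.commute)
qed

text \<open>Inversion in the unit circle carries the punctured disc of radius 2 to the exterior of
  the disc of radius 1/2. Both sets are open and miss 0, as the smoothness of the inversion
  requires.\<close>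

lemma stereo_overlap:
  "stereo 1 ` (sphere_disc \<inter> {x \<in> sphere 0 1. x $ 3 \<noteq> - 1}) = ball 0 2 - {0}"
  "stereo (- 1) ` (sphere_disc \<inter> {x \<in> sphere 0 1. x $ 3 \<noteq> - 1}) = {w. 1/2 < cmod w}"
proof -
  let ?W = "sphere_disc \<inter> {x \<in> sphere 0 1. x $ 3 \<noteq> - 1}"
  have pt: "sphere_point z \<in> ?W" if "z \<in> ball 0 2 - {0}" for z
  proof -
    have "sphere_point z $ 3 \<noteq> - 1"
    proof
      assume "sphere_point z $ 3 = - 1"
      then have "den z = 1" using den_pos[of z] by (simp add: sphere_point_def field_simps)
      then show False using that by (simp add: den_cmod)
    qed
    then show ?thesis using that sphere_point_nth3[of z]
      by (simp add: sphere_disc_def norm_sphere_point stereo_sphere_point)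
  qed
  have im: "stereo 1 x \<in> ball 0 2 - {0}" if "x \<in> ?W" for x
  proof -
    have "stereo 1 x \<noteq> 0"
    proof
      assume 0: "stereo 1 x = 0"
      have "x = sphere_point (stereo 1 x)" using that by (simp add: sphere_point_stereo sphere_disc_def)
      then have "x $ 3 = - 1" unfolding 0 by (simp add: sphere_point_def den_def)
      then show False using that by simp
    qed
    then show ?thesis using that by (simp add: sphere_disc_def)
  qed
  show 1: "stereo 1 ` ?W = ball 0 2 - {0}"
    using pt im stereo_sphere_point by (metis (no_types, lifting) image_eqI image_subsetI subsetI subset_antisym)
  have inv: "stereo (- 1) x = inverse (cnj (stereo 1 x))" if "x \<in> ?W" for x
    using that by (intro stereo_inversion) (auto simp: sphere_disc_def)
  have "stereo (- 1) ` ?W = (\<lambda>z. inverse (cnj z)) ` (stereo 1 ` ?W)"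
    unfolding image_image using inv by (rule image_cong[OF refl])
  also have "\<dots> = {w. 1/2 < cmod w}"
    unfolding 1
  proof (intro set_eqI iffI)
    fix w assume "w \<in> (\<lambda>z. inverse (cnj z)) ` (ball 0 2 - {0})"
    then obtain z where z: "w = inverse (cnj z)" "z \<in> ball 0 2 - {0}" by (rule imageE)
    then have "cmod z < 2" "z \<noteq> 0" by auto
    then show "w \<in> {w. 1/2 < cmod w}" 
      unfolding mem_Collect_eq z(1) norm_inverse complex_mod_cnj by (simp add: field_simps)
  next
    fix w :: complex assume "w \<in> {w. 1/2 < cmod w}"
    then have w: "1/2 < cmod w" by simp
    then have "w \<noteq> 0" by auto
    moreover have "cmod (inverse (cnj w)) < 2"
      unfolding norm_inverse complex_mod_cnj using w \<open>w \<noteq> 0\<close> by (simp add: field_simps)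
    ultimately have "inverse (cnj w) \<in> ball 0 2 - {0}" by simp
    then show "w \<in> (\<lambda>z. inverse (cnj z)) ` (ball 0 2 - {0})"
      by (rule rev_image_eqI) simp
  qed
  finally show "stereo (- 1) ` ?W = {w. 1/2 < cmod w}" .
qed

lemma sphere_coordinate_disc: "coordinate_disc \<infinity> S2 S2_atlas (sphere_disc, stereo 1)"
proof -
  let ?V = "\<lambda>\<epsilon>. {x \<in> sphere 0 1. x $ 3 \<noteq> (\<epsilon>::real)}"
  have subV: "sphere_disc \<subseteq> ?V 1" by (auto simp: sphere_disc_def)
  have inv1: "inv_into sphere_disc (stereo 1) (stereo 1 x) = x" if "x \<in> sphere_disc" for x
    using that inj_on_subset[OF inj_on_stereo subV] by simp
  have inv2: "inv_into (?V \<epsilon>) (stereo \<epsilon>) (stereo \<epsilon> x) = x" if "x \<in> ?V \<epsilon>" "\<epsilon> \<in> {1, -1}" for x \<epsilon>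
    using that inj_on_stereo[of \<epsilon>] by (simp del: mem_Collect_eq)
  have "compatible \<infinity> (sphere_disc, stereo 1) (?V \<epsilon>, stereo \<epsilon>)" if "\<epsilon> \<in> {1, -1}" for \<epsilon>
  proof (cases "\<epsilon> = 1")
    case True
    have I: "sphere_disc \<inter> ?V 1 = sphere_disc" using subV by auto
    have "Ck_on k (stereo 1 \<circ> inv_into sphere_disc (stereo 1)) (ball 0 2)"
      "Ck_on k (stereo 1 \<circ> inv_into (?V 1) (stereo 1)) (ball 0 2)" for k
    proof -
      have "(stereo 1 \<circ> inv_into sphere_disc (stereo 1)) z = z"
        "(stereo 1 \<circ> inv_into (?V 1) (stereo 1)) z = z" if "z \<in> ball 0 2" for z
      proof -
        obtain x where x: "x \<in> sphere_disc" "z = stereo 1 x"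
          using \<open>z \<in> ball 0 2\<close> unfolding stereo_sphere_disc[symmetric] by (elim imageE)
        have "x \<in> ?V 1" using x(1) subV by (rule rev_subsetD)
        then show "(stereo 1 \<circ> inv_into sphere_disc (stereo 1)) z = z"
          "(stereo 1 \<circ> inv_into (?V 1) (stereo 1)) z = z"
          unfolding o_def x(2) using inv1[OF x(1)] inv2[of x 1] by (simp_all del: mem_Collect_eq)
      qed
      then show "Ck_on k (stereo 1 \<circ> inv_into sphere_disc (stereo 1)) (ball 0 2)"
        "Ck_on k (stereo 1 \<circ> inv_into (?V 1) (stereo 1)) (ball 0 2)"
        by (intro Ck_on_cong[OF open_ball _ Ck_on_id]; simp)+
    qed
    then show ?thesis unfolding True compatible_def Cr_on_def prod.case I stereo_sphere_disc by blast
  next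
    case False
    then have e: "\<epsilon> = - 1" using that by auto
    let ?W = "sphere_disc \<inter> ?V (- 1)"
    have x: "norm x = 1" "x $ 3 \<noteq> 1" "x $ 3 \<noteq> - 1" if "x \<in> ?W" for x
      using that by (auto simp: sphere_disc_def)
    have "Ck_on k (stereo (- 1) \<circ> inv_into sphere_disc (stereo 1)) (stereo 1 ` ?W)" for k
    proof (rule Ck_on_cong[OF _ _ Ck_on_inverse_cnj[of _ k 1 1]])
      show "open (stereo 1 ` ?W)" "0 \<notin> stereo 1 ` ?W" "open (stereo 1 ` ?W)"
        unfolding stereo_overlap by (auto intro: open_delete)
      fix z assume "z \<in> stereo 1 ` ?W"
      then obtain x' where x': "x' \<in> ?W" "z = stereo 1 x'" by blast
      then show "1 * inverse (cnj z) ^ 1 = (stereo (- 1) \<circ> inv_into sphere_disc (stereo 1)) z"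
        using stereo_inversion(1)[OF x[OF x'(1)]] inv1[of x'] by simp
    qed
    moreover have "Ck_on k (stereo 1 \<circ> inv_into (?V (- 1)) (stereo (- 1))) (stereo (- 1) ` ?W)" for k
    proof (rule Ck_on_cong[OF _ _ Ck_on_inverse_cnj[of _ k 1 1]])
      show "open (stereo (- 1) ` ?W)" "0 \<notin> stereo (- 1) ` ?W" "open (stereo (- 1) ` ?W)"
        unfolding stereo_overlap by (auto intro!: open_Collect_less continuous_intros)
      fix z assume "z \<in> stereo (- 1) ` ?W"
      then obtain x' where x': "x' \<in> ?W" "z = stereo (- 1) x'" by blast
      then show "1 * inverse (cnj z) ^ 1 = (stereo 1 \<circ> inv_into (?V (- 1)) (stereo (- 1))) z"
        using stereo_inversion(2)[OF x[OF x'(1)]] inv2[of x' "- 1"] by simp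
    qed
    ultimately show ?thesis unfolding e compatible_def Cr_on_def prod.case by blast
  qed
  then have "\<forall>d\<in>S2_atlas. compatible \<infinity> (sphere_disc, stereo 1) d"
    by (auto simp: S2_atlas_eq)
  moreover have "\<exists>z \<rho>. \<rho> > 0 \<and> snd (sphere_disc, stereo 1) ` fst (sphere_disc, stereo 1) = ball z \<rho>"
    using stereo_sphere_disc by (intro exI[of _ 0] exI[of _ 2]) simp
  ultimately show ?thesis using sphere_disc_chart unfolding coordinate_disc_def by blast
qed

theorem even_sphere_loop_figure_eight:
  assumes \<tau>: "sphere_loop \<tau> \<tau>'" and e: "even_frame \<tau> (\<lambda>t. sgn (\<tau>' t))"
  shows "figure_eight \<infinity> 1 S2 S2_atlas \<tau>"
proof -
  let ?\<beta> = "sphere_point \<circ> standard_figure_eight"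
  have "cmod (standard_figure_eight t) < 2" for t
  proof -
    have "(cmod (standard_figure_eight t))\<^sup>2 = (cos t)\<^sup>2 * (1 + (sin t)\<^sup>2)"
      unfolding cmod_power2 standard_figure_eight_def by (simp add: power2_eq_square algebra_simps)
    also have "\<dots> \<le> 1 * 2"
      by (intro mult_mono) (simp_all add: abs_square_le_1 add_nonneg_nonneg)
    finally show ?thesis using power2_less_imp_less[of "cmod (standard_figure_eight t)" 2] by simp
  qed
  then have "\<forall>t. ?\<beta> t \<in> sphere_disc \<and> stereo 1 (?\<beta> t) = standard_figure_eight t"
    using sphere_point_nth3 by (auto simp: sphere_disc_def norm_sphere_point stereo_sphere_point less_imp_neq)
  moreover have "regularly_homotopic S2 S2_atlas \<tau> ?\<beta>"
    by (rule reg_homotopic_sphere[OF even_sphere_loop_homotopic[OF \<tau> e]])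
  ultimately show ?thesis
    unfolding figure_eight_def using sphere_loop_immersed[OF \<tau>] sphere_coordinate_disc by blast
qed

section \<open>The tantrix of a skew loop\<close>

text \<open>Hadamard's form of the difference quotient of \<open>\<tau>\<close> between
  \<open>t\<close> and \<open>s\<close>: written as an integral it extends over the diagonal by
  \<open>\<tau>'\<close> and is jointly continuous for a C^1 curve.\<close>

definition chord_slope :: "(real \<Rightarrow> 'a::euclidean_space) \<Rightarrow> real \<Rightarrow> real \<Rightarrow> 'a" where
  "chord_slope \<tau>' t s = integral {0..1} (\<lambda>x. \<tau>' (t + x * (s - t)))"

lemma chord_slope:
  fixes \<tau> :: "real \<Rightarrow> 'a::euclidean_space"
  assumes d: "\<And>t. (\<tau> has_vector_derivative \<tau>' t) (at t)"
  shows "(s - t) *\<^sub>R chord_slope \<tau>' t s = \<tau> s - \<tau> t"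
proof -
  have "((\<lambda>x. \<tau> (t + x * (s - t))) has_vector_derivative (s - t) *\<^sub>R \<tau>' (t + x * (s - t))) (at x)" for x
  proof -
    have "((\<lambda>x. t + x * (s - t)) has_vector_derivative (s - t)) (at x)"
      unfolding has_real_derivative_iff_has_vector_derivative[symmetric]
      by (auto intro!: derivative_eq_intros)
    from vector_diff_chain_at[OF this d] show ?thesis by (simp add: o_def)
  qed
  then have "((\<lambda>x. (s - t) *\<^sub>R \<tau>' (t + x * (s - t))) has_integral \<tau> (t + 1 * (s - t)) - \<tau> (t + 0 * (s - t))) {0..1}"
    by (intro fundamental_theorem_of_calculus) (auto intro: has_vector_derivative_at_within)
  then show ?thesis by (simp add: chord_slope_def integral_unique flip: integral_cmul)
qed

lemma chord_slope_diagonal: "chord_slope \<tau>' t t = \<tau>' t"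
  by (simp add: chord_slope_def)

lemma continuous_on_chord_slope:
  assumes c: "continuous_on UNIV \<tau>'"
  shows "continuous_on X (\<lambda>p. chord_slope \<tau>' (fst p) (snd p))"
proof -
  have "continuous_on (X \<times> cbox 0 (1::real)) (\<lambda>(p, x). \<tau>' (fst p + x * (snd p - fst p)))"
    unfolding case_prod_unfold by (intro continuous_on_compose2[OF c] continuous_intros) auto
  from integral_continuous_on_param[OF this] show ?thesis by (simp add: chord_slope_def)
qed

text \<open>Right multiplication by the unit quaternion that turns the frame at \<open>\<tau> t\<close> pointing towards
  \<open>\<tau> s\<close> into the frame at \<open>\<tau> s\<close> pointing towards \<open>\<tau> t\<close>. It is purely imaginary, so its square
  is \<open>- 1\<close>; here \<open>x\<close> and \<open>y\<close> are the cosine and sine of half the angle from \<open>\<tau> t\<close> to \<open>\<tau> s\<close>.\<close>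

definition swap_spinor :: "real \<Rightarrow> real \<Rightarrow> complex \<times> complex \<Rightarrow> complex \<times> complex" where
  "swap_spinor x y q = (\<i> * (of_real x * fst q + of_real y * cnj (snd q)),
     \<i> * (of_real x * snd q - of_real y * cnj (fst q)))"

lemma swap_spinor_uminus: "swap_spinor x y (- q) = - swap_spinor x y q"
  by (simp add: swap_spinor_def algebra_simps)

lemma swap_spinor_twice:
  assumes "x\<^sup>2 + y\<^sup>2 = 1"
  shows "swap_spinor x y (swap_spinor x y q) = - q"
proof -
  have "swap_spinor x y (swap_spinor x y q) = - ((x\<^sup>2 + y\<^sup>2) *\<^sub>R q)"
    by (simp add: swap_spinor_def prod_eq_iff complex_eq_iff power2_eq_square algebra_simps)
  then show ?thesis by (simp add: assms)
qed

lemma norm_swap_spinor: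
  assumes "x\<^sup>2 + y\<^sup>2 = 1" "norm q = 1"
  shows "norm (swap_spinor x y q) = 1"
proof -
  have "(cmod (fst (swap_spinor x y q)))\<^sup>2 + (cmod (snd (swap_spinor x y q)))\<^sup>2 =
      (x\<^sup>2 + y\<^sup>2) * ((cmod (fst q))\<^sup>2 + (cmod (snd q))\<^sup>2)"
    unfolding cmod_power2 by (simp add: swap_spinor_def power2_eq_square algebra_simps)
  then show ?thesis using assms by (simp add: norm_spinor)
qed

text \<open>With half-angle data the coefficients are cosine and sine of the full angle: the new
  first vector is \<open>\<tau> s\<close>, and the new second vector is the tangent direction at
  \<open>\<tau> s\<close> back towards \<open>\<tau> t\<close>.\<close>

lemma spin_swap_spinor:
  "spin1 (swap_spinor x y q) = (x\<^sup>2 - y\<^sup>2) *\<^sub>R spin1 q + (2 * x * y) *\<^sub>R spin2 q"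
  "spin2 (swap_spinor x y q) = (2 * x * y) *\<^sub>R spin1 q - (x\<^sup>2 - y\<^sup>2) *\<^sub>R spin2 q"
  unfolding vec_eq_iff forall_3 vector_add_component vector_minus_component vector_scaleR_component
    spin1_def spin2_def mk3_nth cmod_power2
  by (simp_all add: swap_spinor_def power2_eq_square algebra_simps)

lemma cross3_residual_eq_0:
  assumes "u - c *\<^sub>R v = (0::real^3)"
  shows "cross3 v u = 0"
proof -
  have "u = c *\<^sub>R v" using assms by simp
  then show ?thesis by (simp add: cross_mult_right)
qed

text \<open>Two computations of the same sign. On the diagonal the chord frame is the tangent frame,
  so an even frame gives the sign + for the shift by a period. Off the diagonal this shift is the
  square of the interchange of the two points, which acts on the lift by \<open>swap_spinor\<close>
  up to a fixed sign, so the sign is -.\<close>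

theorem skew_frame_not_even:
  assumes \<tau>: "sphere_loop \<tau> \<tau>'"
    and skew: "\<And>s t. (\<nexists>m::int. t - s = 2 * pi * of_int m) \<Longrightarrow> cross3 (\<tau> t) (\<tau> s) \<noteq> 0"
  shows "\<not> even_frame \<tau> (\<lambda>t. sgn (\<tau>' t))"
proof
  assume ev: "even_frame \<tau> (\<lambda>t. sgn (\<tau>' t))"
  have c': "continuous_on UNIV \<tau>'" and d: "(\<tau> has_vector_derivative \<tau>' t) (at t)" and ne: "\<tau>' t \<noteq> 0"
    and n1: "norm (\<tau> t) = 1" and per: "\<tau> (t + 2 * pi) = \<tau> t" for t
    using \<tau> by (auto simp: sphere_loop_def)
  have c: "continuous_on UNIV \<tau>" using sphere_loop_continuous[OF \<tau>] .
  have per': "\<tau>' (t + 2 * pi) = \<tau>' t" for t using derivative_periodic[OF d per] .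
  have tt: "\<tau> t \<bullet> \<tau> t = 1" for t using n1 by (simp add: norm_eq_1)
  have tan: "\<tau> t \<bullet> \<tau>' t = 0" for t by (rule sphere_loop_tangent[OF d n1])
  define D where "D = chord_slope \<tau>'"
  have Dst: "(s - t) *\<^sub>R D t s = \<tau> s - \<tau> t" for s t unfolding D_def by (rule chord_slope[OF d])
  have Dsh: "D (t + 2 * pi) (s + 2 * pi) = D t s" for s t
  proof -
    have "\<tau>' (t + 2 * pi + x * (s - t)) = \<tau>' (t + x * (s - t))" for x
      using per'[of "t + x * (s - t)"] by (simp add: algebra_simps)
    then show ?thesis by (simp add: D_def chord_slope_def)
  qed
  \<comment> \<open>The part of the chord slope tangent to the sphere at \<open>\<tau> t\<close>. Up
    to the factor \<open>s - t\<close> it is the tangential part of \<open>\<tau> s\<close>, so it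
    can vanish off the diagonal only where \<open>\<tau> s\<close> and \<open>\<tau> t\<close> are
    parallel.\<close>
  define P where "P t s = D t s - (D t s \<bullet> \<tau> t) *\<^sub>R \<tau> t" for t s
  have Pst: "(s - t) *\<^sub>R P t s = \<tau> s - (\<tau> s \<bullet> \<tau> t) *\<^sub>R \<tau> t" for s t
  proof -
    have "(s - t) *\<^sub>R P t s = (s - t) *\<^sub>R D t s - (((s - t) *\<^sub>R D t s) \<bullet> \<tau> t) *\<^sub>R \<tau> t"
      by (simp add: P_def scaleR_diff_right)
    then show ?thesis unfolding Dst by (simp add: inner_diff_left tt algebra_simps)
  qed
  have Pdiag: "P t t = \<tau>' t" for t
    using tan[of t] by (simp add: P_def D_def chord_slope_diagonal inner_commute)
  have not_mult: "\<nexists>m::int. t - s = 2 * pi * of_int m" if "t < s" "s < t + 2 * pi" for s t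
  proof
    assume "\<exists>m::int. t - s = 2 * pi * of_int m"
    then obtain m :: int where m: "t - s = 2 * pi * of_int m" by blast
    then have *: "2 * pi * of_int m < 0" "2 * pi * of_int m > - 2 * pi" using that by auto
    then have "m \<le> - 1" by (simp add: mult_less_0_iff)
    then have "2 * pi * of_int m \<le> 2 * pi * (- 1 :: real)" by (intro mult_left_mono) auto
    then show False using *(2) by simp
  qed
  \<comment> \<open>\<open>?X\<close> contains the diagonal, where the hypothesis on the tangent
    frame can be used; at the other edge the chord slope vanishes and the frame is lost. The
    interchange of points therefore acts only on the open strip \<open>?O\<close>. Both strips are
    convex, so lifts over them are unique up to sign.\<close>
  let ?X = "{p::real \<times> real. fst p \<le> snd p \<and> snd p < fst p + 2 * pi}"
  let ?O = "{p::real \<times> real. fst p < snd p \<and> snd p < fst p + 2 * pi}"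
  have P0: "P (fst p) (snd p) \<noteq> 0" if "p \<in> ?X" for p
  proof (cases "fst p = snd p")
    case True
    then show ?thesis using Pdiag ne by simp
  next
    case False
    show ?thesis
    proof
      assume "P (fst p) (snd p) = 0"
      then have "cross3 (\<tau> (fst p)) (\<tau> (snd p)) = 0"
        using Pst[of "snd p" "fst p"] by (intro cross3_residual_eq_0) auto
      then show False using skew not_mult[of "fst p" "snd p"] that False by auto
    qed
  qed
  have PT: "P t s \<bullet> \<tau> t = 0" for s t by (simp add: P_def inner_diff_left tt)
  have convX: "convex ?X"
  proof -
    have "?X = {p. (1, - 1) \<bullet> p \<le> 0} \<inter> {p. (- 1, 1) \<bullet> p < 2 * pi}" by (auto simp: inner_prod_def)
    then show ?thesis by (simp add: convex_Int convex_halfspace_le convex_halfspace_lt)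
  qed
  have convO: "convex ?O"
  proof -
    have "?O = {p. (1, - 1) \<bullet> p < 0} \<inter> {p. (- 1, 1) \<bullet> p < 2 * pi}" by (auto simp: inner_prod_def)
    then show ?thesis by (simp add: convex_Int convex_halfspace_lt)
  qed
  define e1 e2 where "e1 p = \<tau> (fst p)" and "e2 p = sgn (P (fst p) (snd p))" for p :: "real \<times> real"
  have ce1: "continuous_on ?X e1" unfolding e1_def[abs_def]
    by (intro continuous_on_compose2[OF c] continuous_intros) auto
  have cP: "continuous_on ?X (\<lambda>p. P (fst p) (snd p))"
    unfolding P_def D_def
    using ce1 by (intro continuous_intros continuous_on_chord_slope[OF c']) (simp_all add: e1_def[abs_def])
  have ce2: "continuous_on ?X e2" unfolding e2_def[abs_def] using cP P0 by (intro continuous_on_sgn) auto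
  have on: "orthonormal2 (e1 p) (e2 p)" if "p \<in> ?X" for p
    using P0[OF that] n1 PT[of "fst p" "snd p"]
    by (simp add: orthonormal2_def e1_def e2_def norm_sgn) (simp add: sgn_div_norm inner_commute)
  obtain Q where Q: "spin_lift ?X e1 e2 Q" using spin_lift_exists[OF convX ce1 ce2 on] by blast
  have Qn: "norm (Q p) = 1" "spin (Q p) = (e1 p, e2 p)" if "p \<in> ?X" for p
    using Q that unfolding spin_lift_def by blast+
  define sh where "sh p = (fst p + 2 * pi, snd p + 2 * pi)" for p :: "real \<times> real"
  have csh: "continuous_on ?X sh" unfolding sh_def[abs_def] by (intro continuous_intros)
  have cQ: "continuous_on ?X Q" using Q by (simp add: spin_lift_def)
  have shX: "sh p \<in> ?X" if "p \<in> ?X" for p using that by (simp add: sh_def)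
  have Psh: "P (t + 2 * pi) (s + 2 * pi) = P t s" for s t by (simp add: P_def Dsh per)
  have e_sh: "e1 (sh p) = e1 p" "e2 (sh p) = e2 p" for p by (simp_all add: e1_def e2_def sh_def per Psh)
  have "continuous_on ?X (\<lambda>p. Q (sh p))"
    by (rule continuous_on_compose2[OF cQ csh]) (use shX in blast)
  moreover have "norm (Q (sh p)) = 1 \<and> spin (Q (sh p)) = (e1 (sh p), e2 (sh p))" if "p \<in> ?X" for p
    using Q shX[OF that] unfolding spin_lift_def by blast
  ultimately have "spin_lift ?X e1 e2 (\<lambda>p. Q (sh p))"
    unfolding spin_lift_def e_sh by blast
  from spin_lift_unique[OF convex_connected[OF convX] Q this]
  have sgn: "(\<forall>p\<in>?X. Q (sh p) = Q p) \<or> (\<forall>p\<in>?X. Q (sh p) = - Q p)" .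
  have nz: "Q p \<noteq> - Q p" if "p \<in> ?X" for p
  proof
    assume "Q p = - Q p"
    then have "2 *\<^sub>R Q p = 0" by (metis add.right_inverse scaleR_2)
    then show False using Qn(1)[OF that] by simp
  qed
  \<comment> \<open>The sign of the period shift is constant on \<open>?X\<close>, so it suffices to
    find it on the diagonal, where \<open>Q\<close> restricts to a lift of the tangent
    frame.\<close>
  have per_Q: "Q (sh p) = Q p" if "p \<in> ?X" for p
  proof -
    have diag: "(\<lambda>t. (t, t)) ` UNIV \<subseteq> ?X" by auto
    have "continuous_on UNIV (\<lambda>t. Q (t, t))"
      by (rule continuous_on_compose2[OF cQ _ diag]) (intro continuous_intros)
    then have lift: "spin_lift UNIV \<tau> (\<lambda>t. sgn (\<tau>' t)) (\<lambda>t. Q (t, t))"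
      using Qn[of "(t, t)" for t] by (simp add: spin_lift_def e1_def e2_def Pdiag)
    obtain R where R: "spin_lift UNIV \<tau> (\<lambda>t. sgn (\<tau>' t)) R" "\<And>t. R (t + 2 * pi) = R t"
      using ev by (auto simp: even_frame_def)
    have "Q (0 + 2 * pi, 0 + 2 * pi) = Q (0, 0)"
      using spin_lift_unique[OF connected_UNIV lift R(1)] R(2)[of 0] by auto
    then have "Q (sh (0, 0)) = Q (0, 0)" by (simp add: sh_def)
    moreover have "(0, 0) \<in> ?X" by simp
    ultimately have "\<not> (\<forall>p\<in>?X. Q (sh p) = - Q p)" using nz by metis
    then show ?thesis using sgn that by blast
  qed
  define sw where "sw p = (snd p, fst p + 2 * pi)" for p :: "real \<times> real"
  have swO: "sw p \<in> ?O" if "p \<in> ?O" for p using that by (auto simp: sw_def)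
  have OX: "?O \<subseteq> ?X" by auto
  define k where "k p = \<tau> (fst p) \<bullet> \<tau> (snd p)" for p :: "real \<times> real"
  define x y where "x p = sqrt ((1 + k p) / 2)" and "y p = sqrt ((1 - k p) / 2)" for p
  have k_bound: "\<bar>k p\<bar> < 1" if "p \<in> ?O" for p
  proof -
    have "cross3 (\<tau> (fst p)) (\<tau> (snd p)) \<noteq> 0"
      using skew not_mult[of "fst p" "snd p"] that by auto
    then have "(norm (cross3 (\<tau> (fst p)) (\<tau> (snd p))))\<^sup>2 > 0" by simp
    moreover have "(norm (cross3 (\<tau> (fst p)) (\<tau> (snd p))))\<^sup>2 + (k p)\<^sup>2 = 1"
      using norm_cross_dot[of "\<tau> (fst p)" "\<tau> (snd p)"] n1 by (simp add: k_def)
    ultimately have "(k p)\<^sup>2 < 1" by linarith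
    then show ?thesis by (simp add: abs_square_less_1)
  qed
  have xy: "(x p)\<^sup>2 + (y p)\<^sup>2 = 1" "(x p)\<^sup>2 - (y p)\<^sup>2 = k p" "2 * x p * y p = sqrt (1 - (k p)\<^sup>2)" if "p \<in> ?O" for p
  proof -
    have pos: "(1 + k p) / 2 \<ge> 0" "(1 - k p) / 2 \<ge> 0" using k_bound[OF that] by auto
    have sq: "(x p)\<^sup>2 = (1 + k p) / 2" "(y p)\<^sup>2 = (1 - k p) / 2"
      unfolding x_def y_def using pos by simp_all
    then show "(x p)\<^sup>2 + (y p)\<^sup>2 = 1" "(x p)\<^sup>2 - (y p)\<^sup>2 = k p" by (simp_all add: field_simps)
    have "x p * y p = sqrt ((1 - (k p)\<^sup>2) / 4)"
      unfolding x_def y_def real_sqrt_mult[symmetric] by (simp add: power2_eq_square field_simps)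
    then show "2 * x p * y p = sqrt (1 - (k p)\<^sup>2)" by (simp add: real_sqrt_divide)
  qed
  have frame: "\<tau> (snd p) = k p *\<^sub>R e1 p + sqrt (1 - (k p)\<^sup>2) *\<^sub>R e2 p" if "p \<in> ?O" for p
  proof -
    let ?w = "\<tau> (snd p) - k p *\<^sub>R \<tau> (fst p)"
    have w: "?w = (snd p - fst p) *\<^sub>R P (fst p) (snd p)"
      using Pst[of "snd p" "fst p"] by (simp add: k_def inner_commute)
    have "e2 p = sgn ?w" unfolding w e2_def using that by (simp add: sgn_scaleR)
    moreover have "(norm ?w)\<^sup>2 = 1 - (k p)\<^sup>2"
      unfolding power2_norm_eq_inner
      by (simp add: inner_diff_left inner_diff_right tt k_def inner_commute power2_eq_square)
    then have "norm ?w = sqrt (1 - (k p)\<^sup>2)" by (metis norm_ge_zero real_sqrt_unique)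
    moreover have "norm ?w *\<^sub>R sgn ?w = ?w" by (cases "?w = 0") (simp_all add: sgn_div_norm)
    ultimately show ?thesis by (simp add: e1_def algebra_simps)
  qed
  have k_sw: "k (sw p) = k p" for p by (simp add: k_def sw_def per inner_commute)
  have e_sw: "e1 (sw p) = k p *\<^sub>R e1 p + sqrt (1 - (k p)\<^sup>2) *\<^sub>R e2 p"
    "e2 (sw p) = sqrt (1 - (k p)\<^sup>2) *\<^sub>R e1 p - k p *\<^sub>R e2 p" if p: "p \<in> ?O" for p
  proof -
    define \<sigma> where "\<sigma> = sqrt (1 - (k p)\<^sup>2)"
    have "(k p)\<^sup>2 < 1" using k_bound[OF p] by (simp add: abs_square_less_1)
    then have \<sigma>: "\<sigma> > 0" "\<sigma> * \<sigma> = 1 - k p * k p" by (simp_all add: \<sigma>_def power2_eq_square)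
    show 1: "e1 (sw p) = k p *\<^sub>R e1 p + sqrt (1 - (k p)\<^sup>2) *\<^sub>R e2 p"
      using frame[OF p] by (simp add: e1_def sw_def)
    \<comment> \<open>After a second interchange the first vector is \<open>e1 p\<close> again, up
      to a period. The frame relation at \<open>sw p\<close> therefore expresses \<open>e1 p\<close>
      through \<open>e2 (sw p)\<close> and can be solved for it, as the sine \<open>\<sigma>\<close>
      is positive.\<close>
    have "e1 p = k p *\<^sub>R e1 (sw p) + \<sigma> *\<^sub>R e2 (sw p)"
      using frame[OF swO[OF p]] by (simp add: k_sw \<sigma>_def) (simp add: e1_def sw_def per)
    then have "\<sigma> *\<^sub>R e2 (sw p) = e1 p - k p *\<^sub>R (k p *\<^sub>R e1 p + \<sigma> *\<^sub>R e2 p)"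
      unfolding 1 \<sigma>_def[symmetric] by (simp add: algebra_simps)
    also have "\<dots> = (\<sigma> * \<sigma>) *\<^sub>R e1 p - (\<sigma> * k p) *\<^sub>R e2 p"
      unfolding \<sigma>(2) by (simp add: algebra_simps)
    also have "\<dots> = \<sigma> *\<^sub>R (\<sigma> *\<^sub>R e1 p - k p *\<^sub>R e2 p)" by (simp add: algebra_simps)
    finally show "e2 (sw p) = sqrt (1 - (k p)\<^sup>2) *\<^sub>R e1 p - k p *\<^sub>R e2 p"
      using \<sigma>(1) by (simp add: \<sigma>_def)
  qed
  have cQO: "continuous_on ?O Q" by (rule continuous_on_subset[OF cQ OX])
  have "spin_lift ?O (\<lambda>p. e1 (sw p)) (\<lambda>p. e2 (sw p)) (\<lambda>p. Q (sw p))"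
    unfolding spin_lift_def
  proof
    have "continuous_on ?O sw" unfolding sw_def[abs_def] by (intro continuous_intros)
    then show "continuous_on ?O (\<lambda>p. Q (sw p))"
      by (rule continuous_on_compose2[OF cQO]) (use swO in blast)
    show "\<forall>p\<in>?O. norm (Q (sw p)) = 1 \<and> spin (Q (sw p)) = (e1 (sw p), e2 (sw p))"
      using Q swO OX unfolding spin_lift_def by blast
  qed
  moreover have "spin_lift ?O (\<lambda>p. e1 (sw p)) (\<lambda>p. e2 (sw p)) (\<lambda>p. swap_spinor (x p) (y p) (Q p))"
    unfolding spin_lift_def
  proof
    have "continuous_on ?O k" unfolding k_def[abs_def]
      by (intro continuous_intros continuous_on_compose2[OF c]) auto
    then have "continuous_on ?O x" "continuous_on ?O y"
      unfolding x_def[abs_def] y_def[abs_def] by (auto intro!: continuous_intros)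
    then show "continuous_on ?O (\<lambda>p. swap_spinor (x p) (y p) (Q p))"
      unfolding swap_spinor_def using cQO by (intro continuous_intros)
    show "\<forall>p\<in>?O. norm (swap_spinor (x p) (y p) (Q p)) = 1 \<and>
        spin (swap_spinor (x p) (y p) (Q p)) = (e1 (sw p), e2 (sw p))"
    proof
      fix p assume p: "p \<in> ?O"
      then have Qp: "norm (Q p) = 1" "spin1 (Q p) = e1 p" "spin2 (Q p) = e2 p"
        using Qn[OF subsetD[OF OX p]] by (auto simp: spin_def)
      show "norm (swap_spinor (x p) (y p) (Q p)) = 1 \<and>
        spin (swap_spinor (x p) (y p) (Q p)) = (e1 (sw p), e2 (sw p))"
        using norm_swap_spinor[OF xy(1)[OF p] Qp(1)]
        by (simp only: spin_def spin_swap_spinor xy[OF p] Qp e_sw[OF p])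
    qed
  qed
  ultimately have sw: "(\<forall>p\<in>?O. swap_spinor (x p) (y p) (Q p) = Q (sw p)) \<or>
      (\<forall>p\<in>?O. swap_spinor (x p) (y p) (Q p) = - Q (sw p))"
    by (rule spin_lift_unique[OF convex_connected[OF convO]])
  define p where "p = (0::real, 1::real)"
  have p: "p \<in> ?O" using pi_gt3 by (simp add: p_def)
  have xy_sw: "x (sw p) = x p" "y (sw p) = y p" by (simp_all add: x_def y_def k_sw)
  \<comment> \<open>The unknown sign is the same at \<open>p\<close> and at \<open>sw p\<close>, so
    it cancels when the interchange is done twice.\<close>
  have "swap_spinor (x p) (y p) (Q p) = Q (sw p) \<and> swap_spinor (x p) (y p) (Q (sw p)) = Q (sw (sw p)) \<or>
      swap_spinor (x p) (y p) (Q p) = - Q (sw p) \<and> swap_spinor (x p) (y p) (Q (sw p)) = - Q (sw (sw p))"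
    using sw
  proof
    assume "\<forall>p\<in>?O. swap_spinor (x p) (y p) (Q p) = Q (sw p)"
    from bspec[OF this p] bspec[OF this swO[OF p]] show ?thesis unfolding xy_sw by blast
  next
    assume "\<forall>p\<in>?O. swap_spinor (x p) (y p) (Q p) = - Q (sw p)"
    from bspec[OF this p] bspec[OF this swO[OF p]] show ?thesis unfolding xy_sw by blast
  qed
  then have "Q (sw (sw p)) = swap_spinor (x p) (y p) (swap_spinor (x p) (y p) (Q p))"
    by (auto simp: swap_spinor_uminus)
  then have "Q (sh p) = - Q p"
    using swap_spinor_twice[OF xy(1)[OF p]] by (simp add: sw_def sh_def)
  then show False
    using per_Q[OF subsetD[OF OX p]] nz[OF subsetD[OF OX p]] by metis
qed

section \<open>Positively curved parametrised surfaces\<close>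

lemma continuous_on_locally:
  fixes X :: "'a::t2_space set"
  assumes "\<And>x. x \<in> X \<Longrightarrow> \<exists>T. openin (top_of_set X) T \<and> x \<in> T \<and> continuous_on T g"
  shows "continuous_on X g"
  unfolding continuous_on_eq_continuous_within
proof
  fix x assume "x \<in> X"
  then obtain T where T: "openin (top_of_set X) T" "x \<in> T" "continuous_on T g" using assms by blast
  then obtain O' where "open O'" "T = X \<inter> O'" by (auto simp: openin_open)
  then have "at x within T = at x within X"
    using T(2) by (intro at_within_nhd[of x O']) auto
  moreover have "continuous (at x within T) g" using T by (simp add: continuous_on_eq_continuous_within)
  ultimately show "continuous (at x within X) g" by (simp add: continuous_within)
qed

lemma has_vector_derivative_sgn:
  fixes v :: "real \<Rightarrow> 'a::real_inner"
  assumes v: "(v has_vector_derivative w) (at t)" and "v t \<noteq> 0"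
  shows "((\<lambda>t. sgn (v t)) has_vector_derivative (w - (w \<bullet> sgn (v t)) *\<^sub>R sgn (v t)) /\<^sub>R norm (v t)) (at t)"
proof -
  have nz: "norm (v t) \<noteq> 0" using assms by simp
  have "((\<lambda>t. norm (v t)) has_derivative (\<lambda>h. (h *\<^sub>R w) \<bullet> sgn (v t))) (at t)"
    using has_derivative_compose[OF v[unfolded has_vector_derivative_def] has_derivative_norm[OF assms(2)]]
    by (simp add: inner_commute)
  then have n: "((\<lambda>t. norm (v t)) has_real_derivative (w \<bullet> sgn (v t))) (at t)"
    unfolding has_field_derivative_def by (rule has_derivative_eq_rhs) (simp add: fun_eq_iff)
  have i: "((\<lambda>t. inverse (norm (v t))) has_real_derivative - (w \<bullet> sgn (v t)) / (norm (v t))\<^sup>2) (at t)"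
    by (rule DERIV_cong[OF DERIV_inverse'[OF n nz]]) (simp add: power2_eq_square divide_inverse)
  define u r where "u = sgn (v t)" and "r = norm (v t)"
  have r: "r \<noteq> 0" and vt: "v t = r *\<^sub>R u" using nz by (simp_all add: u_def r_def sgn_div_norm)
  have "(- (w \<bullet> u) / r\<^sup>2) *\<^sub>R v t = - ((inverse r * (w \<bullet> u)) *\<^sub>R u)"
    unfolding vt using r by (simp add: power2_eq_square divide_inverse)
  then have "inverse r *\<^sub>R w + (- (w \<bullet> u) / r\<^sup>2) *\<^sub>R v t = (w - (w \<bullet> u) *\<^sub>R u) /\<^sub>R r"
    by (simp add: scaleR_diff_right)
  then show ?thesis
    using has_vector_derivative_scaleR[OF i v] unfolding sgn_div_norm[of "v _", abs_def] u_def r_def by metis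
qed

lemma partial_works:
  assumes "X differentiable (at z)"
  shows "frechet_derivative X (at z) v = Re v *\<^sub>R partial 1 X z + Im v *\<^sub>R partial \<i> X z"
    "(X has_derivative (\<lambda>v. Re v *\<^sub>R partial 1 X z + Im v *\<^sub>R partial \<i> X z)) (at z)"
proof -
  have l: "linear (frechet_derivative X (at z))" using assms by (rule linear_frechet_derivative)
  have eq: "frechet_derivative X (at z) v = Re v *\<^sub>R partial 1 X z + Im v *\<^sub>R partial \<i> X z" for v
  proof -
    have "v = Re v *\<^sub>R 1 + Im v *\<^sub>R \<i>" by (simp add: complex_eq_iff)
    then have "frechet_derivative X (at z) v = frechet_derivative X (at z) (Re v *\<^sub>R 1 + Im v *\<^sub>R \<i>)"
      by simp
    then show ?thesis by (simp add: linear_add[OF l] linear_cmul[OF l] partial_def)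
  qed
  show "frechet_derivative X (at z) v = Re v *\<^sub>R partial 1 X z + Im v *\<^sub>R partial \<i> X z" by (rule eq)
  show "(X has_derivative (\<lambda>v. Re v *\<^sub>R partial 1 X z + Im v *\<^sub>R partial \<i> X z)) (at z)"
    using assms unfolding frechet_derivative_works eq[abs_def] .
qed

lemma has_real_derivative_along_line:
  assumes "(g has_derivative (\<lambda>v. Re v * p + Im v * q)) (at (z + of_real x * w))"
  shows "((\<lambda>x. g (z + of_real x * w)) has_real_derivative Re w * p + Im w * q) (at x)"
proof -
  have "((\<lambda>x. z + of_real x * w) has_derivative (\<lambda>h. of_real h * w)) (at x)"
    by (auto intro!: derivative_eq_intros)
  from has_derivative_compose[OF this assms] show ?thesis
    unfolding has_field_derivative_def by (rule has_derivative_eq_rhs) (auto simp: algebra_simps)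
qed

text \<open>Schwarz's argument: the second difference of \<open>g\<close> over a small square,
  evaluated by the mean value theorem in both orders, equates a value of \<open>g12\<close> with a
  value of \<open>g21\<close> near \<open>z\<close>.\<close>

lemma mixed_partials_commute:
  fixes g :: "complex \<Rightarrow> real"
  assumes W: "open W" "z \<in> W"
    and g: "\<And>w. w \<in> W \<Longrightarrow> (g has_derivative (\<lambda>v. Re v * g1 w + Im v * g2 w)) (at w)"
      "\<And>w. w \<in> W \<Longrightarrow> (g1 has_derivative (\<lambda>v. Re v * g11 w + Im v * g12 w)) (at w)"
      "\<And>w. w \<in> W \<Longrightarrow> (g2 has_derivative (\<lambda>v. Re v * g21 w + Im v * g22 w)) (at w)"
    and c: "continuous_on W g12" "continuous_on W g21"
  shows "g12 z = g21 z"
proof (rule ccontr)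
  assume ne: "g12 z \<noteq> g21 z"
  define \<epsilon> where "\<epsilon> = \<bar>g12 z - g21 z\<bar> / 2"
  have "\<epsilon> > 0" using ne by (simp add: \<epsilon>_def)
  have "isCont g12 z" "isCont g21 z" using c W by (simp_all add: continuous_on_eq_continuous_at)
  then obtain d1 d2 where d12: "d1 > 0" "\<And>w. dist w z < d1 \<Longrightarrow> dist (g12 w) (g12 z) < \<epsilon>"
    "d2 > 0" "\<And>w. dist w z < d2 \<Longrightarrow> dist (g21 w) (g21 z) < \<epsilon>"
    using \<open>\<epsilon> > 0\<close> unfolding continuous_at_eps_delta by metis
  obtain d3 where d3: "d3 > 0" "ball z d3 \<subseteq> W" using W open_contains_ball by blast
  \<comment> \<open>Points of the square of side \<open>h\<close> are at distance at most
    \<open>2 * h\<close> from \<open>z\<close>; dividing by 3 makes this strictly smaller than each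
    of the three radii.\<close>
  define h where "h = min d1 (min d2 d3) / 3"
  have h: "h > 0" using d12 d3 by (simp add: h_def)
  define pt where "pt a b = z + Complex a b" for a b
  have near: "dist (pt a b) z < d1" "dist (pt a b) z < d2" "pt a b \<in> W"
    if "0 \<le> a" "a \<le> h" "0 \<le> b" "b \<le> h" for a b
  proof -
    have "dist (pt a b) z \<le> \<bar>a\<bar> + \<bar>b\<bar>" using cmod_le[of "Complex a b"] by (simp add: pt_def dist_norm)
    then have "dist (pt a b) z < 3 * h" using that h by linarith
    then show "dist (pt a b) z < d1" "dist (pt a b) z < d2" "pt a b \<in> W"
      using d3 by (auto simp: h_def dist_commute subset_iff)
  qed
  have line1: "((\<lambda>a. F (pt a b)) has_real_derivative p) (at a)"
    if "(F has_derivative (\<lambda>v. Re v * p + Im v * q)) (at (pt a b))" for F p q a b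
    using has_real_derivative_along_line[of F p q "z + Complex 0 b" a 1] that
    by (simp add: pt_def complex_of_real_def add.assoc plus_complex.ctr)
  have line2: "((\<lambda>b. F (pt a b)) has_real_derivative q) (at b)"
    if "(F has_derivative (\<lambda>v. Re v * p + Im v * q)) (at (pt a b))" for F p q a b
  proof -
    have "z + Complex a 0 + of_real x * \<i> = pt a x" for x by (simp add: pt_def complex_eq_iff)
    then show ?thesis using has_real_derivative_along_line[of F p q "z + Complex a 0" b \<i>] that by simp
  qed
  have "\<exists>\<xi>. 0 < \<xi> \<and> \<xi> < h \<and> (g (pt h h) - g (pt h 0)) - (g (pt 0 h) - g (pt 0 0)) =
      (h - 0) * (g1 (pt \<xi> h) - g1 (pt \<xi> 0))"
    using h by (intro MVT2 DERIV_diff line1[OF g(1)] near(3)) auto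
  then obtain \<xi> where \<xi>: "0 < \<xi>" "\<xi> < h" "(g (pt h h) - g (pt h 0)) - (g (pt 0 h) - g (pt 0 0)) =
      h * (g1 (pt \<xi> h) - g1 (pt \<xi> 0))" by auto
  have "\<exists>\<eta>. 0 < \<eta> \<and> \<eta> < h \<and> g1 (pt \<xi> h) - g1 (pt \<xi> 0) = (h - 0) * g12 (pt \<xi> \<eta>)"
    using h \<xi> by (intro MVT2 line2[OF g(2)] near(3)) auto
  then obtain \<eta> where \<eta>: "0 < \<eta>" "\<eta> < h" "g1 (pt \<xi> h) - g1 (pt \<xi> 0) = h * g12 (pt \<xi> \<eta>)" by auto
  have "\<exists>\<mu>. 0 < \<mu> \<and> \<mu> < h \<and> (g (pt h h) - g (pt 0 h)) - (g (pt h 0) - g (pt 0 0)) =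
      (h - 0) * (g2 (pt h \<mu>) - g2 (pt 0 \<mu>))"
    using h by (intro MVT2 DERIV_diff line2[OF g(1)] near(3)) auto
  then obtain \<mu> where \<mu>: "0 < \<mu>" "\<mu> < h" "(g (pt h h) - g (pt 0 h)) - (g (pt h 0) - g (pt 0 0)) =
      h * (g2 (pt h \<mu>) - g2 (pt 0 \<mu>))" by auto
  have "\<exists>\<nu>. 0 < \<nu> \<and> \<nu> < h \<and> g2 (pt h \<mu>) - g2 (pt 0 \<mu>) = (h - 0) * g21 (pt \<nu> \<mu>)"
    using h \<mu> by (intro MVT2 line1[OF g(3)] near(3)) auto
  then obtain \<nu> where \<nu>: "0 < \<nu>" "\<nu> < h" "g2 (pt h \<mu>) - g2 (pt 0 \<mu>) = h * g21 (pt \<nu> \<mu>)" by auto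
  have "h * (h * g12 (pt \<xi> \<eta>)) = h * (h * g21 (pt \<nu> \<mu>))"
    using \<xi>(3) \<mu>(3) unfolding \<eta>(3) \<nu>(3) by linarith
  then have "g12 (pt \<xi> \<eta>) = g21 (pt \<nu> \<mu>)" using h by simp
  moreover have "dist (g12 (pt \<xi> \<eta>)) (g12 z) < \<epsilon>" "dist (g21 (pt \<nu> \<mu>)) (g21 z) < \<epsilon>"
    using near \<xi> \<eta> \<mu> \<nu> by (intro d12; simp)+
  ultimately have "\<bar>g12 z - g21 z\<bar> < \<epsilon> + \<epsilon>" unfolding dist_real_def by linarith
  then show False by (simp add: \<epsilon>_def)
qed

lemma quadratic_form_pos:
  fixes a b d x y :: real
  assumes "a > 0" "a * d - b\<^sup>2 > 0" "x \<noteq> 0 \<or> y \<noteq> 0"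
  shows "x\<^sup>2 * a + 2 * x * y * b + y\<^sup>2 * d > 0"
proof -
  have "a * (x\<^sup>2 * a + 2 * x * y * b + y\<^sup>2 * d) = (a * x + b * y)\<^sup>2 + (a * d - b\<^sup>2) * y\<^sup>2"
    by (simp add: power2_eq_square algebra_simps)
  also have "\<dots> > 0"
  proof (cases "y = 0")
    case True
    then show ?thesis using assms by simp
  next
    case False
    then show ?thesis using assms by (intro add_nonneg_pos) auto
  qed
  finally show ?thesis using assms(1) by (simp add: zero_less_mult_iff)
qed

section \<open>The distinguished normal of a positively curved patch\<close>

locale curved_patch =
  fixes X :: "complex \<Rightarrow> real^3" and W :: "complex set"
  assumes W: "open W" and Ck: "Ck_on 2 X W"
    and imm: "\<And>z. z \<in> W \<Longrightarrow> inj (frechet_derivative X (at z))"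
    and curved: "\<And>z. z \<in> W \<Longrightarrow> gauss_curvature X z > 0"
begin

definition "H v w z = partial v (partial w X) z"

text \<open>A definite second form has a nonzero coefficient in the direction 1, and the sign of
  that coefficient decides which of the two unit normals makes the form positive.\<close>

definition "conormal z = sgn (H 1 1 z \<bullet> unit_normal X z) *\<^sub>R unit_normal X z"

definition "D z v = Re v *\<^sub>R partial 1 X z + Im v *\<^sub>R partial \<i> X z"

lemma Ck2:
  shows "\<And>z. z \<in> W \<Longrightarrow> X differentiable (at z)"
    "\<And>z w. z \<in> W \<Longrightarrow> partial w X differentiable (at z)"
    "\<And>v w. continuous_on W (H v w)"
proof -
  have 2: "Ck_on (Suc (Suc 0)) X W" using Ck by (simp only: numeral_2_eq_2)
  then show "\<And>z. z \<in> W \<Longrightarrow> X differentiable (at z)"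
    "\<And>z w. z \<in> W \<Longrightarrow> partial w X differentiable (at z)"
    "\<And>v w. continuous_on W (H v w)"
    unfolding Ck_on.simps H_def[abs_def] partial_def[abs_def] by auto
qed

lemma continuous_partial: "continuous_on W (partial w X)"
  by (rule continuous_at_imp_continuous_on) (intro ballI differentiable_imp_continuous_within Ck2(2))

lemma D_eq: "z \<in> W \<Longrightarrow> frechet_derivative X (at z) v = D z v"
  unfolding D_def by (rule partial_works(1)[OF Ck2(1)])

lemma has_derivative_D: "z \<in> W \<Longrightarrow> (X has_derivative D z) (at z)"
  unfolding D_def[abs_def] by (rule partial_works(2)[OF Ck2(1)])

lemma D_nonzero:
  assumes "z \<in> W" "v \<noteq> 0"
  shows "D z v \<noteq> 0"
proof
  assume "D z v = 0"
  then have "frechet_derivative X (at z) v = frechet_derivative X (at z) 0"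
    using D_eq[OF assms(1)] by (simp add: D_def)
  then show False using imm[OF assms(1)] assms(2) by (simp add: inj_eq)
qed

lemma cross_nonzero:
  assumes z: "z \<in> W"
  shows "cross3 (partial 1 X z) (partial \<i> X z) \<noteq> 0"
proof
  assume "cross3 (partial 1 X z) (partial \<i> X z) = 0"
  then consider "partial 1 X z = 0" | "partial \<i> X z = 0" | c where "partial \<i> X z = c *\<^sub>R partial 1 X z"
    unfolding cross_eq_0 collinear_lemma by blast
  then show False
  proof cases
    case 1
    then show False using D_nonzero[OF z, of 1] by (simp add: D_def)
  next
    case 2
    then show False using D_nonzero[OF z, of \<i>] by (simp add: D_def)
  next
    case 3
    then show False using D_nonzero[OF z, of "Complex (- c) 1"] by (simp add: D_def complex_eq_iff)
  qed
qed

lemma unit_normal: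
  assumes z: "z \<in> W"
  shows "norm (unit_normal X z) = 1" "partial 1 X z \<bullet> unit_normal X z = 0"
    "partial \<i> X z \<bullet> unit_normal X z = 0"
  using cross_nonzero[OF z] by (simp_all add: unit_normal_def Let_def dot_cross_self)

lemma mixed: "z \<in> W \<Longrightarrow> H \<i> 1 z \<bullet> n = H 1 \<i> z \<bullet> n"
proof -
  assume z: "z \<in> W"
  have d: "((\<lambda>w. F w \<bullet> n) has_derivative (\<lambda>v. Re v * (partial 1 F w \<bullet> n) + Im v * (partial \<i> F w \<bullet> n))) (at w)"
    if "F differentiable (at w)" for F :: "complex \<Rightarrow> real^3" and w
    using has_derivative_inner_left[OF partial_works(2)[OF that]] by (simp add: inner_add_left)
  show "H \<i> 1 z \<bullet> n = H 1 \<i> z \<bullet> n"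
    unfolding H_def
  proof (rule mixed_partials_commute[OF W z d[OF Ck2(1)] d[OF Ck2(2)] d[OF Ck2(2)]])
    have "continuous_on W (\<lambda>w. H u v w \<bullet> n)" for u v
      by (intro continuous_on_inner Ck2(3) continuous_on_const)
    then show "continuous_on W (\<lambda>w. partial \<i> (partial 1 X) w \<bullet> n)"
      "continuous_on W (\<lambda>w. partial 1 (partial \<i> X) w \<bullet> n)"
      unfolding H_def by blast+
  qed
qed

text \<open>The denominator of the Gauss curvature is the Gram determinant of the partials, that is,
  the squared norm of their cross product. So positive curvature means a positive determinant of the
  second form, which excludes \<open>a = 0\<close>; switching the normal leaves the determinant
  unchanged.\<close>

lemma second_form_definite:
  assumes z: "z \<in> W"
  shows "H 1 1 z \<bullet> conormal z > 0"
    "(H 1 1 z \<bullet> conormal z) * (H \<i> \<i> z \<bullet> conormal z) - (H 1 \<i> z \<bullet> conormal z)\<^sup>2 > 0"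
proof -
  let ?n = "unit_normal X z"
  define a b d where "a = H 1 1 z \<bullet> ?n" and "b = H 1 \<i> z \<bullet> ?n" and "d = H \<i> \<i> z \<bullet> ?n"
  have "(norm (cross3 (partial 1 X z) (partial \<i> X z)))\<^sup>2 > 0" using cross_nonzero[OF z] by simp
  moreover have "(norm (partial 1 X z) * norm (partial \<i> X z))\<^sup>2 =
      (partial 1 X z \<bullet> partial 1 X z) * (partial \<i> X z \<bullet> partial \<i> X z)"
    by (simp add: power_mult_distrib power2_norm_eq_inner)
  ultimately have "first_form X z 1 1 * first_form X z \<i> \<i> - (first_form X z 1 \<i>)\<^sup>2 > 0"
    using norm_cross_dot[of "partial 1 X z" "partial \<i> X z"] unfolding first_form_def by linarith
  then have pos: "a * d - b\<^sup>2 > 0"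
    using curved[OF z] unfolding gauss_curvature_def second_form_def a_def b_def d_def H_def
    by (simp add: zero_less_divide_iff)
  have "a \<noteq> 0"
  proof
    assume "a = 0"
    then show False using pos zero_le_power2[of b] by simp
  qed
  have sg: "sgn a * sgn a = 1" using \<open>a \<noteq> 0\<close> by (auto simp: sgn_real_def)
  have c: "H 1 1 z \<bullet> conormal z = sgn a * a" "H 1 \<i> z \<bullet> conormal z = sgn a * b" "H \<i> \<i> z \<bullet> conormal z = sgn a * d"
    by (simp_all add: conormal_def a_def b_def d_def)
  show "H 1 1 z \<bullet> conormal z > 0" unfolding c using \<open>a \<noteq> 0\<close> by (simp add: sgn_real_def)
  have "sgn a * a * (sgn a * d) - (sgn a * b)\<^sup>2 = (sgn a * sgn a) * (a * d - b\<^sup>2)"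
    by (simp add: power2_eq_square algebra_simps)
  then show "(H 1 1 z \<bullet> conormal z) * (H \<i> \<i> z \<bullet> conormal z) - (H 1 \<i> z \<bullet> conormal z)\<^sup>2 > 0"
    unfolding c using pos sg by simp
qed

lemma norm_conormal: "z \<in> W \<Longrightarrow> norm (conormal z) = 1"
  using unit_normal(1) second_form_definite(1) by (fastforce simp: conormal_def sgn_real_def split: if_splits)

lemma D_conormal: "z \<in> W \<Longrightarrow> D z v \<bullet> conormal z = 0"
  using unit_normal(2,3) by (simp add: conormal_def D_def inner_add_left)

text \<open>The second form on \<open>(v, v)\<close>, written out in the shape that the product rule
  yields for the acceleration of a curve.\<close>

lemma hessian_pos:
  assumes z: "z \<in> W" and v: "v \<noteq> 0"
  shows "(Re v *\<^sub>R (Re v *\<^sub>R H 1 1 z + Im v *\<^sub>R H \<i> 1 z) + Im v *\<^sub>R (Re v *\<^sub>R H 1 \<i> z + Im v *\<^sub>R H \<i> \<i> z)) \<bullet> conormal z > 0"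
proof -
  have "Re v \<noteq> 0 \<or> Im v \<noteq> 0" using v by (auto simp: complex_eq_iff)
  from quadratic_form_pos[OF second_form_definite[OF z] this] show ?thesis
    by (simp add: inner_add_left mixed[OF z] power2_eq_square algebra_simps)
qed

lemma continuous_on_conormal: "continuous_on W conormal"
proof -
  have n: "continuous_on W (unit_normal X)"
    unfolding unit_normal_def[abs_def] Let_def
    using cross_nonzero by (intro continuous_intros continuous_on_cross continuous_partial) auto
  have "H 1 1 z \<bullet> unit_normal X z \<noteq> 0" if "z \<in> W" for z
    using second_form_definite(1)[OF that] by (auto simp: conormal_def)
  then show ?thesis
    unfolding conormal_def[abs_def]
    by (intro continuous_on_scaleR continuous_on_sgn continuous_on_inner n Ck2(3)) auto
qed

lemma continuous_on_D:
  assumes "continuous_on S a" "continuous_on S b" "\<And>x. x \<in> S \<Longrightarrow> a x \<in> W"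
  shows "continuous_on S (\<lambda>x. D (a x) (b x))"
  unfolding D_def using assms
  by (intro continuous_intros continuous_on_compose2[OF continuous_partial assms(1)]) auto

text \<open>The height over the tangent plane at \<open>z\<close> vanishes to first order at
  \<open>z\<close>. Its Hessian, taken against the fixed vector \<open>conormal z\<close>, is
  positive definite at \<open>z\<close> and by continuity on a ball; the mean value theorem applied
  twice along a segment gives strict positivity.\<close>

lemma strict_support:
  assumes z: "z \<in> W"
  obtains \<delta> where "\<delta> > 0" "ball z \<delta> \<subseteq> W"
    "\<forall>w\<in>ball z \<delta>. w \<noteq> z \<longrightarrow> (X w - X z) \<bullet> conormal z > 0"
proof -
  let ?N = "conormal z"
  define a where "a w = H 1 1 w \<bullet> ?N" for w
  \<comment> \<open>The second derivative along a segment contains both mixed coefficients with the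
    same factor, so their average is the off-diagonal entry.\<close>
  define b where "b w = (H 1 \<i> w \<bullet> ?N + H \<i> 1 w \<bullet> ?N) / 2" for w
  define d where "d w = H \<i> \<i> w \<bullet> ?N" for w
  have c: "continuous_on W a" "continuous_on W b" "continuous_on W d"
    unfolding a_def[abs_def] b_def[abs_def] d_def[abs_def] by (auto intro!: continuous_intros Ck2(3))
  define A where "A = W \<inter> a -` {0<..}"
  define B where "B = W \<inter> (\<lambda>w. a w * d w - (b w)\<^sup>2) -` {0<..}"
  have "open A" "open B" unfolding A_def B_def
    by (intro continuous_open_preimage W continuous_intros c; simp)+
  moreover have "z \<in> A" "z \<in> B"
    using second_form_definite[OF z] z by (simp_all add: A_def B_def a_def b_def d_def mixed)
  ultimately obtain \<delta> where \<delta>: "\<delta> > 0" "ball z \<delta> \<subseteq> A \<inter> B"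
    by (meson IntI open_Int open_contains_ball)
  show ?thesis
  proof
    show "\<delta> > 0" "ball z \<delta> \<subseteq> W" using \<delta> by (auto simp: A_def)
    show "\<forall>w\<in>ball z \<delta>. w \<noteq> z \<longrightarrow> (X w - X z) \<bullet> conormal z > 0"
    proof (intro ballI impI)
      fix w assume w: "w \<in> ball z \<delta>" "w \<noteq> z"
      define v where "v = w - z"
      have seg: "z + of_real u * v \<in> ball z \<delta>" if "0 \<le> u" "u \<le> 1" for u
      proof -
        have "dist z (z + of_real u * v) = u * cmod v" using that by (simp add: dist_norm norm_mult)
        also have "\<dots> \<le> 1 * cmod v" using that by (intro mult_right_mono) auto
        finally show ?thesis using w by (simp add: v_def dist_norm norm_minus_commute)
      qed
      have segW: "z + of_real u * v \<in> W" if "0 \<le> u" "u \<le> 1" for u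
        using seg[OF that] \<delta>(2) by (auto simp: A_def)
      define g where "g u = X (z + of_real u * v) \<bullet> ?N" for u
      define g' where "g' u = Re v * (partial 1 X (z + of_real u * v) \<bullet> ?N) + Im v * (partial \<i> X (z + of_real u * v) \<bullet> ?N)" for u
      define q where "q w = (Re v)\<^sup>2 * a w + 2 * Re v * Im v * b w + (Im v)\<^sup>2 * d w" for w
      have dd: "((\<lambda>u. F (z + of_real u * v) \<bullet> ?N) has_real_derivative
          Re v * (partial 1 F (z + of_real u * v) \<bullet> ?N) + Im v * (partial \<i> F (z + of_real u * v) \<bullet> ?N)) (at u)"
        if "F differentiable (at (z + of_real u * v))" for F :: "complex \<Rightarrow> real^3" and u
      proof -
        have "((\<lambda>w. F w \<bullet> ?N) has_derivative (\<lambda>h. Re h * (partial 1 F (z + of_real u * v) \<bullet> ?N)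
            + Im h * (partial \<i> F (z + of_real u * v) \<bullet> ?N))) (at (z + of_real u * v))"
          using has_derivative_inner_left[OF partial_works(2)[OF that], of ?N] by (simp add: inner_add_left)
        then show ?thesis by (rule has_real_derivative_along_line)
      qed
      have g1: "(g has_real_derivative g' u) (at u)" if "0 \<le> u" "u \<le> 1" for u
        unfolding g_def[abs_def] g'_def by (rule dd[OF Ck2(1)[OF segW[OF that]]])
      have g2: "(g' has_real_derivative q (z + of_real u * v)) (at u)" if "0 \<le> u" "u \<le> 1" for u
        unfolding g'_def[abs_def] q_def
        by (rule DERIV_cong[OF DERIV_add[OF DERIV_cmult[OF dd[OF Ck2(2)[OF segW[OF that]]]] DERIV_cmult[OF dd[OF Ck2(2)[OF segW[OF that]]]]]])
          (simp add: a_def b_def d_def H_def power2_eq_square algebra_simps add_divide_distrib)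
      have qpos: "q (z + of_real u * v) > 0" if "0 \<le> u" "u \<le> 1" for u
      proof -
        have "z + of_real u * v \<in> A \<inter> B" using seg[OF that] \<delta>(2) by blast
        moreover have "Re v \<noteq> 0 \<or> Im v \<noteq> 0" using w(2) by (auto simp: v_def complex_eq_iff)
        ultimately show ?thesis unfolding q_def by (intro quadratic_form_pos) (auto simp: A_def B_def)
      qed
      have "\<exists>\<xi>. 0 < \<xi> \<and> \<xi> < 1 \<and> g 1 - g 0 = (1 - 0) * g' \<xi>"
        by (rule MVT2) (auto intro: g1)
      then obtain \<xi> where \<xi>: "0 < \<xi>" "\<xi> < 1" "g 1 - g 0 = g' \<xi>" by auto
      have "\<exists>\<eta>. 0 < \<eta> \<and> \<eta> < \<xi> \<and> g' \<xi> - g' 0 = (\<xi> - 0) * q (z + of_real \<eta> * v)"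
        using \<xi> by (intro MVT2 g2) auto
      then obtain \<eta> where \<eta>: "0 < \<eta>" "\<eta> < \<xi>" "g' \<xi> - g' 0 = \<xi> * q (z + of_real \<eta> * v)" by auto
      have "g' 0 = D z v \<bullet> ?N" by (simp add: g'_def D_def inner_add_left)
      then have "g' 0 = 0" using D_conormal[OF z] by simp
      then have "g 1 - g 0 > 0" using \<xi> \<eta> qpos[of \<eta>] by simp
      then show "(X w - X z) \<bullet> ?N > 0" by (simp add: g_def v_def inner_diff_left)
    qed
  qed
qed

text \<open>The height in the direction \<open>n\<close> has a local minimum at \<open>z\<close>, so
  its differential is zero there.\<close>

lemma support_orthogonal:
  assumes z: "z \<in> W" and V: "open V" "z \<in> V" "V \<subseteq> W" and n: "\<And>w. w \<in> V \<Longrightarrow> (X w - X z) \<bullet> n \<ge> 0"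
  shows "D z v \<bullet> n = 0"
proof -
  have "((\<lambda>w. X w \<bullet> n) has_derivative (\<lambda>v. D z v \<bullet> n)) (at z)"
    by (rule has_derivative_inner_left[OF has_derivative_D[OF z]])
  then have "(\<lambda>v. D z v \<bullet> n) = (\<lambda>v. 0)"
    by (rule differential_zero_maxmin[OF V(2,1)]) (use n in \<open>auto simp: inner_diff_left\<close>)
  then show ?thesis by meson
qed

lemma unit_orthogonal_unique:
  assumes z: "z \<in> W" and n: "norm n = 1" "\<And>v. D z v \<bullet> n = 0"
  shows "n = conormal z \<or> n = - conormal z"
proof -
  let ?c = "cross3 (partial 1 X z) (partial \<i> X z)"
  have o: "partial 1 X z \<bullet> n = 0" "partial \<i> X z \<bullet> n = 0" using n(2)[of 1] n(2)[of \<i>] by (auto simp: D_def)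
  have "cross3 n ?c = 0" unfolding Lagrange using o by (simp add: inner_commute)
  moreover have "conormal z = (sgn (H 1 1 z \<bullet> unit_normal X z) / norm ?c) *\<^sub>R ?c"
    by (simp add: conormal_def unit_normal_def Let_def divide_inverse)
  ultimately have c0: "cross3 n (conormal z) = 0" by (simp add: cross_mult_right)
  have "(n \<bullet> conormal z)\<^sup>2 = 1"
    using norm_cross_dot[of n "conormal z"] c0 n(1) norm_conormal[OF z] by simp
  then have "n \<bullet> conormal z = 1 \<or> n \<bullet> conormal z = - 1" by (simp add: power2_eq_1_iff)
  moreover have "n \<bullet> n = 1" "conormal z \<bullet> conormal z = 1" using n(1) norm_conormal[OF z] by (simp_all add: norm_eq_1)
  ultimately have "(n - conormal z) \<bullet> (n - conormal z) = 0 \<or> (n + conormal z) \<bullet> (n + conormal z) = 0"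
    by (auto simp: inner_diff inner_add inner_commute)
  then show ?thesis by (auto simp: eq_neg_iff_add_eq_0)
qed

end

section \<open>Charts and the canonical normal\<close>

lemma chartD:
  assumes "is_chart M (U, \<phi>)"
  shows "openin M U" "open (\<phi> ` U)" "inj_on \<phi> U"
    "\<And>V. openin M V \<Longrightarrow> V \<subseteq> U \<Longrightarrow> open (\<phi> ` V)"
    "\<And>B. open B \<Longrightarrow> openin M {p \<in> U. \<phi> p \<in> B}"
    "continuous_map (subtopology M U) euclidean \<phi>"
    "continuous_map (top_of_set (\<phi> ` U)) M (inv_into U \<phi>)"
proof -
  show U: "openin M U" and W: "open (\<phi> ` U)" using assms by (auto simp: is_chart_def)
  have h: "homeomorphic_map (subtopology M U) (top_of_set (\<phi> ` U)) \<phi>" using assms by (simp add: is_chart_def)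
  have ts: "topspace (subtopology M U) = U" using openin_subset[OF U] by (simp add: Int_absorb1)
  show inj: "inj_on \<phi> U" using homeomorphic_imp_injective_map[OF h] unfolding ts .
  show "open (\<phi> ` V)" if V: "openin M V" "V \<subseteq> U" for V
  proof -
    have "openin (subtopology M U) V" using V U by (simp add: openin_open_subtopology)
    then have "openin (top_of_set (\<phi> ` U)) (\<phi> ` V)"
      using homeomorphic_imp_open_map[OF h] by (simp add: open_map_def)
    then show ?thesis using W by (simp add: openin_open_eq)
  qed
  show c: "continuous_map (subtopology M U) euclidean \<phi>"
    using homeomorphic_imp_continuous_map[OF h] by (simp add: continuous_map_in_subtopology)
  show "openin M {p \<in> U. \<phi> p \<in> B}" if "open B" for B
    using openin_continuous_map_preimage[OF c, of B] that U unfolding ts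
    by (simp add: openin_open_subtopology)
  obtain g where g: "homeomorphic_maps (subtopology M U) (top_of_set (\<phi> ` U)) \<phi> g"
    using h unfolding homeomorphic_map_maps by blast
  have "g z = inv_into U \<phi> z" if "z \<in> \<phi> ` U" for z
  proof -
    obtain p where p: "p \<in> U" "z = \<phi> p" using \<open>z \<in> \<phi> ` U\<close> by blast
    then have "g (\<phi> p) = p" using g unfolding homeomorphic_maps_def ts by blast
    then show ?thesis using p inj by simp
  qed
  moreover have "continuous_map (top_of_set (\<phi> ` U)) M g"
    using g by (auto simp: homeomorphic_maps_def continuous_map_in_subtopology)
  ultimately show "continuous_map (top_of_set (\<phi> ` U)) M (inv_into U \<phi>)"
    by (auto intro: continuous_map_eq)
qed

lemma chart_pullback:
  assumes c: "is_chart M (U, \<phi>)" and g: "continuous_map (top_of_set S) M g"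
  shows "openin (top_of_set S) {x \<in> S. g x \<in> U}" "continuous_on {x \<in> S. g x \<in> U} (\<lambda>x. \<phi> (g x))"
proof -
  show "openin (top_of_set S) {x \<in> S. g x \<in> U}"
    using openin_continuous_map_preimage[OF g chartD(1)[OF c]] by simp
  let ?T = "{x \<in> S. g x \<in> U}"
  have "continuous_map (top_of_set ?T) M g"
    by (rule continuous_map_from_subtopology_mono[OF g]) auto
  then have "continuous_map (top_of_set ?T) (subtopology M U) g"
    by (auto simp: continuous_map_in_subtopology)
  from continuous_map_compose[OF this chartD(6)[OF c]]
  show "continuous_on ?T (\<lambda>x. \<phi> (g x))" by (simp add: o_def)
qed

lemma loop_chart_domain_open:
  assumes "is_chart M (U, \<phi>)" "is_loop M g"
  shows "open {t. g t \<in> U}"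
  using openin_continuous_map_preimage[of euclideanreal M g U] chartD(1)[OF assms(1)] assms(2)
  by (simp add: is_loop_def)

lemma Ck_on_differentiable: "Ck_on k g S \<Longrightarrow> k > 0 \<Longrightarrow> x \<in> S \<Longrightarrow> g differentiable (at x)"
  by (cases k) auto

lemma frechet_derivative_real:
  fixes g :: "real \<Rightarrow> 'b::real_normed_vector"
  assumes "g differentiable (at t)"
  shows "frechet_derivative g (at t) 1 = vector_derivative g (at t)"
proof -
  have l: "linear (frechet_derivative g (at t))" using assms by (rule linear_frechet_derivative)
  have eq: "frechet_derivative g (at t) h = h *\<^sub>R frechet_derivative g (at t) 1" for h
    using linear_cmul[OF l, of h 1] by simp
  have "(g has_vector_derivative frechet_derivative g (at t) 1) (at t)"
    unfolding has_vector_derivative_def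
    by (rule has_derivative_eq_rhs[OF assms[unfolded frechet_derivative_works]]) (rule ext, rule eq)
  then show ?thesis by (rule vector_derivative_at[symmetric])
qed

locale curved_surface =
  fixes M :: "'a topology" and A :: "'a chart set" and f :: "'a \<Rightarrow> real^3"
  assumes surface: "is_surface 2 M A"
    and immersion: "is_immersion 2 A f"
    and curvature: "positively_curved A f"
begin

lemma chart: "(U, \<phi>) \<in> A \<Longrightarrow> is_chart M (U, \<phi>)"
  using surface by (auto simp: is_surface_def)

lemma covered: "p \<in> topspace M \<Longrightarrow> \<exists>U \<phi>. (U, \<phi>) \<in> A \<and> p \<in> U"
  using surface by (force simp: is_surface_def)

lemma patch:
  assumes c: "(U, \<phi>) \<in> A"
  shows "curved_patch (local_param f (U, \<phi>)) (\<phi> ` U)"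
proof
  show "open (\<phi> ` U)" by (rule chartD(2)[OF chart[OF c]])
  show "Ck_on 2 (local_param f (U, \<phi>)) (\<phi> ` U)" using immersion c by (auto simp: is_immersion_def)
  show "inj (frechet_derivative (local_param f (U, \<phi>)) (at z))" if "z \<in> \<phi> ` U" for z
    using immersion c that unfolding is_immersion_def by blast
  show "gauss_curvature (local_param f (U, \<phi>)) z > 0" if "z \<in> \<phi> ` U" for z
    using curvature c that unfolding positively_curved_def by blast
qed

lemma local_param_chart: "(U, \<phi>) \<in> A \<Longrightarrow> q \<in> U \<Longrightarrow> local_param f (U, \<phi>) (\<phi> q) = f q"
  using chartD(3)[OF chart] by (simp add: local_param_def)

text \<open>Near \<open>p\<close> the surface lies strictly on the side of its tangent plane that \<open>n\<close> points to. This
  characterises the second form's positive normal without reference to a chart.\<close>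

definition supports :: "'a \<Rightarrow> real^3 \<Rightarrow> bool" where
  "supports p n \<longleftrightarrow> norm n = 1 \<and>
     (\<exists>V. openin M V \<and> p \<in> V \<and> (\<forall>q\<in>V. q \<noteq> p \<longrightarrow> (f q - f p) \<bullet> n > 0))"

definition normal :: "'a \<Rightarrow> real^3" where
  "normal p = (THE n. supports p n)"

lemma supports_conormal:
  assumes c: "(U, \<phi>) \<in> A" and p: "p \<in> U"
  shows "supports p (curved_patch.conormal (local_param f (U, \<phi>)) (\<phi> p))"
proof -
  interpret curved_patch "local_param f (U, \<phi>)" "\<phi> ` U" by (rule patch[OF c])
  note ch = chartD[OF chart[OF c]]
  have z: "\<phi> p \<in> \<phi> ` U" using p by simp
  obtain \<delta> where \<delta>: "\<delta> > 0" "ball (\<phi> p) \<delta> \<subseteq> \<phi> ` U"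
    "\<forall>w\<in>ball (\<phi> p) \<delta>. w \<noteq> \<phi> p \<longrightarrow>
      (local_param f (U, \<phi>) w - local_param f (U, \<phi>) (\<phi> p)) \<bullet> conormal (\<phi> p) > 0"
    using strict_support[OF z] .
  show ?thesis unfolding supports_def
  proof (intro conjI exI ballI impI)
    show "norm (conormal (\<phi> p)) = 1" by (rule norm_conormal[OF z])
    show "openin M {q \<in> U. \<phi> q \<in> ball (\<phi> p) \<delta>}" by (intro ch(5)) simp
    show "p \<in> {q \<in> U. \<phi> q \<in> ball (\<phi> p) \<delta>}" using p \<delta> by simp
    fix q assume q: "q \<in> {q \<in> U. \<phi> q \<in> ball (\<phi> p) \<delta>}" "q \<noteq> p"
    then have "\<phi> q \<noteq> \<phi> p" using ch(3) p by (auto dest: inj_onD)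
    then show "(f q - f p) \<bullet> conormal (\<phi> p) > 0"
      using bspec[OF \<delta>(3), of "\<phi> q"] q p local_param_chart[OF c] by simp
  qed
qed

text \<open>A supporting vector is orthogonal to the tangent plane, since \<open>p\<close> minimises
  the height, so it is the conormal up to sign. The opposite sign fails at any nearby point, where
  the two heights would both be positive.\<close>

lemma supports_unique:
  assumes c: "(U, \<phi>) \<in> A" and p: "p \<in> U" and s: "supports p n"
  shows "n = curved_patch.conormal (local_param f (U, \<phi>)) (\<phi> p)"
proof -
  let ?X = "local_param f (U, \<phi>)"
  interpret curved_patch ?X "\<phi> ` U" by (rule patch[OF c])
  note ch = chartD[OF chart[OF c]]
  have z: "\<phi> p \<in> \<phi> ` U" using p by simp
  obtain V where V: "openin M V" "p \<in> V" "\<And>q. q \<in> V \<Longrightarrow> q \<noteq> p \<Longrightarrow> (f q - f p) \<bullet> n > 0" and n: "norm n = 1"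
    using s by (auto simp: supports_def)
  have "openin M (V \<inter> U)" using V(1) ch(1) by blast
  then have op: "open (\<phi> ` (V \<inter> U))" by (rule ch(4)) simp
  have zV: "\<phi> p \<in> \<phi> ` (V \<inter> U)" using V p by blast
  have pos: "(?X w - ?X (\<phi> p)) \<bullet> n > 0" if w: "w \<in> \<phi> ` (V \<inter> U)" "w \<noteq> \<phi> p" for w
  proof -
    obtain q where q: "q \<in> V" "q \<in> U" "w = \<phi> q" using w(1) by blast
    then have "q \<noteq> p" using w(2) by blast
    then show ?thesis using V(3)[OF q(1)] unfolding q(3) local_param_chart[OF c q(2)] local_param_chart[OF c p] by simp
  qed
  then have "(?X w - ?X (\<phi> p)) \<bullet> n \<ge> 0" if "w \<in> \<phi> ` (V \<inter> U)" for w
    using that by (cases "w = \<phi> p") (auto intro: less_imp_le)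
  then have "D (\<phi> p) v \<bullet> n = 0" for v
    by (intro support_orthogonal[OF z op zV]) auto
  then have "n = conormal (\<phi> p) \<or> n = - conormal (\<phi> p)"
    by (rule unit_orthogonal_unique[OF z n])
  moreover have "n \<noteq> - conormal (\<phi> p)"
  proof
    assume neg: "n = - conormal (\<phi> p)"
    obtain \<delta> where \<delta>: "\<delta> > 0" "ball (\<phi> p) \<delta> \<subseteq> \<phi> ` U"
      "\<forall>w\<in>ball (\<phi> p) \<delta>. w \<noteq> \<phi> p \<longrightarrow> (?X w - ?X (\<phi> p)) \<bullet> conormal (\<phi> p) > 0"
      using strict_support[OF z] .
    obtain \<epsilon> where \<epsilon>: "\<epsilon> > 0" "ball (\<phi> p) \<epsilon> \<subseteq> \<phi> ` (V \<inter> U)" using op zV unfolding open_contains_ball by blast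
    \<comment> \<open>Any point other than \<open>\<phi> p\<close> in both balls would do; this one
      lies at half of the smaller radius.\<close>
    define w where "w = \<phi> p + of_real (min \<delta> \<epsilon> / 2)"
    have m: "0 < min \<delta> \<epsilon> / 2" "min \<delta> \<epsilon> / 2 < \<delta>" "min \<delta> \<epsilon> / 2 < \<epsilon>"
      using \<delta>(1) \<epsilon>(1) by linarith+
    have "dist (\<phi> p) w = min \<delta> \<epsilon> / 2" using m(1) by (simp add: w_def dist_norm)
    then have "w \<in> ball (\<phi> p) \<delta>" "w \<in> ball (\<phi> p) \<epsilon>" "w \<noteq> \<phi> p" using m by auto
    then have "(?X w - ?X (\<phi> p)) \<bullet> conormal (\<phi> p) > 0" "(?X w - ?X (\<phi> p)) \<bullet> n > 0"
      using \<delta>(3) pos \<epsilon>(2) by blast+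
    then show False by (simp add: neg)
  qed
  ultimately show ?thesis by blast
qed

text \<open>The left side mentions no chart, so the conormals of overlapping charts agree and the
  local continuity of \<open>conormal\<close> becomes that of one global field.\<close>

lemma normal_eq:
  assumes c: "(U, \<phi>) \<in> A" and p: "p \<in> U"
  shows "normal p = curved_patch.conormal (local_param f (U, \<phi>)) (\<phi> p)"
  unfolding normal_def using supports_conormal[OF c p] supports_unique[OF c p] by (rule the_equality)

lemma norm_normal: "p \<in> topspace M \<Longrightarrow> norm (normal p) = 1"
proof -
  assume "p \<in> topspace M"
  then obtain U \<phi> where c: "(U, \<phi>) \<in> A" "p \<in> U" using covered by blast
  then show ?thesis
    using curved_patch.norm_conormal[OF patch[OF c(1)], of "\<phi> p"] by (simp add: normal_eq)
qed

lemma continuous_on_normal: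
  fixes S :: "'b::t2_space set"
  assumes g: "continuous_map (top_of_set S) M g"
  shows "continuous_on S (\<lambda>x. normal (g x))"
proof (rule continuous_on_locally)
  fix x assume x: "x \<in> S"
  then have "g x \<in> topspace M" using g by (auto simp: continuous_map_def)
  then obtain U \<phi> where c: "(U, \<phi>) \<in> A" "g x \<in> U" using covered by blast
  let ?T = "{x \<in> S. g x \<in> U}"
  note pb = chart_pullback[OF chart[OF c(1)] g]
  have "continuous_on ?T (\<lambda>x. curved_patch.conormal (local_param f (U, \<phi>)) (\<phi> (g x)))"
    by (rule continuous_on_compose2[OF curved_patch.continuous_on_conormal[OF patch[OF c(1)]] pb(2)]) auto
  then have "continuous_on ?T (\<lambda>x. normal (g x))"
    by (rule continuous_on_eq) (simp add: normal_eq[OF c(1)])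
  then show "\<exists>T. openin (top_of_set S) T \<and> x \<in> T \<and> continuous_on T (\<lambda>x. normal (g x))"
    using pb(1) x c(2) by blast
qed

lemma loop_velocity:
  assumes g: "immersed_loop k M A g" "k > 0" and c: "(U, \<phi>) \<in> A" and t: "g t \<in> U"
  shows "((f \<circ> g) has_vector_derivative
     curved_patch.D (local_param f (U, \<phi>)) (\<phi> (g t)) (vector_derivative (\<phi> \<circ> g) (at t))) (at t)"
    "vector_derivative (\<phi> \<circ> g) (at t) \<noteq> 0"
proof -
  let ?X = "local_param f (U, \<phi>)"
  interpret curved_patch ?X "\<phi> ` U" by (rule patch[OF c])
  have loop: "is_loop M g" and ck: "Ck_on k (\<phi> \<circ> g) {t. g t \<in> U}"
    using g(1) c by (auto simp: immersed_loop_def)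
  show "vector_derivative (\<phi> \<circ> g) (at t) \<noteq> 0" using g(1) c t by (auto simp: immersed_loop_def)
  have "(\<phi> \<circ> g) differentiable (at t)" using Ck_on_differentiable[OF ck g(2)] t by simp
  then have v: "((\<phi> \<circ> g) has_vector_derivative vector_derivative (\<phi> \<circ> g) (at t)) (at t)"
    by (simp add: vector_derivative_works)
  have z: "(\<phi> \<circ> g) t \<in> \<phi> ` U" using t by simp
  have "((\<lambda>t. ?X ((\<phi> \<circ> g) t)) has_vector_derivative D ((\<phi> \<circ> g) t) (vector_derivative (\<phi> \<circ> g) (at t))) (at t)"
    using has_derivative_compose[OF v[unfolded has_vector_derivative_def] has_derivative_D[OF z]]
    by (simp add: has_vector_derivative_def D_def algebra_simps)
  then show "((f \<circ> g) has_vector_derivative D (\<phi> (g t)) (vector_derivative (\<phi> \<circ> g) (at t))) (at t)"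
    using has_vector_derivative_transform_within_open[OF _ loop_chart_domain_open[OF chart[OF c] loop], of _ _ t "f \<circ> g"]
      local_param_chart[OF c] t by simp
qed

lemma loop_in_topspace: "is_loop M g \<Longrightarrow> g t \<in> topspace M"
  by (auto simp: is_loop_def continuous_map_def)

lemma loop_velocity_tangent:
  assumes g: "immersed_loop k M A g" "k > 0"
  shows "((f \<circ> g) has_vector_derivative vector_derivative (f \<circ> g) (at t)) (at t)"
    "vector_derivative (f \<circ> g) (at t) \<noteq> 0"
    "vector_derivative (f \<circ> g) (at t) \<bullet> normal (g t) = 0"
proof -
  have "g t \<in> topspace M" using g loop_in_topspace by (auto simp: immersed_loop_def)
  then obtain U \<phi> where c: "(U, \<phi>) \<in> A" "g t \<in> U" using covered by blast
  note v = loop_velocity[OF g c]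
  have z: "\<phi> (g t) \<in> \<phi> ` U" using c by simp
  show "((f \<circ> g) has_vector_derivative vector_derivative (f \<circ> g) (at t)) (at t)"
    using v(1) by (simp add: vector_derivative_at)
  show "vector_derivative (f \<circ> g) (at t) \<noteq> 0" "vector_derivative (f \<circ> g) (at t) \<bullet> normal (g t) = 0"
    unfolding vector_derivative_at[OF v(1)] normal_eq[OF c]
    by (rule curved_patch.D_nonzero[OF patch[OF c(1)] z v(2)] curved_patch.D_conormal[OF patch[OF c(1)] z])+
qed

lemma loop_periodic_velocity:
  assumes "immersed_loop k M A g" "k > 0"
  shows "vector_derivative (f \<circ> g) (at (t + 2 * pi)) = vector_derivative (f \<circ> g) (at t)"
  using derivative_periodic[of "f \<circ> g" "\<lambda>t. vector_derivative (f \<circ> g) (at t)" "2 * pi" t]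
    loop_velocity_tangent(1)[OF assms] assms(1)
  by (simp add: immersed_loop_def is_loop_def)

lemma tantrix_sgn: "tantrix f g t = sgn (vector_derivative (f \<circ> g) (at t))"
  by (simp add: tantrix_def Let_def sgn_div_norm)

lemma orthonormal_tantrix_normal:
  assumes g: "immersed_loop k M A g" "k > 0"
  shows "orthonormal2 (tantrix f g t) (normal (g t))"
proof -
  have "g t \<in> topspace M" using g loop_in_topspace by (auto simp: immersed_loop_def)
  then show ?thesis
    using loop_velocity_tangent(2,3)[OF g, of t] norm_normal
    by (simp add: orthonormal2_def tantrix_sgn norm_sgn) (simp add: sgn_div_norm)
qed

text \<open>Continuity of the velocities is given chart by chart, and the charts change along the
  homotopy. The velocity in space is free of charts; locally it is the differential of the
  parametrisation applied to the chart velocity, hence continuous in both variables, and the frame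
  with the normal follows.\<close>

lemma even_frame_regular_homotopy:
  assumes h: "regularly_homotopic M A \<alpha> \<beta>" and e: "even_frame (tantrix f \<beta>) (\<lambda>t. normal (\<beta> t))"
  shows "even_frame (tantrix f \<alpha>) (\<lambda>t. normal (\<alpha> t))"
proof -
  obtain h where h: "h 0 = \<alpha>" "h 1 = \<beta>" "\<forall>s\<in>{0..1}. immersed_loop 1 M A (h s)"
    "continuous_map (top_of_set ({0..1} \<times> UNIV)) M (\<lambda>(s::real, t). h s t)"
    and hv: "\<forall>(U, \<phi>)\<in>A. continuous_on {(s, t). s \<in> {0..1} \<and> h s t \<in> U}
       (\<lambda>(s, t). vector_derivative (\<phi> \<circ> h s) (at t))"
    using h unfolding regularly_homotopic_def by blast
  note h3 = bspec[OF h(3)]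
  have h5: "continuous_on {(s, t). s \<in> {0..1} \<and> h s t \<in> U} (\<lambda>(s, t). vector_derivative (\<phi> \<circ> h s) (at t))"
    if "(U, \<phi>) \<in> A" for U \<phi>
    using bspec[OF hv that] by simp
  let ?K = "{0..1::real} \<times> (UNIV :: real set)"
  define E where "E p = vector_derivative (f \<circ> h (fst p)) (at (snd p))" for p
  have cE: "continuous_on ?K E"
  proof (rule continuous_on_locally)
    fix p assume p: "p \<in> ?K"
    have "h (fst p) (snd p) \<in> topspace M"
      using h3[of "fst p"] p loop_in_topspace by (auto simp: immersed_loop_def)
    then obtain U \<phi> where c: "(U, \<phi>) \<in> A" "h (fst p) (snd p) \<in> U" using covered by blast
    let ?T = "{p \<in> ?K. (case p of (s, t) \<Rightarrow> h s t) \<in> U}"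
    note pb = chart_pullback[OF chart[OF c(1)] h(4)]
    have T: "?T = {(s, t). s \<in> {0..1} \<and> h s t \<in> U}" by auto
    have "continuous_on ?T (\<lambda>p. curved_patch.D (local_param f (U, \<phi>)) (\<phi> (case p of (s, t) \<Rightarrow> h s t))
        ((\<lambda>(s, t). vector_derivative (\<phi> \<circ> h s) (at t)) p))"
      by (rule curved_patch.continuous_on_D[OF patch[OF c(1)] pb(2) h5[OF c(1), folded T]]) auto
    then have "continuous_on ?T E"
    proof (rule continuous_on_eq)
      fix q assume q: "q \<in> ?T"
      have "immersed_loop 1 M A (h (fst q))" using q by (intro h3) auto
      moreover have "h (fst q) (snd q) \<in> U" using q by auto
      ultimately show "curved_patch.D (local_param f (U, \<phi>)) (\<phi> (case q of (s, t) \<Rightarrow> h s t))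
        ((\<lambda>(s, t). vector_derivative (\<phi> \<circ> h s) (at t)) q) = E q"
        using vector_derivative_at[OF loop_velocity(1)[OF _ zero_less_one c(1)]]
        by (simp add: E_def case_prod_unfold)
    qed
    then show "\<exists>T. openin (top_of_set ?K) T \<and> p \<in> T \<and> continuous_on T E"
      using pb(1) p c(2) by (intro exI[of _ ?T]) (auto simp: case_prod_unfold)
  qed
  have E0: "E p \<noteq> 0" if "p \<in> ?K" for p
  proof -
    have "immersed_loop 1 M A (h (fst p))" using that by (intro h3) auto
    then show ?thesis unfolding E_def by (rule loop_velocity_tangent(2)) simp
  qed
  have "even_frame (tantrix f (h 0)) (\<lambda>t. normal (h 0 t))"
  \<comment> \<open>Run from parameter 1 back to 0, since evenness is known at the end
    \<open>\<beta>\<close>.\<close>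
  proof (rule even_frame_homotopy[of "\<lambda>s. tantrix f (h s)" "\<lambda>s t. normal (h s t)" 1 0])
    have "continuous_on ?K (\<lambda>p. sgn (E p))" using cE E0 by (intro continuous_on_sgn) auto
    then show "continuous_on ?K (\<lambda>(s, t). tantrix f (h s) t)"
      by (simp add: tantrix_sgn E_def case_prod_unfold)
    show "continuous_on ?K (\<lambda>(s, t). normal (h s t))"
      using continuous_on_normal[OF h(4)] by (simp add: case_prod_unfold)
    fix s t :: real assume s: "s \<in> {0..1}"
    show "orthonormal2 (tantrix f (h s) t) (normal (h s t))"
      by (rule orthonormal_tantrix_normal[OF h3[OF s]]) simp
    show "tantrix f (h s) (t + 2 * pi) = tantrix f (h s) t"
      unfolding tantrix_sgn using loop_periodic_velocity[OF h3[OF s]] by simp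
    show "normal (h s (t + 2 * pi)) = normal (h s t)"
      using h3[OF s] by (simp add: immersed_loop_def is_loop_def)
  qed (use e h(2) in auto)
  then show ?thesis by (simp add: h(1))
qed

end

section \<open>Figure-eights in a coordinate disc and the tangent frame of the tantrix\<close>

context curved_surface
begin

text \<open>The disc is compatible with the atlas but may fail to belong to it, so immersion and
  tangency are carried over by the transition map \<open>\<xi>\<close>. Its inverse
  \<open>\<eta>\<close> is differentiable too, which makes the differential of \<open>\<xi>\<close>
  injective.\<close>

lemma disc_param:
  fixes U \<phi>
  defines "Y \<equiv> f \<circ> inv_into U \<phi>"
  assumes c: "coordinate_disc 2 M A (U, \<phi>)"
  shows "\<And>x. x \<in> \<phi> ` U \<Longrightarrow> Y differentiable (at x)"
    "\<And>x v. x \<in> \<phi> ` U \<Longrightarrow> v \<noteq> 0 \<Longrightarrow> frechet_derivative Y (at x) v \<noteq> 0"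
    "\<And>x v. x \<in> \<phi> ` U \<Longrightarrow> frechet_derivative Y (at x) v \<bullet> normal (inv_into U \<phi> x) = 0"
    "\<And>v. continuous_on (\<phi> ` U) (\<lambda>x. frechet_derivative Y (at x) v)"
proof -
  have ch: "is_chart M (U, \<phi>)" and comp: "\<And>d. d \<in> A \<Longrightarrow> compatible 2 (U, \<phi>) d"
    using c by (auto simp: coordinate_disc_def)
  note cU = chartD[OF ch]
  have main: "open (\<phi> ` (U \<inter> V))" "Y differentiable (at x)"
    "v \<noteq> 0 \<Longrightarrow> frechet_derivative Y (at x) v \<noteq> 0"
    "frechet_derivative Y (at x) v \<bullet> normal (inv_into U \<phi> x) = 0"
    "continuous_on (\<phi> ` (U \<inter> V)) (\<lambda>x. frechet_derivative Y (at x) v)"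
    if V: "(V, \<psi>) \<in> A" and x: "x \<in> \<phi> ` (U \<inter> V)" for V \<psi> x v
  proof -
    let ?X = "local_param f (V, \<psi>)"
    interpret curved_patch ?X "\<psi> ` V" by (rule patch[OF V])
    note cV = chartD[OF chart[OF V]]
    define \<xi> where "\<xi> = \<psi> \<circ> inv_into U \<phi>"
    define \<eta> where "\<eta> = \<phi> \<circ> inv_into V \<psi>"
    have UV: "openin M (U \<inter> V)" using cU(1) cV(1) by blast
    show op: "open (\<phi> ` (U \<inter> V))" by (rule cU(4)[OF UV]) simp
    have le: "enat 1 \<le> 2" by (simp add: numeral_eq_enat)
    have "Ck_on 1 \<xi> (\<phi> ` (U \<inter> V))" "Ck_on 1 \<eta> (\<psi> ` (U \<inter> V))"
      using comp[OF V] le unfolding compatible_def Cr_on_def \<xi>_def \<eta>_def prod.case by blast+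
    then have d: "\<And>y. y \<in> \<phi> ` (U \<inter> V) \<Longrightarrow> \<xi> differentiable (at y)"
      "\<And>y. y \<in> \<psi> ` (U \<inter> V) \<Longrightarrow> \<eta> differentiable (at y)"
      "\<And>v. continuous_on (\<phi> ` (U \<inter> V)) (\<lambda>y. frechet_derivative \<xi> (at y) v)"
      by auto
    have inv: "inv_into U \<phi> (\<phi> p) = p" "inv_into V \<psi> (\<psi> p) = p" if "p \<in> U \<inter> V" for p
      using that cU(3) cV(3) by auto
    have pt: "\<xi> y \<in> \<psi> ` (U \<inter> V)" "\<eta> (\<xi> y) = y" "inv_into U \<phi> y \<in> V" "Y y = ?X (\<xi> y)"
      "\<xi> y = \<psi> (inv_into U \<phi> y)" if y: "y \<in> \<phi> ` (U \<inter> V)" for y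
    proof -
      obtain p where p: "p \<in> U \<inter> V" "y = \<phi> p" using y by blast
      show "\<xi> y \<in> \<psi> ` (U \<inter> V)" "\<eta> (\<xi> y) = y" "inv_into U \<phi> y \<in> V" "\<xi> y = \<psi> (inv_into U \<phi> y)" "Y y = ?X (\<xi> y)"
        using p inv[OF p(1)] by (auto simp: \<xi>_def \<eta>_def Y_def local_param_def)
    qed
    have dY: "(Y has_derivative (\<lambda>v. D (\<xi> y) (frechet_derivative \<xi> (at y) v))) (at y)" if y: "y \<in> \<phi> ` (U \<inter> V)" for y
    proof -
      have "\<xi> y \<in> \<psi> ` V" using pt(1)[OF y] by auto
      from has_derivative_compose[OF d(1)[OF y, unfolded frechet_derivative_works] has_derivative_D[OF this]]
      show ?thesis by (rule has_derivative_transform_within_open[OF _ op y]) (simp add: pt(4))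
    qed
    have fY: "frechet_derivative Y (at y) v = D (\<xi> y) (frechet_derivative \<xi> (at y) v)"
      if y: "y \<in> \<phi> ` (U \<inter> V)" for y v
      using frechet_derivative_at[OF dY[OF y]] by metis
    show "Y differentiable (at x)" using dY[OF x] by (auto simp: differentiable_def)
    have xW: "\<xi> x \<in> \<psi> ` V" using pt(1)[OF x] by auto
    show "frechet_derivative Y (at x) v \<bullet> normal (inv_into U \<phi> x) = 0"
      unfolding fY[OF x] normal_eq[OF V pt(3)[OF x]] pt(5)[OF x, symmetric] by (rule D_conormal[OF xW])
    have "frechet_derivative \<xi> (at x) v \<noteq> 0" if "v \<noteq> 0"
    proof
      assume 0: "frechet_derivative \<xi> (at x) v = 0"
      have "((\<lambda>y. \<eta> (\<xi> y)) has_derivative (\<lambda>v. frechet_derivative \<eta> (at (\<xi> x)) (frechet_derivative \<xi> (at x) v))) (at x)"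
        by (rule has_derivative_compose[OF d(1)[OF x, unfolded frechet_derivative_works]
              d(2)[OF pt(1)[OF x], unfolded frechet_derivative_works]])
      then have "((\<lambda>y. y) has_derivative (\<lambda>v. frechet_derivative \<eta> (at (\<xi> x)) (frechet_derivative \<xi> (at x) v))) (at x)"
        by (rule has_derivative_transform_within_open[OF _ op x]) (simp add: pt(2))
      from has_derivative_unique[OF this has_derivative_ident]
      have "v = frechet_derivative \<eta> (at (\<xi> x)) 0" using 0 by metis
      also have "\<dots> = 0" by (rule linear_0[OF linear_frechet_derivative[OF d(2)[OF pt(1)[OF x]]]])
      finally show False using that by simp
    qed
    then show "frechet_derivative Y (at x) v \<noteq> 0" if "v \<noteq> 0"
      unfolding fY[OF x] using D_nonzero[OF xW] that by blast
    have "continuous_on (\<phi> ` (U \<inter> V)) \<xi>"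
      by (rule continuous_at_imp_continuous_on) (intro ballI differentiable_imp_continuous_within d(1))
    then have "continuous_on (\<phi> ` (U \<inter> V)) (\<lambda>y. D (\<xi> y) (frechet_derivative \<xi> (at y) v))"
      by (rule continuous_on_D[OF _ d(3)]) (use pt(1) in blast)
    then show "continuous_on (\<phi> ` (U \<inter> V)) (\<lambda>x. frechet_derivative Y (at x) v)"
      by (rule continuous_on_eq) (rule fY[symmetric])
  qed
  have cov: "\<exists>V \<psi>. (V, \<psi>) \<in> A \<and> x \<in> \<phi> ` (U \<inter> V)" if x: "x \<in> \<phi> ` U" for x
  proof -
    obtain p where p: "p \<in> U" "x = \<phi> p" using x by blast
    then have "p \<in> topspace M" using openin_subset[OF cU(1)] by blast
    then show ?thesis using covered p by blast
  qed
  show "Y differentiable (at x)" if "x \<in> \<phi> ` U" for x using cov[OF that] main(2) by blast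
  show "frechet_derivative Y (at x) v \<noteq> 0" if "x \<in> \<phi> ` U" "v \<noteq> 0" for x v
    using cov[OF that(1)] main(3) that(2) by blast
  show "frechet_derivative Y (at x) v \<bullet> normal (inv_into U \<phi> x) = 0" if "x \<in> \<phi> ` U" for x v
    using cov[OF that] main(4) by blast
  show "continuous_on (\<phi> ` U) (\<lambda>x. frechet_derivative Y (at x) v)" for v
  proof (rule continuous_on_locally)
    fix x assume x: "x \<in> \<phi> ` U"
    then obtain V \<psi> where V: "(V, \<psi>) \<in> A" "x \<in> \<phi> ` (U \<inter> V)" using cov by blast
    have "openin (top_of_set (\<phi> ` U)) (\<phi> ` (U \<inter> V))"
      using main(1)[OF V] cU(2) by (auto simp: openin_open_eq)
    then show "\<exists>T. openin (top_of_set (\<phi> ` U)) T \<and> x \<in> T \<and> continuous_on T (\<lambda>x. frechet_derivative Y (at x) v)"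
      using main(5)[OF V] V(2) by blast
  qed
qed

lemma even_frame_constant:
  assumes "orthonormal2 u v"
  shows "even_frame (\<lambda>t. u) (\<lambda>t. v)"
proof -
  obtain q where "norm q = 1" "spin q = (u, v)" using spin_surj[OF assms] .
  then show ?thesis by (auto simp: even_frame_def spin_lift_def intro!: exI[of _ "\<lambda>t. q"])
qed

text \<open>Shrinking the disc to a point and, simultaneously, the velocity angle of the figure-eight to zero
  deforms the frame to a constant.\<close>

lemma even_frame_disc_figure_eight:
  assumes c: "coordinate_disc 2 M A (U, \<phi>)"
    and \<beta>: "\<And>t. \<beta> t \<in> U \<and> \<phi> (\<beta> t) = standard_figure_eight t"
  shows "even_frame (tantrix f \<beta>) (\<lambda>t. normal (\<beta> t))"
proof -
  define \<iota> where "\<iota> = inv_into U \<phi>"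
  define Y where "Y = f \<circ> \<iota>"
  note Y = disc_param[OF c, folded \<iota>_def, folded Y_def]
  have ch: "is_chart M (U, \<phi>)" using c by (simp add: coordinate_disc_def)
  obtain z0 \<rho> where ball: "\<phi> ` U = ball z0 \<rho>" "\<rho> > 0" using c by (auto simp: coordinate_disc_def)
  obtain r \<theta> where p: "polar_loop standard_figure_eight r \<theta> 0"
    using turning_number_figure_eight by (auto simp: turning_number_def)
  have r: "r t > 0" and \<theta>: "continuous_on UNIV \<theta>" and per: "\<theta> (t + 2 * pi) = \<theta> t"
    and d: "(standard_figure_eight has_vector_derivative of_real (r t) * cis (\<theta> t)) (at t)" for t
    using p by (auto simp: polar_loop_def)
  have fp: "standard_figure_eight (t + 2 * pi) = standard_figure_eight t" for t
    by (rule standard_figure_eight_periodic)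
  have fc: "continuous_on UNIV standard_figure_eight"
    using d by (meson continuous_at_imp_continuous_on has_vector_derivative_continuous)
  have in_ball: "standard_figure_eight t \<in> ball z0 \<rho>" for t
    using \<beta>[of t] ball(1) by (metis image_eqI)
  have \<iota>\<beta>: "\<iota> (standard_figure_eight t) = \<beta> t" for t
    using \<beta>[of t] chartD(3)[OF ch] unfolding \<iota>_def by (metis inv_into_f_f)
  define x where "x s t = z0 + of_real s * (standard_figure_eight t - z0)" for s t :: real
  have xB: "x s t \<in> ball z0 \<rho>" if "s \<in> {0..1}" for s t
  proof -
    have "dist z0 (x s t) = s * dist z0 (standard_figure_eight t)"
      using that by (simp add: x_def dist_norm norm_mult norm_minus_commute)
    also have "\<dots> \<le> 1 * dist z0 (standard_figure_eight t)" using that by (intro mult_right_mono) auto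
    finally show ?thesis using in_ball[of t] by simp
  qed
  let ?K = "{0..1::real} \<times> (UNIV :: real set)"
  have cx: "continuous_on ?K (\<lambda>p. x (fst p) (snd p))"
    unfolding x_def by (intro continuous_intros continuous_on_compose2[OF fc]) auto
  define G where "G z v = frechet_derivative Y (at z) v" for z v
  have G: "G z v \<noteq> 0" if "z \<in> ball z0 \<rho>" "v \<noteq> 0" for z v
    unfolding G_def using Y(2) that ball(1) by blast
  have Gn: "G z v \<bullet> normal (\<iota> z) = 0" if "z \<in> ball z0 \<rho>" for z v
    unfolding G_def using Y(3) that ball(1) by blast
  have Gd: "G z v = Re v *\<^sub>R G z 1 + Im v *\<^sub>R G z \<i>" if "z \<in> ball z0 \<rho>" for z v
    using partial_works(1)[OF Y(1), of z v] that ball(1) by (simp add: G_def partial_def)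
  have cG: "continuous_on (ball z0 \<rho>) (\<lambda>z. G z v)" for v
    using Y(4)[of v] unfolding ball(1) G_def .
  \<comment> \<open>The turning number is 0, so \<open>\<theta>\<close> itself is periodic and every
    multiple \<open>s * \<theta>\<close> is the angle of a closed family; at \<open>s = 0\<close>
    the direction is constantly 1. The speed is left out because only the direction of the velocity
    enters the frame.\<close>
  define E where "E s t = G (x s t) (cis (s * \<theta> t))" for s t
  have E0: "E s t \<noteq> 0" if "s \<in> {0..1}" for s t
    unfolding E_def by (intro G xB that) (metis cis_neq_zero)
  have "continuous_on ?K (\<lambda>p. Re (cis (fst p * \<theta> (snd p))) *\<^sub>R G (x (fst p) (snd p)) 1
      + Im (cis (fst p * \<theta> (snd p))) *\<^sub>R G (x (fst p) (snd p)) \<i>)"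
    by (intro continuous_intros continuous_on_compose2[OF cG cx] continuous_on_compose2[OF \<theta>]) (use xB in auto)
  then have cE: "continuous_on ?K (\<lambda>p. E (fst p) (snd p))"
    unfolding E_def
  proof (rule continuous_on_eq)
    fix p assume "p \<in> ?K"
    then have "x (fst p) (snd p) \<in> ball z0 \<rho>" by (intro xB) auto
    then show "Re (cis (fst p * \<theta> (snd p))) *\<^sub>R G (x (fst p) (snd p)) 1
      + Im (cis (fst p * \<theta> (snd p))) *\<^sub>R G (x (fst p) (snd p)) \<i> = G (x (fst p) (snd p)) (cis (fst p * \<theta> (snd p)))"
      by (rule Gd[symmetric])
  qed
  have c\<iota>: "continuous_map (top_of_set (ball z0 \<rho>)) M \<iota>"
    using chartD(7)[OF ch] unfolding ball(1) \<iota>_def .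
  have nB: "norm (normal (\<iota> z)) = 1" if "z \<in> ball z0 \<rho>" for z
    using that c\<iota> by (intro norm_normal) (auto simp: continuous_map_def)
  have "even_frame (\<lambda>t. sgn (E 1 t)) (\<lambda>t. normal (\<iota> (x 1 t)))"
  proof (rule even_frame_homotopy[of "\<lambda>s t. sgn (E s t)" "\<lambda>s t. normal (\<iota> (x s t))" 0 1])
    show "continuous_on ?K (\<lambda>(s, t). sgn (E s t))"
      unfolding case_prod_unfold using cE E0 by (intro continuous_on_sgn) auto
    show "continuous_on ?K (\<lambda>(s, t). normal (\<iota> (x s t)))"
      unfolding case_prod_unfold
      by (rule continuous_on_compose2[OF continuous_on_normal[OF c\<iota>] cx]) (use xB in auto)
    fix s t :: real assume s: "s \<in> {0..1}"
    show "orthonormal2 (sgn (E s t)) (normal (\<iota> (x s t)))"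
      using E0[OF s] nB[OF xB[OF s]] Gn[OF xB[OF s], of t "cis (s * \<theta> t)"]
      by (simp add: orthonormal2_def norm_sgn) (simp add: sgn_div_norm E_def)
    show "sgn (E s (t + 2 * pi)) = sgn (E s t)" "normal (\<iota> (x s (t + 2 * pi))) = normal (\<iota> (x s t))"
      by (simp_all add: E_def x_def fp per)
  next
    have "orthonormal2 (sgn (G z0 1)) (normal (\<iota> z0))"
      using ball(2) G[of z0 1] nB[of z0] Gn[of z0 1]
      by (simp add: orthonormal2_def norm_sgn) (simp add: sgn_div_norm)
    then show "even_frame (\<lambda>t. sgn (E 0 t)) (\<lambda>t. normal (\<iota> (x 0 t)))"
      using even_frame_constant by (simp add: E_def x_def)
  qed auto
  moreover have "\<iota> (x 1 t) = \<beta> t" for t using \<iota>\<beta> by (simp add: x_def)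
  moreover have "sgn (E 1 t) = tantrix f \<beta> t" for t
  proof -
    have z: "standard_figure_eight t \<in> ball z0 \<rho>" by (rule in_ball)
    have "Y differentiable (at (standard_figure_eight t))" using Y(1) z ball(1) by blast
    from has_derivative_compose[OF d[of t, unfolded has_vector_derivative_def] this[unfolded frechet_derivative_works]]
    have "((\<lambda>t. Y (standard_figure_eight t)) has_derivative
        (\<lambda>h. G (standard_figure_eight t) (h *\<^sub>R (of_real (r t) * cis (\<theta> t))))) (at t)" by (simp add: G_def)
    moreover have lin: "G (standard_figure_eight t) (h *\<^sub>R v) = h *\<^sub>R G (standard_figure_eight t) v" for h v
      using Gd[OF z, of "h *\<^sub>R v"] Gd[OF z, of v] by (simp add: scaleR_add_right)
    moreover have "(\<lambda>t. Y (standard_figure_eight t)) = f \<circ> \<beta>" by (auto simp: Y_def \<iota>\<beta>)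
    ultimately have "((f \<circ> \<beta>) has_vector_derivative G (standard_figure_eight t) (of_real (r t) * cis (\<theta> t))) (at t)"
      by (simp add: has_vector_derivative_def)
    then have "vector_derivative (f \<circ> \<beta>) (at t) = r t *\<^sub>R G (standard_figure_eight t) (cis (\<theta> t))"
      unfolding lin[symmetric] by (simp add: vector_derivative_at scaleR_conv_of_real)
    then show ?thesis using r[of t] by (simp add: tantrix_sgn E_def x_def sgn_scaleR)
  qed
  ultimately show ?thesis by simp
qed

text \<open>The acceleration is the differential applied to the second derivative in the chart, plus
  the Hessian on the chart velocity. The first part is tangent, so the component along the normal is
  the second form on a nonzero vector, which is positive.\<close>

lemma loop_acceleration:
  assumes g: "immersed_loop 2 M A g"
  defines "v \<equiv> \<lambda>t. vector_derivative (f \<circ> g) (at t)"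
  obtains w where "\<And>t. (v has_vector_derivative w t) (at t)" "continuous_on UNIV w"
    "\<And>t. w t \<bullet> normal (g t) > 0"
proof -
  have loop: "is_loop M g" using g by (simp add: immersed_loop_def)
  have local: "\<exists>T w. open T \<and> t \<in> T \<and> continuous_on T w \<and>
      (\<forall>t\<in>T. (v has_vector_derivative w t) (at t) \<and> w t \<bullet> normal (g t) > 0)" for t
  proof -
    obtain U \<phi> where c: "(U, \<phi>) \<in> A" "g t \<in> U" using covered[OF loop_in_topspace[OF loop]] by blast
    let ?X = "local_param f (U, \<phi>)"
    interpret curved_patch ?X "\<phi> ` U" by (rule patch[OF c(1)])
    define T where "T = {t. g t \<in> U}"
    have T: "open T" unfolding T_def by (rule loop_chart_domain_open[OF chart[OF c(1)] loop])
    define a where "a = \<phi> \<circ> g"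
    define a' where "a' t = frechet_derivative a (at t) 1" for t
    define a'' where "a'' t = vector_derivative a' (at t)" for t
    have ck: "Ck_on (Suc (Suc 0)) a T"
      using g c(1) unfolding immersed_loop_def a_def T_def numeral_2_eq_2 by blast
    then have da: "a differentiable (at t)" and da': "a' differentiable (at t)" if "t \<in> T" for t
      using that by (auto simp: a'_def[abs_def])
    have ca'': "continuous_on T a''"
    proof (rule continuous_on_eq)
      show "continuous_on T (\<lambda>t. frechet_derivative a' (at t) 1)" using ck by (simp add: a'_def[abs_def])
      show "frechet_derivative a' (at t) 1 = a'' t" if "t \<in> T" for t
        unfolding a''_def by (rule frechet_derivative_real[OF da'[OF that]])
    qed
    have a1: "vector_derivative a (at t) = a' t" if "t \<in> T" for t
      unfolding a'_def by (rule frechet_derivative_real[OF da[OF that], symmetric])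
    have va: "(a has_vector_derivative a' t) (at t)" if "t \<in> T" for t
      using da[OF that] unfolding vector_derivative_works a1[OF that] .
    have va': "(a' has_vector_derivative a'' t) (at t)" if "t \<in> T" for t
      using da'[OF that] unfolding vector_derivative_works a''_def .
    have aW: "a t \<in> \<phi> ` U" if "t \<in> T" for t using that by (simp add: a_def T_def)
    have v_eq: "v t = D (a t) (a' t)" if "t \<in> T" for t
    proof -
      have "g t \<in> U" using that by (simp add: T_def)
      from vector_derivative_at[OF loop_velocity(1)[OF g _ c(1) this]]
      show ?thesis using a1[OF that] by (simp add: v_def a_def)
    qed
    have a0: "a' t \<noteq> 0" if "t \<in> T" for t
      using loop_velocity(2)[OF g _ c(1), of t] a1[OF that] that by (simp add: T_def a_def)
    define q where "q u t = Re (a' t) *\<^sub>R H 1 u (a t) + Im (a' t) *\<^sub>R H \<i> u (a t)" for u t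
    have vq: "((\<lambda>t. partial u ?X (a t)) has_vector_derivative q u t) (at t)" if "t \<in> T" for u t
      using has_derivative_compose[OF va[OF that, unfolded has_vector_derivative_def]
          partial_works(2)[OF Ck2(2)[OF aW[OF that]]]]
      by (simp add: has_vector_derivative_def q_def H_def algebra_simps)
    define w where "w t = (Re (a'' t) *\<^sub>R partial 1 ?X (a t) + Re (a' t) *\<^sub>R q 1 t) +
        (Im (a'' t) *\<^sub>R partial \<i> ?X (a t) + Im (a' t) *\<^sub>R q \<i> t)" for t
    have re: "((\<lambda>t. Re (a' t)) has_real_derivative Re (a'' t)) (at t)"
      "((\<lambda>t. Im (a' t)) has_real_derivative Im (a'' t)) (at t)" if "t \<in> T" for t
      using va'[OF that] by (simp_all add: has_vector_derivative_complex_iff)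
    have vD: "((\<lambda>t. D (a t) (a' t)) has_vector_derivative w t) (at t)" if t: "t \<in> T" for t
      unfolding D_def w_def
      by (rule has_vector_derivative_eq_rhs[OF has_vector_derivative_add[OF
            has_vector_derivative_scaleR[OF re(1)[OF t] vq[OF t]]
            has_vector_derivative_scaleR[OF re(2)[OF t] vq[OF t]]]]) (simp add: add.commute)
    have vw: "(v has_vector_derivative w t) (at t)" if t: "t \<in> T" for t
      by (rule has_vector_derivative_transform_within_open[OF vD[OF t] T t]) (rule v_eq[symmetric])
    have pos: "w t \<bullet> normal (g t) > 0" if t: "t \<in> T" for t
    proof -
      have gt: "g t \<in> U" and at: "\<phi> (g t) = a t" using t by (simp_all add: T_def a_def)
      have "partial 1 ?X (a t) \<bullet> conormal (a t) = 0" "partial \<i> ?X (a t) \<bullet> conormal (a t) = 0"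
        using D_conormal[OF aW[OF t], of 1] D_conormal[OF aW[OF t], of \<i>] by (simp_all add: D_def)
      then have "w t \<bullet> conormal (a t) = (Re (a' t) *\<^sub>R q 1 t + Im (a' t) *\<^sub>R q \<i> t) \<bullet> conormal (a t)"
        by (simp add: w_def inner_add_left)
      then show ?thesis
        using hessian_pos[OF aW[OF t] a0[OF t]] unfolding normal_eq[OF c(1) gt] at q_def by simp
    qed
    have ca: "continuous_on T a" "continuous_on T a'"
      using da da' by (meson continuous_at_imp_continuous_on differentiable_imp_continuous_within)+
    have "continuous_on T (\<lambda>t. partial u ?X (a t))" "continuous_on T (\<lambda>t. H y u (a t))" for y u
      by (rule continuous_on_compose2[OF continuous_partial ca(1)] continuous_on_compose2[OF Ck2(3) ca(1)];
          use aW in blast)+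
    then have "continuous_on T w"
      unfolding w_def q_def using ca'' ca(2) by (intro continuous_intros)
    then show ?thesis using T c(2) vw pos by (intro exI[of _ T] exI[of _ w]) (auto simp: T_def)
  qed
  \<comment> \<open>All chartwise accelerations are derivatives of the same \<open>v\<close>, so
    they agree on overlaps and glue.\<close>
  define w where "w t = vector_derivative v (at t)" for t
  have w: "(v has_vector_derivative w t) (at t)" "w t \<bullet> normal (g t) > 0" for t
    using local[of t] vector_derivative_at unfolding w_def by (metis, metis)
  moreover have "continuous_on UNIV w"
  proof (rule continuous_on_locally)
    fix t :: real
    obtain T u where T: "open T" "t \<in> T" "continuous_on T u" "\<forall>t\<in>T. (v has_vector_derivative u t) (at t)"
      using local[of t] by blast
    have "continuous_on T w"
      by (rule continuous_on_eq[OF T(3)]) (use T(4) vector_derivative_at w_def in metis)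
    then show "\<exists>T. openin (top_of_set UNIV) T \<and> t \<in> T \<and> continuous_on T w" using T by auto
  qed
  ultimately show ?thesis using that by blast
qed

theorem tantrix_even:
  assumes "figure_eight 2 2 M A \<alpha>"
  obtains \<tau>' where "sphere_loop (tantrix f \<alpha>) \<tau>'" "even_frame (tantrix f \<alpha>) (\<lambda>t. sgn (\<tau>' t))"
proof -
  obtain \<beta> U \<phi> where g: "immersed_loop 2 M A \<alpha>" and h: "regularly_homotopic M A \<alpha> \<beta>"
    and disc: "coordinate_disc 2 M A (U, \<phi>)" "\<And>t. \<beta> t \<in> U \<and> \<phi> (\<beta> t) = standard_figure_eight t"
    using assms unfolding figure_eight_def by blast
  let ?\<tau> = "tantrix f \<alpha>"
  define v where "v t = vector_derivative (f \<circ> \<alpha>) (at t)" for t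
  note v = loop_velocity_tangent[OF g zero_less_numeral, folded v_def]
  obtain w where w: "\<And>t. (v has_vector_derivative w t) (at t)" "continuous_on UNIV w"
    "\<And>t. w t \<bullet> normal (\<alpha> t) > 0"
    using loop_acceleration[OF g] unfolding v_def[abs_def] by blast
  define \<tau>' where "\<tau>' t = (w t - (w t \<bullet> sgn (v t)) *\<^sub>R sgn (v t)) /\<^sub>R norm (v t)" for t
  have \<tau>: "?\<tau> = (\<lambda>t. sgn (v t))" by (simp add: tantrix_sgn v_def fun_eq_iff)
  have d: "(?\<tau> has_vector_derivative \<tau>' t) (at t)" for t
    unfolding \<tau> \<tau>'_def by (rule has_vector_derivative_sgn[OF w(1) v(2)])
  have cv: "continuous_on UNIV v"
    using w(1) by (meson continuous_at_imp_continuous_on has_vector_derivative_continuous)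
  have c': "continuous_on UNIV \<tau>'"
    unfolding \<tau>'_def[abs_def] using v(2) by (intro continuous_intros continuous_on_sgn w(2) cv) auto
  have pos: "\<tau>' t \<bullet> normal (\<alpha> t) > 0" for t
  proof -
    have "sgn (v t) \<bullet> normal (\<alpha> t) = 0" using v(3)[of t] by (simp add: sgn_div_norm)
    then have "\<tau>' t \<bullet> normal (\<alpha> t) = (w t \<bullet> normal (\<alpha> t)) / norm (v t)"
      by (simp add: \<tau>'_def inner_diff_left divide_inverse mult.commute)
    then show ?thesis using w(3)[of t] v(2)[of t] by simp
  qed
  have n1: "norm (?\<tau> t) = 1" for t using v(2) by (simp add: \<tau> norm_sgn)
  have per: "?\<tau> (t + 2 * pi) = ?\<tau> t" for t
    using loop_periodic_velocity[OF g] by (simp add: tantrix_sgn)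
  have "\<tau>' t \<noteq> 0" for t using pos[of t] by auto
  with c' d n1 per have loop: "sphere_loop ?\<tau> \<tau>'" by (simp add: sphere_loop_def)
  have e: "even_frame ?\<tau> (\<lambda>t. normal (\<alpha> t))"
    by (rule even_frame_regular_homotopy[OF h even_frame_disc_figure_eight[OF disc]])
  have al: "is_loop M \<alpha>" using g by (simp add: immersed_loop_def)
  have cn: "continuous_on UNIV (\<lambda>t. normal (\<alpha> t))"
    using al by (intro continuous_on_normal) (simp add: is_loop_def)
  have nn: "norm (normal (\<alpha> t)) = 1" for t by (rule norm_normal[OF loop_in_topspace[OF al]])
  let ?K = "{0..1::real} \<times> (UNIV :: real set)"
  \<comment> \<open>The segment from \<open>\<tau>'\<close> to the normal. Both ends pair positively
    with the normal, so the segment avoids 0, and both are orthogonal to the tantrix, so normalising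
    keeps the frame orthonormal.\<close>
  define F where "F s t = (1 - s) *\<^sub>R \<tau>' t + s *\<^sub>R normal (\<alpha> t)" for s t
  have F0: "F s t \<noteq> 0" if "s \<in> {0..1}" for s t
  proof
    assume "F s t = 0"
    then have "F s t \<bullet> normal (\<alpha> t) = 0" by simp
    then have 0: "(1 - s) * (\<tau>' t \<bullet> normal (\<alpha> t)) + s = 0"
      using nn[of t] by (simp add: F_def inner_add_left norm_eq_1)
    have "(1 - s) * (\<tau>' t \<bullet> normal (\<alpha> t)) \<ge> 0" using that pos[of t] by simp
    then have "s = 0" using 0 that by auto
    then show False using 0 pos[of t] by simp
  qed
  have per': "\<tau>' (t + 2 * pi) = \<tau>' t" for t by (rule derivative_periodic[OF d per])
  have ct: "continuous_on UNIV ?\<tau>" by (rule sphere_loop_continuous[OF loop])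
  have tan: "?\<tau> t \<bullet> F s t = 0" for s t
    using sphere_loop_tangent[OF d n1, of t] v(3)[of t]
    by (simp add: F_def inner_add_right) (simp add: \<tau> sgn_div_norm)
  have "even_frame ?\<tau> (\<lambda>t. sgn (F 0 t))"
  proof (rule even_frame_homotopy[of "\<lambda>s. ?\<tau>" "\<lambda>s t. sgn (F s t)" 1 0])
    show "continuous_on ?K (\<lambda>(s, t). ?\<tau> t)"
      unfolding case_prod_unfold by (rule continuous_on_compose2[OF ct]) (auto intro!: continuous_intros)
    have "continuous_on ?K (\<lambda>p. F (fst p) (snd p))"
      unfolding F_def
      by (intro continuous_intros continuous_on_compose2[OF c'] continuous_on_compose2[OF cn]) auto
    then show "continuous_on ?K (\<lambda>(s, t). sgn (F s t))"
      unfolding case_prod_unfold using F0 by (intro continuous_on_sgn) auto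
    fix s t :: real assume s: "s \<in> {0..1}"
    show "orthonormal2 (?\<tau> t) (sgn (F s t))"
      using n1[of t] tan[of t s] F0[OF s] by (simp add: orthonormal2_def norm_sgn) (simp add: sgn_div_norm)
    show "sgn (F s (t + 2 * pi)) = sgn (F s t)"
      using al by (simp add: F_def per' is_loop_def)
  next
    have "sgn (F 1 t) = normal (\<alpha> t)" for t using nn[of t] by (simp add: F_def sgn_div_norm)
    then show "even_frame ?\<tau> (\<lambda>t. sgn (F 1 t))" using e by simp
  qed (auto simp: per)
  then have "even_frame ?\<tau> (\<lambda>t. sgn (\<tau>' t))" by (simp add: F_def)
  with loop show ?thesis by (rule that)
qed

end

theorem proposition2p5:
  fixes M :: "'a topology" and A :: "'a chart set" and f :: "'a \<Rightarrow> real^3"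
  assumes "is_surface 2 M A"
    and "is_immersion 2 A f"
    and "positively_curved A f"
  shows "(\<forall>\<alpha>. figure_eight 2 2 M A \<alpha> \<longrightarrow> figure_eight \<infinity> 1 S2 S2_atlas (tantrix f \<alpha>)) \<and>
    \<not> (\<exists>\<alpha>. figure_eight 2 2 M A \<alpha> \<and> skew_loop f \<alpha>)"
proof -
  interpret curved_surface M A f by (unfold_locales; fact)
  have "figure_eight \<infinity> 1 S2 S2_atlas (tantrix f \<alpha>)" "\<not> skew_loop f \<alpha>" if fig: "figure_eight 2 2 M A \<alpha>" for \<alpha>
  proof -
    obtain \<tau>' where \<tau>: "sphere_loop (tantrix f \<alpha>) \<tau>'" "even_frame (tantrix f \<alpha>) (\<lambda>t. sgn (\<tau>' t))"
      using tantrix_even[OF fig] .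
    show "figure_eight \<infinity> 1 S2 S2_atlas (tantrix f \<alpha>)" by (rule even_sphere_loop_figure_eight[OF \<tau>])
    show "\<not> skew_loop f \<alpha>"
    proof
      assume skew: "skew_loop f \<alpha>"
      have g: "immersed_loop 2 M A \<alpha>" using fig by (simp add: figure_eight_def)
      \<comment> \<open>Tantrix vectors are positive multiples of the velocities, so skewness passes
        to them.\<close>
      have "cross3 (tantrix f \<alpha> t) (tantrix f \<alpha> s) \<noteq> 0" if "\<nexists>m::int. t - s = 2 * pi * of_int m" for s t
      proof -
        have "cross3 (vector_derivative (f \<circ> \<alpha>) (at t)) (vector_derivative (f \<circ> \<alpha>) (at s)) \<noteq> 0"
          using skew that unfolding skew_loop_def by blast
        then show ?thesis
          using loop_velocity_tangent(2)[OF g]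
          by (simp add: tantrix_sgn sgn_div_norm cross_mult_left cross_mult_right)
      qed
      from skew_frame_not_even[OF \<tau>(1) this] \<tau>(2) show False by blast
    qed
  qed
  then show ?thesis by blast
qed

end
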